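(* Let $n\ge 2$, $1/2<s<1$, let $\Omega\subset\mathbb{R}^n$ be open, and let $u:\mathbb{R}^n\to\mathbb{R}$ be Lipschitz continuous with constant $L$ and semiconcave with constant $SC$. Assume that for some constant $\eta_0>0$, $$(1-s)F_{2,s}[u](x)\ge \eta_0\quad\text{for every }x\in\Omega,\ \text{in the viscosity sense}.$$ Then $$F_{2,s}[u](x)=F_{2,s}^{\epsilon_0}[u](x)\quad\text{for every }x\in\Omega,\ \text{in the classical (pointwise) sense},$$ where $\epsilon_0=\epsilon_0(\eta_0,n,s,L,SC)>0$ is given by $$\epsilon_0=\sqrt{\frac{n}{n-1}}\;C_4^{1/s}\Big(\frac{\mu_0}{\mu_1}\Big)^{1/s},$$ with the constants $C_4,\mu_0,\mu_1$ (depending only on $n,s,\eta_0,L,SC$) defined in the context.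
   Context: For $u:\mathbb{R}^n\to\mathbb{R}$ put $\delta(u,x,y)=u(x+y)+u(x-y)-2u(x)$. $u$ is semiconcave with constant $SC\ge 0$ if it is continuous and $\delta(u,x,y)\le SC|y|^2$ for all $x,y$. Let $\Gamma_2$ be the set of real symmetric $n\times n$ matrices $B$ whose eigenvalues $\lambda=(\lambda_1,\dots,\lambda_n)$ satisfy $\sigma_1(\lambda)>0$ and $\sigma_2(\lambda)>0$, where $\sigma_1(\lambda)=\sum_i\lambda_i$, $\sigma_2(\lambda)=\sum_{i<j}\lambda_i\lambda_j$; put $f_2(B)=\sigma_2(\lambda)^{1/2}$. Let $\mathcal{M}_2$ be the set of matrices $M$ for which there is $B=(b_{ij})\in\Gamma_2$ with $M_{ii}=\frac{1}{2f_2(B)}\sum_{j\ne i}b_{jj}$ and $M_{ij}=-\frac{1}{2f_2(B)}b_{ji}$ for $i\neq j$ (that is, $M=Df_2(B)$). Every $M\in\mathcal{M}_2$ is symmetric positive definite, and $\lambda_{\min}(M)$ denotes its smallest eigenvalue. Define $$F_{2,s}[u](x)=\inf_{M\in\mathcal{M}_2}\frac12\int_{\mathbb{R}^n}\frac{\delta(u,x,y)}{|\sqrt{M}^{-1}y|^{n+2s}}\det\sqrt{M}^{-1}\,dy,$$ and, for $\epsilon_0>0$, let $F_{2,s}^{\epsilon_0}[u](x)$ be the same infimum restricted to those $M\in\mathcal{M}_2$ with $\lambda_{\min}(M)\ge\epsilon_0$. Viscosity sense (standard): $(1-s)F_{2,s}[u]\ge\eta_0$ at $x$ means that whenever $\varphi$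 is $C^2$ in a neighbourhood $N$ of $x$, $\varphi(x)=u(x)$ and $\varphi\ge u$ in $N$, the function $w$ equal to $\varphi$ in $N$ and to $u$ outside $N$ satisfies $(1-s)F_{2,s}[w](x)\ge\eta_0$. Constants: $$C_1=\int_{\mathbb{R}}\frac{\min\{2L|t|,SC|t|^2\}}{|t|^{1+2s}}dt,\quad C_2=\int_{\mathbb{R}^{n-1}}\frac{d\bar z}{(1+|\bar z|^2)^{(n+2s)/2}},\quad C_3=\int_{\mathbb{R}}\frac{dt}{(1+t^2)^{(n+2s)/2}},$$ $$g(\epsilon)=\Big(\frac{1}{4\epsilon}+\frac{n-2}{2(n-1)}\epsilon\Big)^{-1/2},\qquad \epsilon_1=\Big(\frac{\eta_0}{2(1-s)C_1C_2}\Big)^{1/s},\qquad \mu_0=\frac{\eta_0}{2C_3}g(\epsilon_1)^{2s},$$ $$\mu_1=(1-s)\int_{\mathbb{R}^{n-1}}\frac{\min\{2L|\bar z|,SC|\bar z|^2\}}{|\bar z|^{n-1+2s}}d\bar z,\qquad C_4=\frac12\sqrt{\Big(1-\frac{\mu_0}{2\mu_1}\Big)^{-2/(n+2s)}-1}.$$ *)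

theory Defs
  imports "HOL-Analysis.Analysis"
begin

definition second_diff :: "(real^'n \<Rightarrow> real) \<Rightarrow> real^'n \<Rightarrow> real^'n \<Rightarrow> real" where
  "second_diff u x y = u (x + y) + u (x - y) - 2 * u x"

definition semiconcave :: "real \<Rightarrow> (real^'n \<Rightarrow> real) \<Rightarrow> bool" where
  "semiconcave SC u \<longleftrightarrow> 0 \<le> SC \<and> continuous_on UNIV u \<and>
     (\<forall>x y. second_diff u x y \<le> SC * (norm y)\<^sup>2)"

(* The eigenvalues with multiplicity, as the roots of the characteristic polynomial.
   They are determined up to order only (and exist for symmetric B); everything below
   depends on them symmetrically, so the choice is immaterial. *)
definition eigenvalues :: "real^'n^'n \<Rightarrow> real^'n" where
  "eigenvalues B = (SOME l. \<forall>t. det (mat t - B) = (\<Prod>i\<in>UNIV. t - l $ i))"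

(* Elementary symmetric function; a k-element index set I stands for i_1 < ... < i_k. *)
definition sigma :: "nat \<Rightarrow> real^'n \<Rightarrow> real" where
  "sigma k l = (\<Sum>I | card I = k. \<Prod>i\<in>I. l $ i)"

definition Gamma2 :: "(real^'n^'n) set" where
  "Gamma2 = {B. transpose B = B \<and> sigma 1 (eigenvalues B) > 0 \<and> sigma 2 (eigenvalues B) > 0}"

definition f2 :: "real^'n^'n \<Rightarrow> real" where
  "f2 B = sqrt (sigma 2 (eigenvalues B))"

definition M2 :: "(real^'n^'n) set" where
  "M2 = {M. \<exists>B\<in>Gamma2.
      (\<forall>i. M $ i $ i = 1 / (2 * f2 B) * (\<Sum>j\<in>UNIV - {i}. B $ j $ j)) \<and>
      (\<forall>i j. i \<noteq> j \<longrightarrow> M $ i $ j = - (1 / (2 * f2 B)) * B $ j $ i)}"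

definition lambda_min :: "real^'n^'n \<Rightarrow> real" where
  "lambda_min M = Min (range (\<lambda>i. eigenvalues M $ i))"

(* The unique symmetric positive semidefinite square root. *)
definition matrix_sqrt :: "real^'n^'n \<Rightarrow> real^'n^'n" where
  "matrix_sqrt M = (THE S. transpose S = S \<and> (\<forall>v. 0 \<le> v \<bullet> (S *v v)) \<and> S ** S = M)"

definition F2_integrand ::
    "real \<Rightarrow> real^'n^'n \<Rightarrow> (real^'n \<Rightarrow> real) \<Rightarrow> real^'n \<Rightarrow> real^'n \<Rightarrow> real" where
  "F2_integrand s M u x y =
     second_diff u x y / norm (matrix_inv (matrix_sqrt M) *v y) powr (real CARD('n) + 2 * s)
       * det (matrix_inv (matrix_sqrt M))"

(* Lebesgue integral with values in [-\<infinity>, \<infinity>], meaningful when the positive or the negative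
   part has finite integral; otherwise Isabelle's \<infinity> - \<infinity> = \<infinity> applies. *)
definition ext_integral :: "(real^'n \<Rightarrow> real) \<Rightarrow> ereal" where
  "ext_integral f =
     enn2ereal (\<integral>\<^sup>+ y. ennreal (f y) \<partial>lborel) - enn2ereal (\<integral>\<^sup>+ y. ennreal (- f y) \<partial>lborel)"

(* Extended values are needed: at a point the integrals for a semiconcave u may be -\<infinity>, those
   for a function w in the viscosity condition may be \<infinity> (the test function is unrestricted
   near the boundary of its neighbourhood), and the infimum may be -\<infinity>. For a semiconcave
   Lipschitz u and 1/2 < s < 1 the case \<infinity> - \<infinity> occurs neither for u nor for such a w. *)
definition F2 :: "real \<Rightarrow> (real^'n \<Rightarrow> real) \<Rightarrow> real^'n \<Rightarrow> ereal" where
  "F2 s u x = (INF M\<in>M2. ereal (1/2) * ext_integral (F2_integrand s M u x))"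

definition F2_restr :: "real \<Rightarrow> real \<Rightarrow> (real^'n \<Rightarrow> real) \<Rightarrow> real^'n \<Rightarrow> ereal" where
  "F2_restr e s u x =
     (INF M\<in>{M \<in> M2. lambda_min M \<ge> e}. ereal (1/2) * ext_integral (F2_integrand s M u x))"

definition C2_on :: "(real^'n) set \<Rightarrow> (real^'n \<Rightarrow> real) \<Rightarrow> bool" where
  "C2_on N p \<longleftrightarrow> (\<exists>(g :: real^'n \<Rightarrow> real^'n) (H :: real^'n \<Rightarrow> real^'n^'n).
     (\<forall>z\<in>N. (p has_derivative (\<lambda>h. g z \<bullet> h)) (at z)) \<and>
     (\<forall>z\<in>N. (g has_derivative (\<lambda>h. H z *v h)) (at z)) \<and>
     continuous_on N H)"

definition viscosity_ge :: "real \<Rightarrow> (real^'n \<Rightarrow> real) \<Rightarrow> real \<Rightarrow> real^'n \<Rightarrow> bool" where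
  "viscosity_ge s u \<eta>0 x \<longleftrightarrow>
     (\<forall>N p. open N \<and> x \<in> N \<and> C2_on N p \<and> p x = u x \<and> (\<forall>z\<in>N. p z \<ge> u z) \<longrightarrow>
        ereal (1 - s) * F2 s (\<lambda>z. if z \<in> N then p z else u z) x \<ge> ereal \<eta>0)"

(* \<real>^(n-1) is rendered by the product measure on the coordinates {..<n - 1}, with Euclidean
   norm L2_set z {..<n - 1}; hence the constants are functions of the number n. *)

abbreviation lborel_pow :: "nat \<Rightarrow> (nat \<Rightarrow> real) measure" where
  "lborel_pow k \<equiv> \<Pi>\<^sub>M i\<in>{..<k}. lborel"

definition const_C1 :: "real \<Rightarrow> real \<Rightarrow> real \<Rightarrow> real" where
  "const_C1 s L SC = (LINT t|lborel. min (2 * L * \<bar>t\<bar>) (SC * \<bar>t\<bar>\<^sup>2) / \<bar>t\<bar> powr (1 + 2 * s))"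

definition const_C2 :: "nat \<Rightarrow> real \<Rightarrow> real" where
  "const_C2 n s =
     (LINT z|lborel_pow (n - 1). 1 / (1 + (L2_set z {..<n - 1})\<^sup>2) powr ((real n + 2 * s) / 2))"

definition const_C3 :: "nat \<Rightarrow> real \<Rightarrow> real" where
  "const_C3 n s = (LINT t|lborel. 1 / (1 + t\<^sup>2) powr ((real n + 2 * s) / 2))"

definition fun_g :: "nat \<Rightarrow> real \<Rightarrow> real" where
  "fun_g n e = (1 / (4 * e) + (real n - 2) / (2 * (real n - 1)) * e) powr (- 1 / 2)"

definition const_eps1 :: "nat \<Rightarrow> real \<Rightarrow> real \<Rightarrow> real \<Rightarrow> real \<Rightarrow> real" where
  "const_eps1 n s \<eta>0 L SC = (\<eta>0 / (2 * (1 - s) * const_C1 s L SC * const_C2 n s)) powr (1 / s)"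

definition const_mu0 :: "nat \<Rightarrow> real \<Rightarrow> real \<Rightarrow> real \<Rightarrow> real \<Rightarrow> real" where
  "const_mu0 n s \<eta>0 L SC =
     \<eta>0 / (2 * const_C3 n s) * fun_g n (const_eps1 n s \<eta>0 L SC) powr (2 * s)"

definition const_mu1 :: "nat \<Rightarrow> real \<Rightarrow> real \<Rightarrow> real \<Rightarrow> real" where
  "const_mu1 n s L SC = (1 - s) *
     (LINT z|lborel_pow (n - 1). min (2 * L * L2_set z {..<n - 1}) (SC * (L2_set z {..<n - 1})\<^sup>2)
        / L2_set z {..<n - 1} powr (real n - 1 + 2 * s))"

definition const_C4 :: "nat \<Rightarrow> real \<Rightarrow> real \<Rightarrow> real \<Rightarrow> real \<Rightarrow> real" where
  "const_C4 n s \<eta>0 L SC = 1/2 * sqrt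
     ((1 - const_mu0 n s \<eta>0 L SC / (2 * const_mu1 n s L SC)) powr (- 2 / (real n + 2 * s)) - 1)"

definition const_eps0 :: "nat \<Rightarrow> real \<Rightarrow> real \<Rightarrow> real \<Rightarrow> real \<Rightarrow> real" where
  "const_eps0 n s \<eta>0 L SC = sqrt (real n / (real n - 1))
     * const_C4 n s \<eta>0 L SC powr (1 / s)
     * (const_mu0 n s \<eta>0 L SC / const_mu1 n s L SC) powr (1 / s)"

end

theory Submission
  imports Defs
begin

text \<open>
  Matrices with a very small eigenvalue are never competitive in the infimum, because such a
  matrix must be huge in all other directions and the operator is bounded below on hyperplanes.

  The set \<open>M2\<close> is one sheet of a quadric: a symmetric \<open>M\<close> belongs to it iff \<open>tr M > 0\<close> and
  \<open>(tr M)^2 / (n - 1) - |M|^2 = 1/2\<close> in the Frobenius norm (\<open>M2_iff\<close>); this uses the spectral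
  theorem only to express the first two elementary symmetric functions of the eigenvalues by
  traces. Substituting \<open>y = X z\<close> with \<open>X X^T = M\<close> turns the integral for \<open>M\<close> into
  \<open>J(X) = \<integral> f(X z) |z|^(-n-2s) dz\<close> with \<open>f(y) = u(x+y) + u(x-y) - 2u(x)\<close>
  (\<open>nn_integral_M2_kernel\<close>), so only \<open>X X^T\<close> matters and \<open>J\<close> is homogeneous of degree \<open>2s\<close>.
  The bound \<open>f(y) \<le> \<rho>(|y|) = min(2L|y|, SC|y|^2)\<close> makes the positive part of every \<open>J(X)\<close> finite.

  From viscosity to pointwise. A semiconcave function is touched from above at every point by
  a paraboloid, so the viscosity condition can be tested everywhere; shrinking the
  neighbourhood gives \<open>J(M) \<ge> 2\<eta>0/(1-s)\<close> for all \<open>M\<close> at every point of \<open>\<Omega>\<close>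
  (\<open>viscosity_pointwise\<close>). In particular no integral is \<open>-\<infinity>\<close>.

  From matrices to hyperplanes. Take a matrix with eigenvalue \<open>\<epsilon>1\<close> in direction \<open>w\<close> and
  \<open>h1 = g(\<epsilon>1)^(-2)\<close> on the orthogonal hyperplane. Averaging over the reflection in \<open>w\<close>,
  semiconcavity in direction \<open>w\<close> allows replacing \<open>f(z)\<close> by \<open>f\<close> at the projection of \<open>z\<close> to
  the hyperplane, at the price of at most a quarter of the lower bound (this is the choice of
  \<open>\<epsilon>1\<close>). Hence the isotropic integral of \<open>f\<close> over every hyperplane is at least a multiple of
  \<open>m = \<mu>0/\<mu>1\<close> times the same integral of \<open>\<rho>\<close> (\<open>hyperplane_lower_bound\<close>).

  Back to matrices. The kernel \<open>((e.y)^2 + \<kappa>|y'|^2)^(-(n+2s)/2)\<close>, where \<open>y'\<close> is the part of \<open>y\<close>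
  orthogonal to \<open>e\<close> and \<open>\<kappa> < 1\<close>, is an exact positive superposition of isotropic kernels on
  hyperplanes: expanding the power in a binomial series with positive coefficients leaves the
  kernels \<open>|y'|^(2k) |y|^(-n-2s-2k)\<close>, and each of these is an average over tilted hyperplanes
  (\<open>tilted_average\<close>). So lower bounds on all hyperplanes integrate, without any loss, to a
  lower bound for the thin kernels (\<open>kernel_integral_lower_bound_from_hyperplanes\<close>).

  Conclusion. Let \<open>M e = \<epsilon> e\<close> with \<open>\<epsilon>\<close> small. The quadric forces the other eigenvalues to
  have mean \<open>h \<ge> 1/(4\<epsilon>)\<close> and relative variance at most \<open>2\<epsilon>^2\<close> (\<open>M2_deviation\<close>). After the
  change of variables by \<open>V = sqrt(M + (h - \<epsilon>) e e^T)\<close> the kernel of \<open>M\<close> is exactly of the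
  above form with \<open>\<kappa> = \<epsilon>/h\<close>, and since \<open>V^2\<close> is close to \<open>h I\<close>, the compressions
  \<open>V (I - (1-\<kappa>) w w^T) V\<close> needed for the hyperplane bounds stay inside the cone over \<open>M2\<close>
  (\<open>cone_estimate\<close>). This yields \<open>J(M) \<ge> (8/5) m h^s Z\<close> with \<open>Z\<close> the hyperplane integral of
  \<open>\<rho>\<close> (\<open>degenerate_value_bound\<close>), which grows like \<open>\<epsilon>^(-s)\<close> and exceeds the value of the
  multiple of the identity in \<open>M2\<close> as soon as \<open>\<epsilon> < \<epsilon>0\<close>. That multiple of the identity
  itself satisfies \<open>\<lambda>_min \<ge> \<epsilon>0\<close>, so discarding all such \<open>M\<close> does not change the infimum.
\<close>

section \<open>The spectral theorem for real symmetric matrices\<close>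

lemma symmetric_inner_swap:
  fixes A :: "real^'n^'n"
  assumes "transpose A = A"
  shows "x \<bullet> (A *v y) = (A *v x) \<bullet> y"
  by (metis assms dot_lmul_matrix vector_transpose_matrix)

lemma nonneg_quadratic_linear_coeff_zero:
  fixes a b :: real
  assumes "\<And>t. 0 \<le> 2 * t * a + t\<^sup>2 * b" "0 \<le> b"
  shows "a = 0"
proof (rule ccontr)
  assume "a \<noteq> 0"
  have "2 * (- a / (b + 1)) * a + (- a / (b + 1))\<^sup>2 * b = - (a\<^sup>2) * (b + 2) / (b + 1)\<^sup>2"
  proof -
    have "b + 1 \<noteq> 0" using assms(2) by simp
    then show ?thesis by (simp add: divide_simps) (simp add: algebra_simps power2_eq_square)
  qed
  also have "\<dots> < 0"
    using assms(2) \<open>a \<noteq> 0\<close> by (simp add: divide_neg_pos)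
  finally show False using assms(1)[of "- a / (b + 1)"] by simp
qed

text \<open>
  A maximizer \<open>x\<close> of the Rayleigh quotient on \<open>W\<close>: the form \<open>c |z|^2 - z.Az\<close> is nonnegative on \<open>W\<close>
  and vanishes at \<open>x\<close>, so its first variation in the direction \<open>c x - A x\<close>, which lies in \<open>W\<close>, is zero.
\<close>

lemma symmetric_eigenvector_in_invariant_subspace:
  fixes A :: "real^'n^'n"
  assumes sym: "transpose A = A" and W: "subspace W" "\<And>w. w \<in> W \<Longrightarrow> A *v w \<in> W"
    and ne: "W \<noteq> {0}"
  obtains x c where "x \<in> W" "norm x = 1" "A *v x = c *\<^sub>R x"
proof -
  obtain w where w: "w \<in> W" "w \<noteq> 0"
    using ne subspace_0[OF W(1)] by blast
  have "w /\<^sub>R norm w \<in> W \<inter> sphere 0 1"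
    using w W(1) by (simp add: subspace_mul)
  moreover have "compact (W \<inter> sphere 0 1)"
    by (simp add: W(1) closed_Int_compact closed_subspace)
  moreover have "continuous_on (W \<inter> sphere 0 1) (\<lambda>x. x \<bullet> (A *v x))"
    by (intro continuous_intros linear_continuous_on bounded_linear_ident matrix_vector_mul_bounded_linear)
  ultimately have "\<exists>x\<in>W \<inter> sphere 0 1. \<forall>y\<in>W \<inter> sphere 0 1. y \<bullet> (A *v y) \<le> x \<bullet> (A *v x)"
    by (intro continuous_attains_sup) blast+
  then obtain x where x: "x \<in> W" "norm x = 1"
    and max: "\<And>y. y \<in> W \<inter> sphere 0 1 \<Longrightarrow> y \<bullet> (A *v y) \<le> x \<bullet> (A *v x)"
    by (metis IntD1 IntD2 mem_sphere_0)
  define c where "c = x \<bullet> (A *v x)"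
  have le: "z \<bullet> (A *v z) \<le> c * (z \<bullet> z)" if "z \<in> W" for z
  proof (cases "z = 0")
    case False
    have "z /\<^sub>R norm z \<in> W \<inter> sphere 0 1" using that W(1) False by (simp add: subspace_mul)
    from max[OF this] have "(z \<bullet> (A *v z)) / (norm z)\<^sup>2 \<le> c"
      by (simp add: c_def scaleR_matrix_vector_assoc[symmetric] matrix_vector_mult_scaleR
          divide_inverse power2_eq_square mult_ac)
    then show ?thesis using False by (simp add: divide_le_eq power2_norm_eq_inner)
  qed simp
  \<comment> \<open>the direction in which the nonnegative form would decrease unless \<open>x\<close> is an eigenvector\<close>
  define y where "y = c *\<^sub>R x - A *v x"
  have y: "y \<in> W" using x W by (simp add: y_def subspace_diff subspace_mul)
  have "0 \<le> 2 * t * (y \<bullet> y) + t\<^sup>2 * (c * (y \<bullet> y) - y \<bullet> (A *v y))" for t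
  proof -
    have "x + t *\<^sub>R y \<in> W" using x y W by (simp add: subspace_add subspace_mul)
    from le[OF this] have "0 \<le> c * ((x + t *\<^sub>R y) \<bullet> (x + t *\<^sub>R y)) - (x + t *\<^sub>R y) \<bullet> (A *v (x + t *\<^sub>R y))"
      by simp
    also have "\<dots> = (c * (x \<bullet> x) - x \<bullet> (A *v x)) + 2 * t * (c * (x \<bullet> y) - (A *v x) \<bullet> y)
        + t\<^sup>2 * (c * (y \<bullet> y) - y \<bullet> (A *v y))"
      using symmetric_inner_swap[OF sym, of x y] symmetric_inner_swap[OF sym, of y x]
      by (simp add: inner_add_left inner_add_right matrix_vector_right_distrib
          matrix_vector_mult_scaleR algebra_simps power2_eq_square inner_commute)
    also have "c * (x \<bullet> x) - x \<bullet> (A *v x) = 0"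
      using x by (simp add: c_def norm_eq_1)
    also have "c * (x \<bullet> y) - (A *v x) \<bullet> y = y \<bullet> y"
      by (simp add: y_def inner_diff_left inner_diff_right inner_commute right_diff_distrib)
    finally show ?thesis by simp
  qed
  moreover have "0 \<le> c * (y \<bullet> y) - y \<bullet> (A *v y)" using le[OF y] by simp
  ultimately have "y \<bullet> y = 0" by (rule nonneg_quadratic_linear_coeff_zero)
  then have "A *v x = c *\<^sub>R x" by (simp add: y_def)
  with x that show ?thesis by blast
qed

text \<open>
  Induction on the dimension: split off one eigenvector and pass to its orthogonal complement in \<open>W\<close>.
\<close>

lemma symmetric_orthonormal_eigenvectors:
  fixes A :: "real^'n^'n"
  assumes sym: "transpose A = A"
  shows "subspace W \<Longrightarrow> (\<And>w. w \<in> W \<Longrightarrow> A *v w \<in> W) \<Longrightarrow>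
    \<exists>B. finite B \<and> card B = dim W \<and> B \<subseteq> W \<and> pairwise orthogonal B \<and>
      (\<forall>b\<in>B. norm b = 1 \<and> (\<exists>c. A *v b = c *\<^sub>R b))"
proof (induction "dim W" arbitrary: W)
  case 0
  then show ?case by (intro exI[of _ "{}"]) auto
next
  case (Suc d)
  have "W \<noteq> {0}" using Suc.hyps(2) by auto
  then obtain x c where x: "x \<in> W" "norm x = 1" "A *v x = c *\<^sub>R x"
    using symmetric_eigenvector_in_invariant_subspace[OF sym Suc.prems(1) Suc.prems(2)] by metis
  define W' where "W' = {w \<in> W. \<forall>v\<in>span {x}. orthogonal v w}"
  have W'_eq: "W' = {w \<in> W. x \<bullet> w = 0}"
    using x by (auto simp: W'_def orthogonal_def span_singleton)
  have "x \<noteq> 0" using x by auto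
  have "dim W' + dim (span {x}) = dim W" unfolding W'_def
    by (rule dim_subspace_orthogonal_to_vectors) (use x Suc.prems in \<open>auto simp: span_minimal\<close>)
  with \<open>x \<noteq> 0\<close> Suc.hyps have d: "d = dim W'" by (simp add: dim_singleton)
  have sub: "subspace W'" using Suc.prems(1) unfolding W'_eq subspace_def by (auto simp: inner_add_right)
  have inv: "A *v w \<in> W'" if "w \<in> W'" for w
    using that symmetric_inner_swap[OF sym, of x w] x Suc.prems(2) by (auto simp: W'_eq)
  obtain B where B: "finite B" "card B = dim W'" "B \<subseteq> W'" "pairwise orthogonal B"
      "\<forall>b\<in>B. norm b = 1 \<and> (\<exists>c. A *v b = c *\<^sub>R b)"
    using Suc.hyps(1)[OF d sub inv] by blast
  have "x \<notin> B" using B(3) x by (auto simp: W'_eq norm_eq_1)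
  then have "finite (insert x B) \<and> card (insert x B) = dim W \<and> insert x B \<subseteq> W \<and>
      pairwise orthogonal (insert x B) \<and> (\<forall>b\<in>insert x B. norm b = 1 \<and> (\<exists>c. A *v b = c *\<^sub>R b))"
    using B x d Suc.hyps(2) by (auto simp: W'_eq pairwise_insert orthogonal_def inner_commute subset_iff)
  then show ?case by blast
qed

theorem symmetric_orthonormal_eigenbasis:
  fixes A :: "real^'n^'n"
  assumes "transpose A = A"
  obtains b :: "'n \<Rightarrow> real^'n" and l :: "'n \<Rightarrow> real"
  where "\<And>i j. b i \<bullet> b j = (if i = j then 1 else 0)" "\<And>i. A *v b i = l i *\<^sub>R b i"
proof -
  obtain B where B: "finite B" "card B = CARD('n)" "pairwise orthogonal B"
      "\<forall>b\<in>B. norm b = 1 \<and> (\<exists>c. A *v b = c *\<^sub>R (b::real^'n))"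
    using symmetric_orthonormal_eigenvectors[OF assms, of UNIV] by auto
  obtain b where b: "bij_betw b (UNIV::'n set) B"
    using finite_same_card_bij[of "UNIV::'n set" B] B by auto
  have bB: "b i \<in> B" for i using b by (auto simp: bij_betw_def)
  have "\<forall>i. \<exists>c. A *v b i = c *\<^sub>R b i" using B(4) bB by blast
  then obtain l where "\<And>i. A *v b i = l i *\<^sub>R b i" by metis
  moreover have "b i \<bullet> b j = (if i = j then 1 else 0)" for i j
  proof (cases "i = j")
    case True then show ?thesis using B(4) bB[of i] by (auto simp: norm_eq_1)
  next
    case False
    then have "b i \<noteq> b j" using b by (auto simp: bij_betw_def inj_on_def)
    then show ?thesis using B(3) bB False by (auto simp: pairwise_def orthogonal_def)
  qed
  ultimately show ?thesis using that by blast
qed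

section \<open>Eigenvalues, elementary symmetric functions and the quadric M2\<close>

lemma matrix_of_orthonormal_columns:
  fixes b :: "'n \<Rightarrow> real^'n"
  assumes "\<And>i j. b i \<bullet> b j = (if i = j then 1 else 0)"
  defines "P \<equiv> \<chi> i j. b j $ i"
  shows "transpose P ** P = mat 1" "P ** transpose P = mat 1"
proof -
  show 1: "transpose P ** P = mat 1"
    using assms(1) by (simp add: P_def transpose_def matrix_matrix_mult_def mat_def vec_eq_iff inner_vec_def)
  then show "P ** transpose P = mat 1"
    by (simp add: matrix_left_right_inverse)
qed

lemma trace_in_orthonormal_basis:
  fixes A :: "real^'n^'n" and b :: "'n \<Rightarrow> real^'n"
  assumes "\<And>i j. b i \<bullet> b j = (if i = j then 1 else 0)"
  shows "trace A = (\<Sum>i\<in>UNIV. b i \<bullet> (A *v b i))"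
proof -
  define P :: "real^'n^'n" where "P = (\<chi> i j. b j $ i)"
  have "trace A = trace (A ** (P ** transpose P))"
    using matrix_of_orthonormal_columns[OF assms] by (simp add: P_def)
  also have "\<dots> = trace (transpose P ** (A ** P))"
    by (metis matrix_mul_assoc trace_mul_sym)
  also have "\<dots> = (\<Sum>i\<in>UNIV. b i \<bullet> (A *v b i))"
    by (simp add: trace_def P_def transpose_def matrix_matrix_mult_def inner_vec_def matrix_vector_mult_def)
  finally show ?thesis .
qed

lemma mat_vector_mult: "(mat c :: real^'n^'n) *v x = c *\<^sub>R x"
  by (simp add: mat_def matrix_vector_mult_def vec_eq_iff if_distrib[where f="\<lambda>x. x * _"] cong: if_cong)

lemma symmetric_component:
  assumes "transpose (B :: 'a^'n^'n) = B"
  shows "B $ i $ j = B $ j $ i"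
  using arg_cong[OF assms, of "\<lambda>X. X $ j $ i"] by (simp add: transpose_def)

lemma inner_symmetric_matrices_eq_trace:
  fixes A B :: "real^'n^'n"
  assumes "transpose B = B"
  shows "A \<bullet> B = trace (A ** B)"
proof -
  have "B $ i $ j = B $ j $ i" for i j
    by (rule symmetric_component[OF assms])
  then have "A $ i $ j * B $ i $ j = A $ i $ j * B $ j $ i" for i j by metis
  then show ?thesis
    unfolding inner_vec_def trace_def matrix_matrix_mult_def by (auto intro!: sum.cong)
qed

lemma eigenvector_matrix_mult:
  fixes A :: "real^'n^'n" and b :: "'n \<Rightarrow> real^'n"
  assumes "\<And>i. A *v b i = l i *\<^sub>R b i"
  shows "A ** (\<chi> i j. b j $ i) = (\<chi> i j. b j $ i) ** (\<chi> i j. if i = j then l i else 0)"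
proof -
  have "(A ** (\<chi> i j. b j $ i)) $ i $ j = (A *v b j) $ i" for i j
    by (simp add: matrix_matrix_mult_def matrix_vector_mult_def)
  then show ?thesis
    by (simp add: vec_eq_iff assms)
       (simp add: matrix_matrix_mult_def if_distrib[where f="\<lambda>x. _ * x"] cong: if_cong)
qed

lemma det_eq_prod_eigenvalues:
  fixes A :: "real^'n^'n" and b :: "'n \<Rightarrow> real^'n"
  assumes b: "\<And>i j. b i \<bullet> b j = (if i = j then 1 else 0)" "\<And>i. A *v b i = l i *\<^sub>R b i"
  shows "det A = (\<Prod>i\<in>UNIV. l i)"
proof -
  define P :: "real^'n^'n" where "P = (\<chi> i j. b j $ i)"
  define D :: "real^'n^'n" where "D = (\<chi> i j. if i = j then l i else 0)"
  have "A ** P = P ** D"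
    unfolding P_def D_def by (rule eigenvector_matrix_mult[OF b(2)])
  then have "det A * det P = det P * det D"
    by (metis det_mul)
  moreover have "det (transpose P) * det P = 1"
    using matrix_of_orthonormal_columns(1)[OF b(1)] by (metis P_def det_I det_mul)
  then have "det P \<noteq> 0" by auto
  ultimately have "det A = det D" by simp
  also have "\<dots> = (\<Prod>i\<in>UNIV. l i)"
    by (subst det_diagonal) (simp_all add: D_def)
  finally show ?thesis .
qed

lemma det_char_matrix_orthonormal_eigenbasis:
  fixes A :: "real^'n^'n" and b :: "'n \<Rightarrow> real^'n"
  assumes b: "\<And>i j. b i \<bullet> b j = (if i = j then 1 else 0)" "\<And>i. A *v b i = l i *\<^sub>R b i"
  shows "det (mat t - A) = (\<Prod>i\<in>UNIV. t - l i)"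
  by (rule det_eq_prod_eigenvalues[OF b(1)])
     (simp add: b(2) matrix_vector_mult_diff_rdistrib mat_vector_mult algebra_simps)

text \<open>
  The eigenvalue vector is chosen by a \<open>SOME\<close> and is determined only up to order; symmetric sums
  over it do not see the order, because equal monic polynomials have equal multisets of roots.
\<close>

lemma sum_over_roots_unique:
  fixes l l' :: "'n::finite \<Rightarrow> real" and g :: "real \<Rightarrow> real"
  assumes "\<And>t. (\<Prod>i\<in>UNIV. t - l i) = (\<Prod>i\<in>UNIV. t - l' i)"
  shows "(\<Sum>i\<in>UNIV. g (l i)) = (\<Sum>i\<in>UNIV. g (l' i))"
proof -
  define p where "p l = (\<Prod>i\<in>UNIV. [:- l i, 1:])" for l :: "'n \<Rightarrow> real"
  have poly: "poly (p l) t = (\<Prod>i\<in>UNIV. t - l i)" for l t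
    by (simp add: p_def poly_prod)
  have "p l = p l'"
    using poly assms by (subst poly_eq_poly_eq_iff[symmetric]) (simp add: fun_eq_iff)
  moreover have "proots (p l) = image_mset l (mset_set UNIV)" for l :: "'n \<Rightarrow> real"
    by (simp add: p_def proots_prod sum_unfold_sum_mset)
  ultimately have "sum_mset (image_mset g (image_mset l (mset_set UNIV)))
      = sum_mset (image_mset g (image_mset l' (mset_set UNIV)))"
    by metis
  then show ?thesis
    by (simp add: sum_unfold_sum_mset multiset.map_comp comp_def)
qed

lemma eigenvalues_char_poly:
  fixes A :: "real^'n^'n"
  assumes "transpose A = A"
  shows "det (mat t - A) = (\<Prod>i\<in>UNIV. t - eigenvalues A $ i)"
proof -
  obtain b :: "'n \<Rightarrow> real^'n" and l where b: "\<And>i j. b i \<bullet> b j = (if i = j then 1 else 0)" "\<And>i. A *v b i = l i *\<^sub>R b i"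
    using symmetric_orthonormal_eigenbasis[OF assms] by metis
  have "\<exists>l::real^'n. \<forall>t. det (mat t - A) = (\<Prod>i\<in>UNIV. t - l $ i)"
    using det_char_matrix_orthonormal_eigenbasis[OF b] by (intro exI[of _ "\<chi> i. l i"]) simp
  from someI_ex[OF this] show ?thesis unfolding eigenvalues_def by blast
qed

text \<open>
  Transfers symmetric sums from the chosen eigenvalue vector to any orthonormal eigenbasis.
\<close>

lemma sum_over_eigenvalues:
  fixes A :: "real^'n^'n" and b :: "'n \<Rightarrow> real^'n"
  assumes sym: "transpose A = A"
    and b: "\<And>i j. b i \<bullet> b j = (if i = j then 1 else 0)" "\<And>i. A *v b i = l i *\<^sub>R b i"
  shows "(\<Sum>i\<in>UNIV. g (eigenvalues A $ i) :: real) = (\<Sum>i\<in>UNIV. g (l i))"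
  by (rule sum_over_roots_unique)
    (use eigenvalues_char_poly[OF sym] det_char_matrix_orthonormal_eigenbasis[OF b] in simp)

lemma sum_eigenvalues_eq_trace:
  fixes A :: "real^'n^'n"
  assumes sym: "transpose A = A"
  shows "(\<Sum>i\<in>UNIV. eigenvalues A $ i) = trace A"
proof -
  obtain b :: "'n \<Rightarrow> real^'n" and l where b: "\<And>i j. b i \<bullet> b j = (if i = j then 1 else 0)" "\<And>i. A *v b i = l i *\<^sub>R b i"
    using symmetric_orthonormal_eigenbasis[OF assms] by metis
  show ?thesis
    using sum_over_eigenvalues[OF sym b, of "\<lambda>x. x"] trace_in_orthonormal_basis[OF b(1), of A] b
    by simp
qed

lemma sum_eigenvalues_squared_eq_inner:
  fixes A :: "real^'n^'n"
  assumes sym: "transpose A = A"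
  shows "(\<Sum>i\<in>UNIV. (eigenvalues A $ i)\<^sup>2) = A \<bullet> A"
proof -
  obtain b :: "'n \<Rightarrow> real^'n" and l where b: "\<And>i j. b i \<bullet> b j = (if i = j then 1 else 0)" "\<And>i. A *v b i = l i *\<^sub>R b i"
    using symmetric_orthonormal_eigenbasis[OF assms] by metis
  show ?thesis
    using sum_over_eigenvalues[OF sym b, of "\<lambda>x. x\<^sup>2"] trace_in_orthonormal_basis[OF b(1), of "A ** A"]
      inner_symmetric_matrices_eq_trace[OF sym, of A] b
    by (simp add: matrix_vector_mul_assoc[symmetric] matrix_vector_mult_scaleR power2_eq_square)
qed

lemma eigenvalue_has_eigenvector:
  fixes A :: "real^'n^'n"
  assumes sym: "transpose A = A"
  obtains v where "norm v = 1" "A *v v = (eigenvalues A $ i) *\<^sub>R v"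
proof -
  have "det (mat (eigenvalues A $ i) - A) = 0"
    using eigenvalues_char_poly[OF sym, of "eigenvalues A $ i"] by (auto simp: prod_zero_iff)
  then have ni: "\<not> invertible (mat (eigenvalues A $ i) - A)"
    by (simp add: invertible_det_nz)
  then obtain x where x: "x \<noteq> 0" "(mat (eigenvalues A $ i) - A) *v x = 0"
    using matrix_left_invertible_ker[of "mat (eigenvalues A $ i) - A"]
      invertible_left_inverse[of "mat (eigenvalues A $ i) - A"] by blast
  then have "A *v x = (eigenvalues A $ i) *\<^sub>R x"
    by (simp add: matrix_vector_mult_diff_rdistrib mat_vector_mult)
  then show ?thesis using x(1) that[of "x /\<^sub>R norm x"] by (simp add: matrix_vector_mult_scaleR)
qed

lemma sigma_1: "sigma 1 (l :: real^'n) = (\<Sum>i\<in>UNIV. l $ i)"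
proof -
  have eq: "{I::'n set. card I = 1} = (\<lambda>i. {i}) ` UNIV" by (auto simp: card_1_singleton_iff)
  have "sigma 1 l = (\<Sum>I\<in>(\<lambda>i::'n. {i}) ` UNIV. \<Prod>i\<in>I. l $ i)"
    unfolding sigma_def eq ..
  also have "\<dots> = (\<Sum>i\<in>UNIV. l $ i)"
    by (subst sum.reindex) (auto simp: inj_on_def)
  finally show ?thesis .
qed

text \<open>
  Squaring \<open>\<Sum>i. l i\<close> counts each two-element set twice.
\<close>

lemma sigma_2: "sigma 2 (l :: real^'n) = ((\<Sum>i\<in>UNIV. l $ i)\<^sup>2 - (\<Sum>i\<in>UNIV. (l $ i)\<^sup>2)) / 2"
proof -
  define T where "T = {(i::'n, j). i \<noteq> j}"
  have "(\<Sum>i\<in>UNIV. l $ i)\<^sup>2 = (\<Sum>p\<in>UNIV \<times> UNIV. l $ fst p * l $ snd p)"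
    by (simp add: power2_eq_square sum_product sum.cartesian_product case_prod_beta)
  also have "\<dots> = (\<Sum>p\<in>T. l $ fst p * l $ snd p) + (\<Sum>p\<in>Id. l $ fst p * l $ snd p)"
    by (subst sum.union_disjoint[symmetric]) (auto simp: T_def intro!: sum.cong)
  also have "(\<Sum>p\<in>Id. l $ fst p * l $ snd p) = (\<Sum>i\<in>UNIV. (l $ i)\<^sup>2)"
    by (rule sum.reindex_bij_witness[of _ "\<lambda>i. (i, i)" fst]) (auto simp: power2_eq_square)
  also have "(\<Sum>p\<in>T. l $ fst p * l $ snd p)
      = (\<Sum>I | card I = 2. \<Sum>p | p \<in> T \<and> {fst p, snd p} = I. l $ fst p * l $ snd p)"
    by (subst sum.group[of T "{I. card I = 2}" "\<lambda>p. {fst p, snd p}"]) (auto simp: T_def)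
  also have "\<dots> = (\<Sum>I | card I = 2. 2 * (\<Prod>i\<in>I. l $ i))"
  proof (rule sum.cong[OF refl])
    fix I :: "'n set" assume "I \<in> {I. card I = 2}"
    then obtain i j where ij: "I = {i, j}" "i \<noteq> j" by (auto simp: card_2_iff)
    have "{p. p \<in> T \<and> {fst p, snd p} = I} = {(i, j), (j, i)}"
      using ij by (auto simp: T_def doubleton_eq_iff)
    then show "(\<Sum>p | p \<in> T \<and> {fst p, snd p} = I. l $ fst p * l $ snd p) = 2 * (\<Prod>i\<in>I. l $ i)"
      using ij by simp
  qed
  finally show ?thesis unfolding sigma_def by (simp add: sum_distrib_left[symmetric])
qed

lemma sigma_eigenvalues:
  fixes B :: "real^'n^'n"
  assumes "transpose B = B"
  shows "sigma 1 (eigenvalues B) = trace B" "sigma 2 (eigenvalues B) = ((trace B)\<^sup>2 - B \<bullet> B) / 2"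
  using sum_eigenvalues_eq_trace[OF assms] sum_eigenvalues_squared_eq_inner[OF assms]
  by (simp_all add: sigma_1[unfolded One_nat_def] sigma_1 sigma_2)

lemma inner_mat_eq_trace: "mat c \<bullet> (A :: real^'n^'n) = c * trace A"
  by (simp add: inner_vec_def mat_def trace_def sum_distrib_left if_distrib[where f="\<lambda>x. x * _"] cong: if_cong)

lemma trace_mat: "trace (mat c :: real^'n^'n) = real CARD('n) * c"
  by (simp add: trace_def mat_def)

lemma trace_scaleR: "trace (c *\<^sub>R A) = c * trace (A :: real^'n^'n)"
  by (simp add: trace_def sum_distrib_left)

lemma transpose_linear:
  "transpose (A + B) = transpose A + transpose (B :: real^'n^'n)"
  "transpose (A - B) = transpose A - transpose (B :: real^'n^'n)"
  "transpose (c *\<^sub>R A) = c *\<^sub>R transpose A"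
  by (simp_all add: transpose_def vec_eq_iff)

text \<open>
  For \<open>B\<close> with trace \<open>T\<close> and \<open>f = f2 B\<close> one has \<open>M = (T I - B)/(2f)\<close> and \<open>2 f^2 = T^2 - |B|^2\<close>; computing
  \<open>tr M\<close> and \<open>|M|^2\<close> gives the equation of the quadric. Conversely \<open>B = T I - 2M\<close> with
  \<open>T = 2 tr M/(n-1)\<close> is a preimage, normalized so that \<open>f2 B = 1\<close>.
\<close>

theorem M2_iff:
  fixes M :: "real^'n^'n"
  assumes n: "2 \<le> CARD('n)"
  shows "M \<in> M2 \<longleftrightarrow> transpose M = M \<and> 0 < trace M
    \<and> (trace M)\<^sup>2 / (real CARD('n) - 1) - M \<bullet> M = 1 / 2"
proof
  define N where "N = real CARD('n)"
  have N: "N \<ge> 2" using n by (simp add: N_def)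
  assume "M \<in> M2"
  then obtain B where B: "B \<in> Gamma2"
    and diag: "\<And>i. M $ i $ i = 1 / (2 * f2 B) * (\<Sum>j\<in>UNIV - {i}. B $ j $ j)"
    and offdiag: "\<And>i j. i \<noteq> j \<Longrightarrow> M $ i $ j = - (1 / (2 * f2 B)) * B $ j $ i"
    unfolding M2_def by blast
  have sym: "transpose B = B" and pos: "0 < trace B" "0 < (trace B)\<^sup>2 - B \<bullet> B"
    using B sigma_eigenvalues[of B] by (auto simp: Gamma2_def)
  have symB: "B $ j $ i = B $ i $ j" for i j by (rule symmetric_component[OF sym])
  define f where "f = f2 B"
  have f2: "f\<^sup>2 = ((trace B)\<^sup>2 - B \<bullet> B) / 2" and f: "0 < f"
    using pos sigma_eigenvalues[OF sym] by (simp_all add: f_def f2_def)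
  have M: "M = (1 / (2 * f)) *\<^sub>R (mat (trace B) - B)"
  proof -
    have "M $ i $ j = ((1 / (2 * f)) *\<^sub>R (mat (trace B) - B)) $ i $ j" for i j
    proof (cases "i = j")
      case True
      then show ?thesis
        by (simp add: diag mat_def trace_def sum_diff1 flip: f_def)
    next
      case False
      then show ?thesis by (simp add: offdiag mat_def symB flip: f_def)
    qed
    then show ?thesis by (simp add: vec_eq_iff)
  qed
  have tr: "trace M = (N - 1) * trace B / (2 * f)"
    unfolding M trace_scaleR trace_sub trace_mat by (simp add: N_def algebra_simps diff_divide_distrib)
  have MM: "M \<bullet> M = ((N - 2) * (trace B)\<^sup>2 + B \<bullet> B) / (4 * f\<^sup>2)"
    unfolding M using f
    by (simp add: inner_diff_left inner_diff_right inner_mat_eq_trace trace_mat inner_commute[of B "mat _"]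
        N_def power2_eq_square field_simps)
  have "(trace M)\<^sup>2 / (N - 1) = (N - 1) * (trace B)\<^sup>2 / (4 * f\<^sup>2)"
    using N by (simp add: tr power2_eq_square)
  then have "(trace M)\<^sup>2 / (N - 1) - M \<bullet> M = ((trace B)\<^sup>2 - B \<bullet> B) / (4 * f\<^sup>2)"
    by (simp add: MM algebra_simps diff_divide_distrib[symmetric] add_divide_distrib[symmetric])
  also have "\<dots> = 1 / 2" using f f2 by (simp add: field_simps)
  finally have "(trace M)\<^sup>2 / (N - 1) - M \<bullet> M = 1 / 2" .
  moreover have "transpose M = M" unfolding M by (simp add: transpose_linear sym)
  moreover have "0 < trace M" using tr N pos f by simp
  ultimately show "transpose M = M \<and> 0 < trace M
      \<and> (trace M)\<^sup>2 / (real CARD('n) - 1) - M \<bullet> M = 1 / 2"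
    unfolding N_def by blast
next
  define N where "N = real CARD('n)"
  have N: "N \<ge> 2" using n by (simp add: N_def)
  assume "transpose M = M \<and> 0 < trace M \<and> (trace M)\<^sup>2 / (real CARD('n) - 1) - M \<bullet> M = 1 / 2"
  then have sym: "transpose M = M" and t: "0 < trace M" and eq: "(trace M)\<^sup>2 / (N - 1) - M \<bullet> M = 1 / 2"
    by (simp_all add: N_def)
  \<comment> \<open>\<open>T\<close> is the trace that \<open>B\<close> must have, since \<open>tr M = (n-1) T / 2\<close> when \<open>f2 B = 1\<close>\<close>
  define T where "T = 2 * trace M / (N - 1)"
  define B where "B = mat T - 2 *\<^sub>R M"
  have symB: "transpose B = B" by (simp add: B_def transpose_linear sym)
  have tM: "trace M = (N - 1) * T / 2" using N by (simp add: T_def)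
  have trB: "trace B = T"
    unfolding B_def trace_sub trace_mat trace_scaleR tM by (simp add: N_def field_simps)
  have "B \<bullet> B = N * T\<^sup>2 - 4 * T * trace M + 4 * (M \<bullet> M)"
    unfolding B_def
    by (simp add: inner_diff_left inner_diff_right inner_mat_eq_trace trace_mat inner_commute[of M "mat _"]
        N_def power2_eq_square algebra_simps)
  also have "M \<bullet> M = (N - 1) * T\<^sup>2 / 4 - 1 / 2"
  proof -
    have "(trace M)\<^sup>2 / (N - 1) = (N - 1) * T\<^sup>2 / 4"
      using N by (simp add: tM power2_eq_square divide_simps)
    then show ?thesis using eq by linarith
  qed
  finally have BB: "(trace B)\<^sup>2 - B \<bullet> B = 2"
    unfolding trB tM by (simp add: field_simps power2_eq_square)
  have s: "sigma 1 (eigenvalues B) = T" "sigma 2 (eigenvalues B) = 1"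
    using sigma_eigenvalues[OF symB] trB BB by simp_all
  have "0 < T" using N t by (simp add: T_def)
  then have G: "B \<in> Gamma2" using s symB by (simp add: Gamma2_def)
  have f: "f2 B = 1" by (simp add: f2_def s)
  have symM: "M $ j $ i = M $ i $ j" for i j by (rule symmetric_component[OF sym])
  have "\<forall>i. M $ i $ i = 1 / (2 * f2 B) * (\<Sum>j\<in>UNIV - {i}. B $ j $ j)"
  proof
    fix i
    have "(\<Sum>j\<in>UNIV - {i}. B $ j $ j) = trace B - B $ i $ i"
      by (simp add: trace_def sum_diff1)
    then show "M $ i $ i = 1 / (2 * f2 B) * (\<Sum>j\<in>UNIV - {i}. B $ j $ j)"
      unfolding f trB by (simp add: B_def mat_def)
  qed
  moreover have "\<forall>i j. i \<noteq> j \<longrightarrow> M $ i $ j = - (1 / (2 * f2 B)) * B $ j $ i"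
    unfolding f by (auto simp: B_def mat_def intro: symM)
  ultimately show "M \<in> M2" unfolding M2_def using G by blast
qed

section \<open>Positive definiteness and square roots\<close>

definition outer :: "real^'n \<Rightarrow> real^'n \<Rightarrow> real^'n^'n" where
  "outer v w = (\<chi> i j. v $ i * w $ j)"

lemma outer_vector_mult: "outer v w *v x = (w \<bullet> x) *\<^sub>R v"
  by (simp add: outer_def matrix_vector_mult_def vec_eq_iff inner_vec_def sum_distrib_left mult_ac)

lemma trace_outer: "trace (outer v w) = v \<bullet> w"
  by (simp add: outer_def trace_def inner_vec_def)

lemma transpose_outer: "transpose (outer v w) = outer w v"
  by (simp add: outer_def transpose_def vec_eq_iff mult.commute)

lemma inner_outer: "M \<bullet> outer v w = v \<bullet> (M *v w)"
  by (simp add: outer_def inner_vec_def matrix_vector_mult_def sum_distrib_left mult_ac)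

lemma mat_1_inner_outer: "mat c \<bullet> outer v w = c * (v \<bullet> w)"
  by (simp add: inner_mat_eq_trace trace_outer)

text \<open>
  The right-hand side dominates the squared norm of the orthogonal projection of \<open>M\<close> to the plane spanned by
  \<open>e e^T\<close> and \<open>I - e e^T\<close>.
\<close>

lemma inner_self_ge_diag_and_trace:
  fixes M :: "real^'n^'n"
  assumes n: "2 \<le> CARD('n)" and e: "norm e = 1"
  shows "(e \<bullet> (M *v e))\<^sup>2 + (trace M - e \<bullet> (M *v e))\<^sup>2 / (real CARD('n) - 1) \<le> M \<bullet> M"
proof -
  define N where "N = real CARD('n)"
  have N: "N \<ge> 2" using n by (simp add: N_def)
  define a where "a = e \<bullet> (M *v e)"
  define T where "T = trace M - a"
  define c where "c = T / (N - 1)"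
  \<comment> \<open>the projection of \<open>M\<close> to the span of \<open>e e^T\<close> and \<open>I - e e^T\<close>\<close>
  define X where "X = a *\<^sub>R outer e e + c *\<^sub>R (mat 1 - outer e e)"
  have ee: "e \<bullet> e = 1" using e by (simp add: norm_eq_1)
  have oo: "outer e e \<bullet> outer e e = 1" "mat 1 \<bullet> (mat 1 :: real^'n^'n) = N" "mat 1 \<bullet> outer e e = 1"
    "outer e e \<bullet> mat 1 = 1"
    using ee by (simp_all add: inner_outer outer_vector_mult mat_1_inner_outer inner_mat_eq_trace trace_mat N_def
        inner_commute[of "outer e e" "mat 1"])
  have XX: "X \<bullet> X = a\<^sup>2 + c\<^sup>2 * (N - 1)"
    by (simp add: X_def inner_add_left inner_add_right inner_diff_left inner_diff_right oo
        algebra_simps power2_eq_square)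
  have MX: "M \<bullet> X = a\<^sup>2 + c * T"
    by (simp add: X_def inner_add_right inner_diff_right inner_outer inner_commute[of M "mat 1"]
        inner_mat_eq_trace T_def power2_eq_square algebra_simps flip: a_def)
  have cT: "c * T = T\<^sup>2 / (N - 1)" "c\<^sup>2 * (N - 1) = T\<^sup>2 / (N - 1)"
    using N by (simp_all add: c_def power2_eq_square)
  have "0 \<le> (M - X) \<bullet> (M - X)" by (rule inner_ge_zero)
  also have "\<dots> = M \<bullet> M - 2 * (M \<bullet> X) + X \<bullet> X"
    by (simp add: inner_diff_left inner_diff_right inner_commute)
  finally show ?thesis unfolding XX MX cT by (simp add: T_def a_def N_def)
qed

text \<open>
  With \<open>a = e.Me\<close> and \<open>T = tr M - a\<close>, the quadric and the previous inequality give
  \<open>2aT \<ge> (n-1)/2 + (n-2)a^2 > 0\<close>, while \<open>a + T > 0\<close>.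
\<close>

lemma M2_direction_pos:
  fixes M :: "real^'n^'n"
  assumes n: "2 \<le> CARD('n)" and M: "M \<in> M2" and e: "norm e = 1"
  shows "0 < e \<bullet> (M *v e)"
proof -
  define N where "N = real CARD('n)"
  have N: "N \<ge> 2" using n by (simp add: N_def)
  define a where "a = e \<bullet> (M *v e)"
  define T where "T = trace M - a"
  have t: "0 < a + T" and eq: "(a + T)\<^sup>2 / (N - 1) - M \<bullet> M = 1 / 2"
    using M M2_iff[OF n, of M] by (simp_all add: T_def N_def)
  have "a\<^sup>2 + T\<^sup>2 / (N - 1) \<le> M \<bullet> M"
    using inner_self_ge_diag_and_trace[OF n e, of M] by (simp add: T_def a_def N_def)
  then have "(a + T)\<^sup>2 / (N - 1) - a\<^sup>2 - T\<^sup>2 / (N - 1) \<ge> 1 / 2" using eq by linarith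
  moreover have "(a + T)\<^sup>2 / (N - 1) - a\<^sup>2 - T\<^sup>2 / (N - 1) = ((a + T)\<^sup>2 - (N - 1) * a\<^sup>2 - T\<^sup>2) / (N - 1)"
    using N by (simp add: diff_divide_distrib)
  ultimately have "1 / 2 \<le> ((a + T)\<^sup>2 - (N - 1) * a\<^sup>2 - T\<^sup>2) / (N - 1)" by simp
  then have "(a + T)\<^sup>2 - (N - 1) * a\<^sup>2 - T\<^sup>2 \<ge> (N - 1) / 2"
    using N by (subst (asm) pos_le_divide_eq) auto
  then have "2 * a * T \<ge> (N - 1) / 2 + (N - 2) * a\<^sup>2"
    by (simp add: power2_eq_square algebra_simps)
  moreover have "0 \<le> (N - 2) * a\<^sup>2" using N by simp
  moreover have "0 < (N - 1) / 2" using N by simp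
  ultimately have "0 < 2 * a * T" by linarith
  then have "0 < a * T" by (simp add: mult.assoc mult.commute)
  then have "0 < a" using t by (auto simp: zero_less_mult_iff)
  then show ?thesis by (simp add: a_def)
qed

lemma M2_positive_definite:
  fixes M :: "real^'n^'n"
  assumes n: "2 \<le> CARD('n)" and M: "M \<in> M2" and v: "v \<noteq> 0"
  shows "0 < v \<bullet> (M *v v)"
proof -
  have "0 < (v /\<^sub>R norm v) \<bullet> (M *v (v /\<^sub>R norm v))"
    by (rule M2_direction_pos[OF n M]) (use v in simp)
  then show ?thesis using v
    by (simp add: matrix_vector_mult_scaleR zero_less_mult_iff)
qed

text \<open>
  For \<open>w = Sv - sqrt c v\<close> the identity \<open>(S + sqrt c) w = 0\<close> and \<open>w.Sw \<ge> 0\<close> force \<open>w = 0\<close>. This is what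
  makes the square root unique: it is determined on an eigenbasis of \<open>M\<close>.
\<close>

lemma psd_sqrt_eigenvector:
  fixes S :: "real^'n^'n"
  assumes psd: "\<And>v. 0 \<le> v \<bullet> (S *v v)" and sq: "S ** S = M" and ev: "M *v v = c *\<^sub>R v" and c: "0 < c"
  shows "S *v v = sqrt c *\<^sub>R v"
proof -
  define w where "w = S *v v - sqrt c *\<^sub>R v"
  have "S *v w = c *\<^sub>R v - sqrt c *\<^sub>R (S *v v)"
    using sq ev by (simp add: w_def matrix_vector_mult_diff_distrib matrix_vector_mult_scaleR
        matrix_vector_mul_assoc)
  also have "\<dots> = - (sqrt c) *\<^sub>R w"
    using c by (simp add: w_def algebra_simps)
  finally have "w \<bullet> (S *v w) = - sqrt c * (w \<bullet> w)" by simp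
  then have "sqrt c * (w \<bullet> w) \<le> 0" using psd[of w] by simp
  then have "w \<bullet> w \<le> 0" using c by (simp add: mult_le_0_iff)
  then have "w = 0" by (metis antisym inner_eq_zero_iff inner_ge_zero)
  then show ?thesis by (simp add: w_def)
qed

lemma matrix_eq_on_orthonormal_basis:
  fixes A B :: "real^'n^'n" and b :: "'n \<Rightarrow> real^'n"
  assumes "\<And>i j. b i \<bullet> b j = (if i = j then 1 else 0)" "\<And>i. A *v b i = B *v b i"
  shows "A = B"
proof -
  define P :: "real^'n^'n" where "P = (\<chi> i j. b j $ i)"
  have PP: "P ** transpose P = mat 1"
    using matrix_of_orthonormal_columns[OF assms(1)] by (simp add: P_def)
  have "(A ** P) $ i $ j = (B ** P) $ i $ j" for i j
    using assms(2)[of j] by (simp add: P_def matrix_matrix_mult_def matrix_vector_mult_def vec_eq_iff)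
  then have "A ** P = B ** P" by (simp add: vec_eq_iff)
  then have "A ** (P ** transpose P) = B ** (P ** transpose P)"
    by (simp add: matrix_mul_assoc)
  then show ?thesis by (simp add: PP)
qed

lemma matrix_sqrt:
  fixes M :: "real^'n^'n"
  assumes sym: "transpose M = M" and pos: "\<And>v. v \<noteq> 0 \<Longrightarrow> 0 < v \<bullet> (M *v v)"
  shows "transpose (matrix_sqrt M) = matrix_sqrt M" "\<And>v. 0 \<le> v \<bullet> (matrix_sqrt M *v v)"
    "matrix_sqrt M ** matrix_sqrt M = M"
proof -
  obtain b :: "'n \<Rightarrow> real^'n" and l where b: "\<And>i j. b i \<bullet> b j = (if i = j then 1 else 0)"
      "\<And>i. M *v b i = l i *\<^sub>R b i"
    using symmetric_orthonormal_eigenbasis[OF sym] by metis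
  have b0: "b i \<noteq> 0" for i using b(1)[of i i] by auto
  have l: "0 < l i" for i using pos[OF b0[of i]] b by simp
  define S where "S = (\<Sum>i\<in>UNIV. sqrt (l i) *\<^sub>R outer (b i) (b i))"
  have Sv: "S *v v = (\<Sum>i\<in>UNIV. (sqrt (l i) * (b i \<bullet> v)) *\<^sub>R b i)" for v
  proof -
    have "S *v v = (\<Sum>i\<in>UNIV. (sqrt (l i) *\<^sub>R outer (b i) (b i)) *v v)"
      unfolding S_def by (induction rule: infinite_finite_induct[of _ "UNIV::'n set"])
         (auto simp: matrix_vector_mult_add_rdistrib)
    then show ?thesis by (simp add: scaleR_matrix_vector_assoc[symmetric] outer_vector_mult)
  qed
  have Sb: "S *v b i = sqrt (l i) *\<^sub>R b i" for i
    by (simp add: Sv b if_distrib[where f="\<lambda>x. _ * x"] if_distrib[where f="\<lambda>x. x *\<^sub>R _"] cong: if_cong)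
  have P: "transpose S = S \<and> (\<forall>v. 0 \<le> v \<bullet> (S *v v)) \<and> S ** S = M"
  proof (intro conjI allI)
    show "transpose S = S"
      unfolding S_def by (simp add: transpose_def vec_eq_iff outer_def mult_ac)
    show "0 \<le> v \<bullet> (S *v v)" for v
      unfolding Sv inner_sum_right using l
      by (intro sum_nonneg) (simp add: inner_commute[of v] mult.assoc less_imp_le)
    show "S ** S = M"
      by (rule matrix_eq_on_orthonormal_basis[OF b(1)])
         (use l in \<open>simp add: matrix_vector_mul_assoc[symmetric] Sb matrix_vector_mult_scaleR b less_imp_le\<close>)
  qed
  have "S' = S" if "transpose S' = S' \<and> (\<forall>v. 0 \<le> v \<bullet> (S' *v v)) \<and> S' ** S' = M" for S'
    by (rule matrix_eq_on_orthonormal_basis[OF b(1)])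
       (use psd_sqrt_eigenvector[of S' M] that l b(2) Sb in simp)
  with P have "\<exists>!S. transpose S = S \<and> (\<forall>v. 0 \<le> v \<bullet> (S *v v)) \<and> S ** S = M" by blast
  from theI'[OF this] show "transpose (matrix_sqrt M) = matrix_sqrt M" "\<And>v. 0 \<le> v \<bullet> (matrix_sqrt M *v v)"
    "matrix_sqrt M ** matrix_sqrt M = M"
    unfolding matrix_sqrt_def by blast+
qed

section \<open>Linear changes of variables\<close>

lemma nn_integral_lborel_translation:
  fixes f :: "'a::euclidean_space \<Rightarrow> ennreal"
  assumes [measurable]: "f \<in> borel_measurable borel"
  shows "(\<integral>\<^sup>+x. f (a + x) \<partial>lborel) = (\<integral>\<^sup>+x. f x \<partial>lborel)"
  by (subst (2) lborel_distr_plus[of a, symmetric]) (simp add: nn_integral_distr)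

lemma borel_measurable_matrix_vector_mult [measurable]:
  "(\<lambda>x. (A :: real^'n^'m) *v x) \<in> borel_measurable borel"
  by (intro borel_measurable_continuous_onI linear_continuous_on matrix_vector_mul_bounded_linear)

text \<open>
  Uniqueness of translation-invariant measures, specialized to the image of Lebesgue measure under an
  invertible matrix: by Tonelli, \<open>\<integral>\<integral> g(y) f(Xz + y)\<close> is computed in two ways, with \<open>g\<close> the indicator of
  the unit ball, which is even.
\<close>

lemma nn_integral_lborel_linear_proportional:
  fixes X Y :: "real^'n^'n" and f :: "real^'n \<Rightarrow> ennreal"
  assumes XY: "X ** Y = mat 1" and f[measurable]: "f \<in> borel_measurable borel"
  shows "(\<integral>\<^sup>+z. f (X *v z) \<partial>lborel) * emeasure lborel (cball (0::real^'n) 1)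
    = (\<integral>\<^sup>+z. f z \<partial>lborel) * emeasure lborel {z. norm (X *v z) \<le> 1}"
proof -
  define g :: "real^'n \<Rightarrow> ennreal" where "g = indicator (cball 0 1)"
  have g[measurable]: "g \<in> borel_measurable borel"
    unfolding g_def by (rule borel_measurable_indicator) simp
  have g_minus: "g (- x) = g x" for x by (simp add: g_def indicator_def)
  have XYv: "X *v (Y *v x) = x" for x by (simp add: matrix_vector_mul_assoc XY)
  have shift: "(\<integral>\<^sup>+z. h (X *v z + y) \<partial>lborel) = (\<integral>\<^sup>+z. h (X *v z) \<partial>lborel)"
    if [measurable]: "h \<in> borel_measurable borel" for h :: "real^'n \<Rightarrow> ennreal" and y
    using nn_integral_lborel_translation[of "\<lambda>z. h (X *v z)" "Y *v y"]
    by (simp add: matrix_vector_right_distrib XYv add.commute)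
  have "(\<integral>\<^sup>+z. f (X *v z) \<partial>lborel) * (\<integral>\<^sup>+y. g y \<partial>lborel)
      = (\<integral>\<^sup>+y. \<integral>\<^sup>+z. g y * f (X *v z + y) \<partial>lborel \<partial>lborel)"
    by (simp add: shift nn_integral_cmult nn_integral_multc mult.commute)
  also have "\<dots> = (\<integral>\<^sup>+z. \<integral>\<^sup>+y. g y * f (X *v z + y) \<partial>lborel \<partial>lborel)"
    by (rule lborel_pair.Fubini') simp
  also have "\<dots> = (\<integral>\<^sup>+z. \<integral>\<^sup>+y. g (y - X *v z) * f y \<partial>lborel \<partial>lborel)"
  proof (rule nn_integral_cong)
    fix z :: "real^'n"
    show "(\<integral>\<^sup>+y. g y * f (X *v z + y) \<partial>lborel) = (\<integral>\<^sup>+y. g (y - X *v z) * f y \<partial>lborel)"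
      using nn_integral_lborel_translation[of "\<lambda>y. g (y - X *v z) * f y" "X *v z"] by simp
  qed
  also have "\<dots> = (\<integral>\<^sup>+y. \<integral>\<^sup>+z. g (y - X *v z) * f y \<partial>lborel \<partial>lborel)"
    by (rule lborel_pair.Fubini') simp
  also have "\<dots> = (\<integral>\<^sup>+y. (\<integral>\<^sup>+z. g (X *v z) \<partial>lborel) * f y \<partial>lborel)"
  proof (rule nn_integral_cong)
    fix y :: "real^'n"
    have "(\<integral>\<^sup>+z. g (y - X *v z) \<partial>lborel) = (\<integral>\<^sup>+z. g (X *v z + - y) \<partial>lborel)"
      using g_minus by (metis (no_types, lifting) add.commute add_uminus_conv_diff minus_diff_eq)
    also have "\<dots> = (\<integral>\<^sup>+z. g (X *v z) \<partial>lborel)" by (rule shift) simp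
    finally show "(\<integral>\<^sup>+z. g (y - X *v z) * f y \<partial>lborel) = (\<integral>\<^sup>+z. g (X *v z) \<partial>lborel) * f y"
      by (simp add: nn_integral_multc)
  qed
  also have "\<dots> = (\<integral>\<^sup>+z. f z \<partial>lborel) * (\<integral>\<^sup>+z. g (X *v z) \<partial>lborel)"
    by (simp add: nn_integral_cmult nn_integral_multc mult.commute)
  also have "(\<integral>\<^sup>+z. g (X *v z) \<partial>lborel) = (\<integral>\<^sup>+z. indicator {z. norm (X *v z) \<le> 1} z \<partial>lborel)"
    by (intro nn_integral_cong) (simp add: g_def indicator_def)
  finally show ?thesis by (simp add: g_def)
qed

lemma emeasure_unit_ball_pos_finite:
  "0 < emeasure lborel (cball (0::real^'n) 1)" "emeasure lborel (cball (0::real^'n) 1) < \<infinity>"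
proof -
  have "0 < measure lborel (cball (0::real^'n) 1)" by (rule content_cball_pos) simp
  then show "0 < emeasure lborel (cball (0::real^'n) 1)"
    by (auto simp: measure_def zero_less_iff_neq_zero)
  show "emeasure lborel (cball (0::real^'n) 1) < \<infinity>" by (rule emeasure_lborel_cball_finite)
qed

lemma orthogonal_matrix_norm:
  fixes X :: "real^'n^'n"
  assumes "orthogonal_matrix X"
  shows "norm (X *v z) = norm z"
proof -
  have "orthogonal_transformation ((*v) X)"
    using assms by (simp add: orthogonal_transformation_matrix)
  then show ?thesis by (rule orthogonal_transformation_norm)
qed

lemma nn_integral_lborel_orthogonal:
  fixes X :: "real^'n^'n" and f :: "real^'n \<Rightarrow> ennreal"
  assumes X: "orthogonal_matrix X" and f: "f \<in> borel_measurable borel"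
  shows "(\<integral>\<^sup>+z. f (X *v z) \<partial>lborel) = (\<integral>\<^sup>+z. f z \<partial>lborel)"
proof -
  have "norm (X *v z) = norm z" for z
    by (rule orthogonal_matrix_norm[OF X])
  then have "{z. norm (X *v z) \<le> 1} = cball 0 1" by auto
  moreover have "X ** transpose X = mat 1" using X by (simp add: orthogonal_matrix_def)
  ultimately have "(\<integral>\<^sup>+z. f (X *v z) \<partial>lborel) * emeasure lborel (cball (0::real^'n) 1)
    = (\<integral>\<^sup>+z. f z \<partial>lborel) * emeasure lborel (cball (0::real^'n) 1)"
    using nn_integral_lborel_linear_proportional[of X "transpose X" f] f by simp
  then show ?thesis
    using emeasure_unit_ball_pos_finite[where 'n='n]
    by (metis infinity_ennreal_def less_irrefl mult_divide_eq_ennreal)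
qed

text \<open>
  The factor is the same for all integrands, so it cancels in every comparison of two integrals.
\<close>

lemma nn_integral_lborel_linear:
  fixes X Y :: "real^'n^'n"
  assumes XY: "X ** Y = mat 1"
  obtains K where "0 < K" "K < \<infinity>"
    "\<And>f. f \<in> borel_measurable borel \<Longrightarrow> (\<integral>\<^sup>+z. f (X *v z) \<partial>lborel) = K * (\<integral>\<^sup>+z. f z \<partial>lborel)"
proof -
  define B where "B = emeasure lborel (cball (0::real^'n) 1)"
  define B' where "B' = emeasure lborel {z. norm (X *v z) \<le> 1}"
  have YX: "Y ** X = mat 1" using XY by (simp add: matrix_left_right_inverse)
  have B: "0 < B" "B < \<infinity>" using emeasure_unit_ball_pos_finite[where 'n='n] by (simp_all add: B_def)
  obtain c where c: "0 < c" "\<And>z. norm (X *v z) \<le> norm z * c"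
    using bounded_linear.pos_bounded[OF matrix_vector_mul_bounded_linear[of X]] by blast
  obtain d where d: "0 < d" "\<And>z. norm (Y *v z) \<le> norm z * d"
    using bounded_linear.pos_bounded[OF matrix_vector_mul_bounded_linear[of Y]] by blast
  have meas: "{z. norm (X *v z) \<le> 1} \<in> sets borel" by measurable
  have "{z. norm (X *v z) \<le> 1} \<subseteq> cball 0 d"
  proof
    fix z assume "z \<in> {z. norm (X *v z) \<le> 1}"
    then have "norm (X *v z) \<le> 1" by simp
    have "norm z = norm (Y *v (X *v z))" by (simp add: matrix_vector_mul_assoc YX)
    also have "\<dots> \<le> norm (X *v z) * d" by (rule d)
    also have "\<dots> \<le> 1 * d" using \<open>norm (X *v z) \<le> 1\<close> d(1) by (intro mult_right_mono) auto
    finally show "z \<in> cball 0 d" by simp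
  qed
  then have "B' \<le> emeasure lborel (cball (0::real^'n) d)"
    unfolding B'_def by (intro emeasure_mono) auto
  then have B'fin: "B' < \<infinity>" using emeasure_lborel_cball_finite[of "0::real^'n" d] by (simp add: order.strict_trans1)
  have "ball 0 (1 / c) \<subseteq> {z. norm (X *v z) \<le> 1}"
  proof
    fix z :: "real^'n" assume "z \<in> ball 0 (1 / c)"
    then have "norm z * c \<le> 1" using c(1) by (simp add: field_simps)
    then show "z \<in> {z. norm (X *v z) \<le> 1}" using c(2)[of z] by simp
  qed
  then have "emeasure lborel (ball (0::real^'n) (1 / c)) \<le> B'"
    unfolding B'_def using meas by (intro emeasure_mono) auto
  moreover have "0 < emeasure lborel (ball (0::real^'n) (1 / c))"
    using content_ball_pos[of "1 / c" "0::real^'n"] c(1)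
    by (auto simp: measure_def zero_less_iff_neq_zero)
  ultimately have B'pos: "0 < B'" by (rule less_le_trans[rotated])
  show ?thesis
  proof (rule that[of "B' / B"])
    show "0 < B' / B" using B B'pos by (simp add: ennreal_zero_less_divide)
    show "B' / B < \<infinity>" using B B'fin by (simp add: zero_less_iff_neq_zero less_top[symmetric] ennreal_divide_eq_top_iff)
    fix f :: "real^'n \<Rightarrow> ennreal" assume "f \<in> borel_measurable borel"
    from nn_integral_lborel_linear_proportional[OF XY this]
    have "(\<integral>\<^sup>+z. f (X *v z) \<partial>lborel) * B = (\<integral>\<^sup>+z. f z \<partial>lborel) * B'"
      by (simp add: B_def B'_def)
    moreover have "(\<integral>\<^sup>+z. f (X *v z) \<partial>lborel) * B / B = (\<integral>\<^sup>+z. f (X *v z) \<partial>lborel)"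
      using B by (subst mult_divide_eq_ennreal) auto
    ultimately have "(\<integral>\<^sup>+z. f (X *v z) \<partial>lborel) = (\<integral>\<^sup>+z. f z \<partial>lborel) * B' / B" by simp
    then show "(\<integral>\<^sup>+z. f (X *v z) \<partial>lborel) = B' / B * (\<integral>\<^sup>+z. f z \<partial>lborel)"
      by (metis ennreal_times_divide mult.commute)
  qed
qed

lemma nn_integral_lborel_scale:
  fixes f :: "real^'n \<Rightarrow> ennreal"
  assumes [measurable]: "f \<in> borel_measurable borel" and c: "0 < c"
  shows "(\<integral>\<^sup>+z. f (c *\<^sub>R z) \<partial>lborel) = ennreal (c powr (- real CARD('n))) * (\<integral>\<^sup>+z. f z \<partial>lborel)"
proof -
  have "(\<integral>\<^sup>+z. f z \<partial>lborel) = ennreal (c ^ CARD('n)) * (\<integral>\<^sup>+z. f (c *\<^sub>R z) \<partial>lborel)"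
    using c by (subst lborel_affine[of c 0])
       (simp_all add: nn_integral_density nn_integral_distr nn_integral_cmult)
  then have "ennreal (c powr (- real CARD('n))) * (\<integral>\<^sup>+z. f z \<partial>lborel)
      = ennreal (c powr (- real CARD('n)) * c ^ CARD('n)) * (\<integral>\<^sup>+z. f (c *\<^sub>R z) \<partial>lborel)"
    using c by (simp add: ennreal_mult mult.assoc)
  also have "c powr (- real CARD('n)) * c ^ CARD('n) = 1"
    using c by (simp add: powr_minus powr_realpow)
  finally show ?thesis by simp
qed

text \<open>
  In an orthonormal eigenbasis the matrix is diagonal, and diagonal
  scalings are covered by the change of variables along the standard basis.
\<close>

lemma nn_integral_lborel_symmetric:
  fixes S :: "real^'n^'n" and f :: "real^'n \<Rightarrow> ennreal"
  assumes sym: "transpose S = S" and pos: "\<And>v. v \<noteq> 0 \<Longrightarrow> 0 < v \<bullet> (S *v v)"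
    and [measurable]: "f \<in> borel_measurable borel"
  shows "0 < det S" "ennreal (det S) * (\<integral>\<^sup>+z. f (S *v z) \<partial>lborel) = (\<integral>\<^sup>+z. f z \<partial>lborel)"
proof -
  obtain b :: "'n \<Rightarrow> real^'n" and l where b: "\<And>i j. b i \<bullet> b j = (if i = j then 1 else 0)"
      "\<And>i. S *v b i = l i *\<^sub>R b i"
    using symmetric_orthonormal_eigenbasis[OF sym] by metis
  have b0: "b i \<noteq> 0" for i using b(1)[of i i] by auto
  have l: "0 < l i" for i using pos[OF b0[of i]] b by simp
  have det: "det S = (\<Prod>i\<in>UNIV. l i)" by (rule det_eq_prod_eigenvalues[OF b])
  then show "0 < det S" using l by (simp add: prod_pos)
  define P :: "real^'n^'n" where "P = (\<chi> i j. b j $ i)"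
  define D :: "real^'n^'n" where "D = (\<chi> i j. if i = j then l i else 0)"
  have P: "transpose P ** P = mat 1" "P ** transpose P = mat 1"
    using matrix_of_orthonormal_columns[OF b(1)] by (simp_all add: P_def)
  then have orth: "orthogonal_matrix P" "orthogonal_matrix (transpose P)"
    by (simp_all add: orthogonal_matrix_def)
  have "S ** P = P ** D" unfolding P_def D_def by (rule eigenvector_matrix_mult[OF b(2)])
  then have S: "S = P ** D ** transpose P"
    by (metis P(2) matrix_mul_assoc matrix_mul_rid)
  define c where "c j = (\<chi> i. l i) \<bullet> j" for j :: "real^'n"
  have D: "D *v z = 0 + (\<Sum>j\<in>Basis. (c j * (z \<bullet> j)) *\<^sub>R j)" for z
  proof (rule euclidean_eqI)
    fix k :: "real^'n" assume k: "k \<in> Basis"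
    then obtain i where i: "k = axis i 1" by (auto simp: Basis_vec_def)
    show "(D *v z) \<bullet> k = (0 + (\<Sum>j\<in>Basis. (c j * (z \<bullet> j)) *\<^sub>R j)) \<bullet> k"
      using k by (simp add: inner_sum_left_Basis)
        (simp add: i c_def inner_axis D_def matrix_vector_mult_def if_distrib[where f="\<lambda>x. x * _"] cong: if_cong)
  qed
  have cpos: "c j > 0" if "j \<in> Basis" for j
    using that l by (auto simp: c_def Basis_vec_def inner_axis)
  have prod_c: "(\<Prod>j\<in>Basis. \<bar>c j\<bar>) = det S"
  proof -
    have "(\<Prod>j\<in>Basis. \<bar>c j\<bar>) = (\<Prod>j\<in>range (\<lambda>i. axis i 1 :: real^'n). c j)"
      using cpos by (intro prod.cong) (auto simp: Basis_vec_def intro!: abs_of_pos)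
    also have "\<dots> = (\<Prod>i\<in>UNIV. c (axis i 1))"
      by (subst prod.reindex) (auto simp: inj_on_def axis_eq_axis)
    finally show ?thesis by (simp add: det c_def inner_axis)
  qed
  have "(\<integral>\<^sup>+z. f (S *v z) \<partial>lborel) = (\<integral>\<^sup>+z. f (P *v (D *v (transpose P *v z))) \<partial>lborel)"
    by (subst S) (simp only: matrix_vector_mul_assoc matrix_mul_assoc)
  also have "\<dots> = (\<integral>\<^sup>+z. f (P *v (D *v z)) \<partial>lborel)"
    by (rule nn_integral_lborel_orthogonal[OF orth(2)]) simp
  finally have 1: "(\<integral>\<^sup>+z. f (S *v z) \<partial>lborel) = (\<integral>\<^sup>+z. f (P *v (D *v z)) \<partial>lborel)" .
  have "(\<integral>\<^sup>+z. f z \<partial>lborel) = (\<integral>\<^sup>+z. f (P *v z) \<partial>lborel)"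
    by (rule nn_integral_lborel_orthogonal[OF orth(1), symmetric]) simp
  also have "\<dots> = ennreal (\<Prod>j\<in>Basis. \<bar>c j\<bar>) * (\<integral>\<^sup>+z. f (P *v (0 + (\<Sum>j\<in>Basis. (c j * (z \<bullet> j)) *\<^sub>R j))) \<partial>lborel)"
    using cpos by (subst lborel_affine_euclidean[of c 0])
       (auto simp: nn_integral_density nn_integral_distr nn_integral_cmult less_imp_neq[symmetric] prod_nonneg)
  finally show "ennreal (det S) * (\<integral>\<^sup>+z. f (S *v z) \<partial>lborel) = (\<integral>\<^sup>+z. f z \<partial>lborel)"
    unfolding 1 D prod_c by simp
qed

lemma matrix_mul_scaleR:
  fixes A :: "real^'m^'n" and B :: "real^'k^'m"
  shows "(a *\<^sub>R A) ** B = a *\<^sub>R (A ** B)" "A ** (a *\<^sub>R B) = a *\<^sub>R (A ** B)"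
  by (simp_all add: matrix_matrix_mult_def vec_eq_iff sum_distrib_left mult_ac)

lemma M2_sqrt:
  fixes M :: "real^'n^'n"
  assumes n: "2 \<le> CARD('n)" and M: "M \<in> M2"
  shows "transpose (matrix_sqrt M) = matrix_sqrt M" "v \<noteq> 0 \<Longrightarrow> 0 < v \<bullet> (matrix_sqrt M *v v)"
    "matrix_sqrt M ** matrix_sqrt M = M"
proof -
  have sym: "transpose M = M" using M M2_iff[OF n] by blast
  define S where "S = matrix_sqrt M"
  have S: "transpose S = S" "\<And>v. 0 \<le> v \<bullet> (S *v v)" "S ** S = M"
    unfolding S_def using matrix_sqrt[OF sym M2_positive_definite[OF n M]] by blast+
  then show "transpose (matrix_sqrt M) = matrix_sqrt M" "matrix_sqrt M ** matrix_sqrt M = M"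
    by (simp_all add: S_def)
  obtain b :: "'n \<Rightarrow> real^'n" and l where b: "\<And>i j. b i \<bullet> b j = (if i = j then 1 else 0)"
      "\<And>i. S *v b i = l i *\<^sub>R b i"
    using symmetric_orthonormal_eigenbasis[OF S(1)] by metis
  show "0 < v \<bullet> (matrix_sqrt M *v v)" if "v \<noteq> 0"
  proof (rule ccontr)
    assume "\<not> 0 < v \<bullet> (matrix_sqrt M *v v)"
    then have v0: "v \<bullet> (S *v v) = 0" using S(2)[of v] by (simp add: S_def)
    define y where "y = S *v v"
    have "0 \<le> 2 * t * (y \<bullet> y) + t\<^sup>2 * (y \<bullet> (S *v y))" for t
    proof -
      have "0 \<le> (v + t *\<^sub>R y) \<bullet> (S *v (v + t *\<^sub>R y))" by (rule S)
      also have "\<dots> = 2 * t * (y \<bullet> y) + t\<^sup>2 * (y \<bullet> (S *v y))"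
        using v0 symmetric_inner_swap[OF S(1), of v y]
        by (simp add: inner_add_left inner_add_right matrix_vector_right_distrib
          matrix_vector_mult_scaleR algebra_simps power2_eq_square flip: y_def)
      finally show ?thesis .
    qed
    then have "y \<bullet> y = 0" using S(2)[of y] by (rule nonneg_quadratic_linear_coeff_zero)
    then have "S *v (S *v v) = 0" by (simp add: y_def)
    then have "M *v v = 0" using S(3) by (simp add: matrix_vector_mul_assoc)
    then show False using M2_positive_definite[OF n M that] by simp
  qed
qed

text \<open>
  Any \<open>X\<close> with \<open>X X^T = c M\<close> has the form \<open>sqrt c S O\<close> with \<open>S\<close> the square root of \<open>M\<close> and \<open>O\<close> orthogonal.
  The substitution \<open>y = S z\<close> absorbs the Jacobian, \<open>O\<close> drops out by rotation invariance, and the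
  factor \<open>c^s\<close> is the homogeneity of the kernel.
\<close>

theorem nn_integral_M2_kernel:
  fixes M X :: "real^'n^'n" and g :: "real^'n \<Rightarrow> real"
  assumes n: "2 \<le> CARD('n)" and M: "M \<in> M2" and X: "X ** transpose X = c *\<^sub>R M" and c: "0 < c"
    and [measurable]: "g \<in> borel_measurable borel"
  shows "(\<integral>\<^sup>+z. ennreal (g (X *v z) / norm z powr (real CARD('n) + 2 * s)) \<partial>lborel)
    = ennreal (c powr s) * (\<integral>\<^sup>+y. ennreal (g y / norm (matrix_inv (matrix_sqrt M) *v y) powr (real CARD('n) + 2 * s)
       * det (matrix_inv (matrix_sqrt M))) \<partial>lborel)"
proof -
  define p where "p = real CARD('n) + 2 * s"
  define S where "S = matrix_sqrt M"
  have S: "transpose S = S" "\<And>v. v \<noteq> 0 \<Longrightarrow> 0 < v \<bullet> (S *v v)" "S ** S = M"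
    unfolding S_def using M2_sqrt[OF n M] by blast+
  have detS: "0 < det S" using nn_integral_lborel_symmetric(1)[of S "\<lambda>_. 0"] S by simp
  define W where "W = matrix_inv S"
  have inv: "invertible S" using detS by (simp add: invertible_det_nz)
  have WS: "W ** S = mat 1" "S ** W = mat 1"
    using someI_ex[OF inv[unfolded invertible_def]] unfolding W_def matrix_inv_def by blast+
  have "det W * det S = 1" by (metis WS(1) det_I det_mul)
  then have detW: "det W = 1 / det S" using detS by (simp add: field_simps)
  have symW: "transpose W = W"
  proof -
    have "transpose W ** S = mat 1" using WS(2) S(1) by (metis matrix_transpose_mul transpose_mat)
    then have "transpose W ** (S ** W) = W" by (simp add: matrix_mul_assoc)
    then show ?thesis by (simp add: WS)
  qed
  define G where "G z = ennreal (g (S *v z) / norm z powr p)" for z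
  have [measurable]: "G \<in> borel_measurable borel" unfolding G_def by measurable
  have "(\<integral>\<^sup>+y. ennreal (g y / norm (W *v y) powr p * det W) \<partial>lborel)
      = ennreal (det S) * (\<integral>\<^sup>+z. ennreal (g (S *v z) / norm (W *v (S *v z)) powr p * det W) \<partial>lborel)"
    by (rule nn_integral_lborel_symmetric(2)[symmetric]) (use S in auto)
  also have "\<dots> = (\<integral>\<^sup>+z. ennreal (det S) * ennreal (g (S *v z) / norm z powr p * det W) \<partial>lborel)"
    by (subst nn_integral_cmult) (simp_all add: matrix_vector_mul_assoc WS)
  also have "\<dots> = (\<integral>\<^sup>+z. G z \<partial>lborel)"
    using detS by (intro nn_integral_cong) (simp add: G_def detW ennreal_mult'[symmetric])
  finally have rhs: "(\<integral>\<^sup>+y. ennreal (g y / norm (W *v y) powr p * det W) \<partial>lborel) = (\<integral>\<^sup>+z. G z \<partial>lborel)" .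
  \<comment> \<open>the orthogonal factor in the polar decomposition of \<open>X\<close>\<close>
  define O' where "O' = (1 / sqrt c) *\<^sub>R (W ** X)"
  have "O' ** transpose O' = mat 1"
  proof -
    have "O' ** transpose O' = (1 / sqrt c * (1 / sqrt c)) *\<^sub>R (W ** X ** (transpose X ** W))"
      by (simp add: O'_def transpose_linear matrix_transpose_mul symW matrix_mul_scaleR)
    also have "W ** X ** (transpose X ** W) = W ** (X ** transpose X) ** W"
      by (simp add: matrix_mul_assoc)
    also have "\<dots> = c *\<^sub>R (W ** (S ** S) ** W)"
      by (simp add: X S matrix_mul_scaleR)
    also have "W ** (S ** S) ** W = mat 1"
      by (metis WS matrix_mul_assoc matrix_mul_lid)
    finally show ?thesis using c by simp
  qed
  then have orth: "orthogonal_matrix O'"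
    by (simp add: orthogonal_matrix_def matrix_left_right_inverse)
  have XO: "X *v z = sqrt c *\<^sub>R (S *v (O' *v z))" for z
    using c by (simp add: O'_def scaleR_matrix_vector_assoc[symmetric] matrix_vector_mul_assoc
       matrix_vector_mult_scaleR matrix_mul_assoc WS)
  have nO: "norm (O' *v z) = norm z" for z
    by (rule orthogonal_matrix_norm[OF orth])
  have "(\<integral>\<^sup>+z. ennreal (g (X *v z) / norm z powr p) \<partial>lborel)
     = (\<integral>\<^sup>+z. ennreal (g (sqrt c *\<^sub>R (S *v (O' *v z))) / norm (O' *v z) powr p) \<partial>lborel)"
    by (simp add: XO nO)
  also have "\<dots> = (\<integral>\<^sup>+z. ennreal (g (sqrt c *\<^sub>R (S *v z)) / norm z powr p) \<partial>lborel)"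
    by (rule nn_integral_lborel_orthogonal[OF orth, where f="\<lambda>z. ennreal (g (sqrt c *\<^sub>R (S *v z)) / norm z powr p)"]) simp
  also have "\<dots> = (\<integral>\<^sup>+z. ennreal (sqrt c powr p) * G (sqrt c *\<^sub>R z) \<partial>lborel)"
    using c by (intro nn_integral_cong)
      (simp add: G_def ennreal_mult'[symmetric] powr_mult matrix_vector_mult_scaleR)
  also have "\<dots> = ennreal (sqrt c powr p) * (ennreal (sqrt c powr (- real CARD('n))) * (\<integral>\<^sup>+z. G z \<partial>lborel))"
    using c by (simp add: nn_integral_cmult nn_integral_lborel_scale)
  also have "\<dots> = ennreal (sqrt c powr p * sqrt c powr (- real CARD('n))) * (\<integral>\<^sup>+z. G z \<partial>lborel)"
    by (simp add: ennreal_mult mult.assoc)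
  also have "sqrt c powr p * sqrt c powr (- real CARD('n)) = c powr s"
    using c by (simp add: powr_half_sqrt[symmetric] powr_powr powr_add[symmetric] p_def field_simps)
  finally show ?thesis unfolding rhs[symmetric] by (simp add: p_def S_def W_def)
qed

section \<open>Integrals over hyperplanes\<close>

definition perp :: "real^'n \<Rightarrow> real^'n \<Rightarrow> real^'n" where
  "perp e y = y - (e \<bullet> y) *\<^sub>R e"

text \<open>
  The integral of \<open>G\<close> over the hyperplane orthogonal to the unit vector \<open>e\<close>. To stay in the same
  space, the hyperplane is thickened to a slab of width 1 on which \<open>G\<close> is extended constantly along \<open>e\<close>.
\<close>

definition hyp :: "real^'n \<Rightarrow> (real^'n \<Rightarrow> ennreal) \<Rightarrow> ennreal" where
  "hyp e G = (\<integral>\<^sup>+y. indicator {0..1} (e \<bullet> y) * G (perp e y) \<partial>lborel)"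

lemma inner_perp: "norm e = 1 \<Longrightarrow> e \<bullet> perp e y = 0"
  by (simp add: perp_def inner_diff_right norm_eq_1)

lemma perp_add_multiple: "norm e = 1 \<Longrightarrow> e \<bullet> v = 0 \<Longrightarrow> perp e (v + t *\<^sub>R e) = v"
  by (simp add: perp_def inner_add_right norm_eq_1)

lemma perp_scaleR: "perp e (c *\<^sub>R y) = c *\<^sub>R perp e y"
  by (simp add: perp_def scaleR_diff_right)

lemma norm_perp_decomposition: "norm e = 1 \<Longrightarrow> (norm y)\<^sup>2 = (norm (perp e y))\<^sup>2 + (e \<bullet> y)\<^sup>2"
  unfolding power2_norm_eq_inner power2_eq_square[of "e \<bullet> y"]
  by (simp add: perp_def inner_diff_left inner_diff_right norm_eq_1 inner_commute)

lemma norm_add_multiple: "norm e = 1 \<Longrightarrow> e \<bullet> v = 0 \<Longrightarrow> (norm (v + t *\<^sub>R e))\<^sup>2 = (norm v)\<^sup>2 + t\<^sup>2"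
  unfolding power2_norm_eq_inner power2_eq_square[of t]
  by (simp add: inner_add_left inner_add_right norm_eq_1 inner_commute)

lemma power2_powr_half: "0 \<le> (t::real) \<Longrightarrow> (t\<^sup>2) powr (p / 2) = t powr p"
proof (cases "t = 0")
  case False
  moreover assume "0 \<le> t"
  ultimately have "t\<^sup>2 = t powr 2" by simp
  then show ?thesis by (simp only: powr_powr) simp
qed simp

lemma norm_powr_eq: "norm x powr p = ((norm x)\<^sup>2) powr (p / 2)"
  by (simp add: power2_powr_half)

lemma borel_measurable_perp [measurable]: "perp e \<in> borel_measurable borel"
  unfolding perp_def by measurable

lemma hyp_cong: "norm e = 1 \<Longrightarrow> (\<And>v. e \<bullet> v = 0 \<Longrightarrow> G v = G' v) \<Longrightarrow> hyp e G = hyp e G'"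
  unfolding hyp_def by (intro nn_integral_cong) (simp add: inner_perp)

lemma hyp_cmult: "G \<in> borel_measurable borel \<Longrightarrow> hyp e (\<lambda>v. c * G v) = c * hyp e G"
  unfolding hyp_def by (subst nn_integral_cmult[symmetric]) (auto intro!: nn_integral_cong simp: mult_ac)

lemma nn_integral_unit_interval_reflected:
  "(\<integral>\<^sup>+t. indicator {0..1} (a - t) \<partial>lborel) = (1::ennreal)" for a :: real
proof -
  have "(\<integral>\<^sup>+t. indicator {0..1} (a - t) \<partial>lborel) = (\<integral>\<^sup>+t. indicator {a - 1..a} t \<partial>lborel)"
    by (intro nn_integral_cong) (auto simp: indicator_def)
  also have "\<dots> = 1" by simp
  finally show ?thesis .
qed

text \<open>
  Fubini for the splitting into \<open>e\<close> and its orthogonal complement, obtained from translation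
  invariance along \<open>e\<close> alone.
\<close>

lemma nn_integral_hyperplane_slices:
  fixes f :: "real^'n \<Rightarrow> ennreal"
  assumes e: "norm e = 1" and [measurable]: "f \<in> borel_measurable borel"
  shows "(\<integral>\<^sup>+y. f y \<partial>lborel) = hyp e (\<lambda>v. \<integral>\<^sup>+t. f (v + t *\<^sub>R e) \<partial>lborel)"
proof -
  have "hyp e (\<lambda>v. \<integral>\<^sup>+t. f (v + t *\<^sub>R e) \<partial>lborel)
      = (\<integral>\<^sup>+y. \<integral>\<^sup>+t. indicator {0..1} (e \<bullet> y) * f (y + t *\<^sub>R e) \<partial>lborel \<partial>lborel)"
    unfolding hyp_def
  proof (rule nn_integral_cong)
    fix y :: "real^'n"
    have "(\<integral>\<^sup>+t. f (perp e y + t *\<^sub>R e) \<partial>lborel) = (\<integral>\<^sup>+t. f (perp e y + (e \<bullet> y + t) *\<^sub>R e) \<partial>lborel)"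
      by (rule nn_integral_lborel_translation[symmetric]) simp
    also have "\<dots> = (\<integral>\<^sup>+t. f (y + t *\<^sub>R e) \<partial>lborel)"
      by (simp add: perp_def scaleR_add_left)
    finally show "indicator {0..1} (e \<bullet> y) * (\<integral>\<^sup>+t. f (perp e y + t *\<^sub>R e) \<partial>lborel)
      = (\<integral>\<^sup>+t. indicator {0..1} (e \<bullet> y) * f (y + t *\<^sub>R e) \<partial>lborel)"
      by (simp add: nn_integral_cmult)
  qed
  also have "\<dots> = (\<integral>\<^sup>+t. \<integral>\<^sup>+y. indicator {0..1} (e \<bullet> y) * f (y + t *\<^sub>R e) \<partial>lborel \<partial>lborel)"
    by (rule lborel_pair.Fubini') simp
  also have "\<dots> = (\<integral>\<^sup>+t. \<integral>\<^sup>+y. indicator {0..1} (e \<bullet> y - t) * f y \<partial>lborel \<partial>lborel)"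
  proof (rule nn_integral_cong)
    fix t :: real
    show "(\<integral>\<^sup>+y. indicator {0..1} (e \<bullet> y) * f (y + t *\<^sub>R e) \<partial>lborel)
        = (\<integral>\<^sup>+y. indicator {0..1} (e \<bullet> y - t) * f y \<partial>lborel)"
      using nn_integral_lborel_translation[of "\<lambda>y. indicator {0..1} (e \<bullet> y - t) * f y" "t *\<^sub>R e"] e
      by (simp add: inner_add_right norm_eq_1 add.commute)
  qed
  also have "\<dots> = (\<integral>\<^sup>+y. \<integral>\<^sup>+t. indicator {0..1} (e \<bullet> y - t) * f y \<partial>lborel \<partial>lborel)"
    by (rule lborel_pair.Fubini') simp
  also have "\<dots> = (\<integral>\<^sup>+y. f y \<partial>lborel)"
    by (simp add: nn_integral_multc nn_integral_unit_interval_reflected)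
  finally show ?thesis by simp
qed

text \<open>
  The unit slab in the definition of the hyperplane integral may be replaced by any weight in the normal direction.
\<close>

lemma nn_integral_product_hyperplane:
  fixes w :: "real \<Rightarrow> ennreal"
  assumes e: "norm e = 1" and [measurable]: "w \<in> borel_measurable borel" "G \<in> borel_measurable borel"
  shows "(\<integral>\<^sup>+y. w (e \<bullet> y) * G (perp e y) \<partial>lborel) = (\<integral>\<^sup>+t. w t \<partial>lborel) * hyp e G"
proof -
  have "(\<integral>\<^sup>+y. w (e \<bullet> y) * G (perp e y) \<partial>lborel)
      = hyp e (\<lambda>v. \<integral>\<^sup>+t. w (e \<bullet> (v + t *\<^sub>R e)) * G (perp e (v + t *\<^sub>R e)) \<partial>lborel)"
    by (rule nn_integral_hyperplane_slices[OF e]) simp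
  also have "\<dots> = hyp e (\<lambda>v. (\<integral>\<^sup>+t. w t \<partial>lborel) * G v)"
    using e by (intro hyp_cong) (simp_all add: perp_add_multiple inner_add_right norm_eq_1 nn_integral_multc)
  finally show ?thesis by (simp add: hyp_cmult)
qed

lemma hyp_scale:
  fixes G :: "real^'n \<Rightarrow> ennreal"
  assumes e: "norm e = 1" and [measurable]: "G \<in> borel_measurable borel" and c: "0 < c"
  shows "hyp e (\<lambda>v. G (c *\<^sub>R v)) = ennreal (c powr (1 - real CARD('n))) * hyp e G"
proof -
  have "hyp e (\<lambda>v. G (c *\<^sub>R v)) = (\<integral>\<^sup>+y. indicator {0..c} (e \<bullet> (c *\<^sub>R y)) * G (perp e (c *\<^sub>R y)) \<partial>lborel)"
    unfolding hyp_def using c by (intro nn_integral_cong) (simp add: perp_scaleR indicator_def zero_le_mult_iff)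
  also have "\<dots> = ennreal (c powr (- real CARD('n))) * (\<integral>\<^sup>+y. indicator {0..c} (e \<bullet> y) * G (perp e y) \<partial>lborel)"
    by (rule nn_integral_lborel_scale[OF _ c]) simp
  also have "(\<integral>\<^sup>+y. indicator {0..c} (e \<bullet> y) * G (perp e y) \<partial>lborel) = ennreal c * hyp e G"
    using c by (subst nn_integral_product_hyperplane[OF e]) simp_all
  also have "ennreal (c powr (- real CARD('n))) * (ennreal c * hyp e G) = ennreal (c powr (1 - real CARD('n))) * hyp e G"
  proof -
    have "c powr (1 - real CARD('n)) = c powr (- real CARD('n)) * c"
      using c by (simp add: powr_diff powr_minus field_simps)
    then show ?thesis using c by (simp add: ennreal_mult mult.assoc)
  qed
  finally show ?thesis .
qed

lemma orthogonal_matrix_moving_unit_vector: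
  fixes e e' :: "real^'n"
  assumes "norm e = norm e'"
  obtains X where "orthogonal_matrix X" "X *v e = e'" "\<And>x y. (X *v x) \<bullet> (X *v y) = x \<bullet> y"
proof -
  obtain f where f: "orthogonal_transformation f" "f e = e'"
    using orthogonal_transformation_exists[OF assms] by metis
  then have "linear f" "orthogonal_matrix (matrix f)" by (auto simp: orthogonal_transformation_matrix)
  moreover have "matrix f *v x = f x" for x using \<open>linear f\<close> by (simp add: matrix_works)
  ultimately show ?thesis using f that[of "matrix f"] by (simp add: orthogonal_transformation_def)
qed

lemma hyp_radial_rotate:
  fixes e e' :: "real^'n" and G :: "real \<Rightarrow> ennreal"
  assumes e: "norm e = 1" "norm e' = 1" and [measurable]: "G \<in> borel_measurable borel"
  shows "hyp e (\<lambda>v. G (norm v)) = hyp e' (\<lambda>v. G (norm v))"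
proof -
  obtain X where X: "orthogonal_matrix X" "X *v e = e'" "\<And>x y. (X *v x) \<bullet> (X *v y) = x \<bullet> y"
    using orthogonal_matrix_moving_unit_vector[of e e'] e by auto
  have ip: "e' \<bullet> (X *v y) = e \<bullet> y" for y
    using X(3)[of e y] X(2) by simp
  then have "perp e' (X *v y) = X *v perp e y" for y
    by (simp add: perp_def X(2) matrix_vector_mult_diff_distrib matrix_vector_mult_scaleR)
  then have *: "norm (perp e' (X *v y)) = norm (perp e y)" for y
    by (simp add: orthogonal_matrix_norm X)
  show ?thesis
    unfolding hyp_def
    by (subst (2) nn_integral_lborel_orthogonal[OF X(1), symmetric]) (simp_all add: * ip)
qed


lemma nn_integral_abs_le:
  fixes f :: "real \<Rightarrow> ennreal"
  assumes [measurable]: "f \<in> borel_measurable borel"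
  shows "(\<integral>\<^sup>+t. f \<bar>t\<bar> \<partial>lborel) \<le> 2 * (\<integral>\<^sup>+t. f t * indicator {0..} t \<partial>lborel)"
proof -
  have "(\<integral>\<^sup>+t. f \<bar>t\<bar> \<partial>lborel)
      \<le> (\<integral>\<^sup>+t. f t * indicator {0..} t + f (0 + (-1) * t) * indicator {0..} (0 + (-1) * t) \<partial>lborel)"
    by (intro nn_integral_mono) (auto simp: indicator_def)
  also have "\<dots> = (\<integral>\<^sup>+t. f t * indicator {0..} t \<partial>lborel)
      + (\<integral>\<^sup>+t. f (0 + (-1) * t) * indicator {0..} (0 + (-1) * t) \<partial>lborel)"
    by (rule nn_integral_add) auto
  also have "(\<integral>\<^sup>+t. f (0 + (-1) * t) * indicator {0..} (0 + (-1) * t) \<partial>lborel)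
      = (\<integral>\<^sup>+t. f t * indicator {0..} t \<partial>lborel)"
    by (subst (2) nn_integral_real_affine[of _ "-1" 0]) auto
  finally show ?thesis by (simp add: mult_2)
qed

text \<open>
  Compare with one power near 0 and another one near infinity.
\<close>

lemma nn_integral_finite_by_powr:
  fixes f :: "real \<Rightarrow> real"
  assumes [measurable]: "f \<in> borel_measurable borel"
    and a: "-1 < a" "\<And>t. 0 < t \<Longrightarrow> t \<le> 1 \<Longrightarrow> f t \<le> A * t powr a"
    and b: "b < -1" "\<And>t. 1 \<le> t \<Longrightarrow> f t \<le> B * t powr b"
    and AB: "0 \<le> A" "0 \<le> B"
  shows "(\<integral>\<^sup>+t. ennreal (f \<bar>t\<bar>) \<partial>lborel) < \<infinity>"
proof -
  have 1: "(\<integral>\<^sup>+t. ennreal (t powr a) * indicator {0..1} t \<partial>lborel) = ennreal (1 powr (a + 1) / (a + 1))"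
    by (rule nn_integral_has_integral_lebesgue'[OF _ has_integral_powr_from_0[OF a(1)]]) auto
  have 2: "(\<integral>\<^sup>+t. ennreal (t powr b) * indicator {1..} t \<partial>lborel) = ennreal (- (1 powr (b + 1)) / (b + 1))"
    by (rule nn_integral_has_integral_lebesgue'[OF _ has_integral_powr_to_inf[OF b(1)]]) auto
  have "(\<integral>\<^sup>+t. ennreal (f t) * indicator {0..} t \<partial>lborel)
      \<le> (\<integral>\<^sup>+t. ennreal A * (ennreal (t powr a) * indicator {0..1} t)
         + ennreal B * (ennreal (t powr b) * indicator {1..} t) \<partial>lborel)"
  proof (rule nn_integral_mono_AE, rule AE_mp[OF AE_lborel_singleton[of 0]], intro AE_I2 impI)
    fix t :: real assume "t \<noteq> 0"
    then consider "t < 0" | "0 < t" "t \<le> 1" | "1 < t" by linarith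
    then show "ennreal (f t) * indicator {0..} t \<le> ennreal A * (ennreal (t powr a) * indicator {0..1} t)
         + ennreal B * (ennreal (t powr b) * indicator {1..} t)"
    proof cases
      case 1 then show ?thesis by simp
    next
      case 2
      then have "ennreal (f t) \<le> ennreal A * ennreal (t powr a)"
        using a(2)[OF 2] AB by (simp add: ennreal_mult[symmetric] ennreal_leI)
      then show ?thesis using 2 by (simp add: add_increasing2)
    next
      case 3
      then have "ennreal (f t) \<le> ennreal B * ennreal (t powr b)"
        using b(2)[of t] AB by (simp add: ennreal_mult[symmetric] ennreal_leI)
      then show ?thesis using 3 by (simp add: add_increasing)
    qed
  qed
  also have "\<dots> < \<infinity>"
    by (subst nn_integral_add) (auto simp: nn_integral_cmult 1 2 ennreal_mult_less_top)
  finally have "2 * (\<integral>\<^sup>+t. ennreal (f t) * indicator {0..} t \<partial>lborel) < \<infinity>"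
    by (simp add: ennreal_mult_less_top)
  then show ?thesis
    using nn_integral_abs_le[of "\<lambda>t. ennreal (f t)"] by (simp add: order.strict_trans1)
qed

lemma nn_integral_bell_finite:
  assumes r: "1 / 2 < r"
  shows "(\<integral>\<^sup>+t. ennreal (1 / (1 + t\<^sup>2) powr r) \<partial>lborel) < \<infinity>"
proof -
  have "(\<integral>\<^sup>+t. ennreal (1 / (1 + \<bar>t\<bar>\<^sup>2) powr r) \<partial>lborel) < \<infinity>"
  proof (rule nn_integral_finite_by_powr[where a=0 and A=1 and b="- 2 * r" and B=1])
    fix t :: real
    have "1 \<le> (1 + t\<^sup>2) powr r" using r by (intro ge_one_powr_ge_zero) auto
    then show "1 / (1 + t\<^sup>2) powr r \<le> 1 * t powr 0" if "0 < t"
      using that by (auto simp: divide_le_eq_1)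
    have "(t\<^sup>2) powr r \<le> (1 + t\<^sup>2) powr r" if "1 \<le> t" using r by (intro powr_mono2) auto
    moreover have "(t\<^sup>2) powr r = t powr (2 * r)" if "1 \<le> t"
      using that power2_powr_half[of t "2 * r"] by simp
    ultimately show "1 / (1 + t\<^sup>2) powr r \<le> 1 * t powr (- 2 * r)" if "1 \<le> t"
      using that by (simp add: powr_minus divide_inverse le_imp_inverse_le)
  qed (use r in auto)
  then show ?thesis by simp
qed

section \<open>Hyperplane integrals as product integrals\<close>

text \<open>
  The two versions of Lebesgue measure agree on boxes.
\<close>

lemma nn_integral_vec_eq_PiM:
  fixes h :: "nat \<Rightarrow> 'n::finite" and f :: "real^'n \<Rightarrow> ennreal"
  assumes h: "bij_betw h {..<m} UNIV" and [measurable]: "f \<in> borel_measurable borel"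
  shows "(\<integral>\<^sup>+y. f y \<partial>lborel) = (\<integral>\<^sup>+z. f (\<chi> i. z (the_inv_into {..<m} h i)) \<partial>lborel_pow m)"
proof -
  interpret product_sigma_finite "\<lambda>_::nat. lborel :: real measure" ..
  define h' where "h' = the_inv_into {..<m} h"
  have h': "bij_betw h' UNIV {..<m}" unfolding h'_def by (rule bij_betw_the_inv_into[OF h])
  have h'_less: "h' i < m" for i using h' by (auto simp: bij_betw_def)
  have [measurable]: "(\<lambda>z. \<chi> i. z (h' i)) \<in> lborel_pow m \<rightarrow>\<^sub>M (borel :: (real^'n) measure)"
  proof (rule borel_measurable_euclidean_space[THEN iffD2], intro ballI)
    fix b :: "real^'n" assume "b \<in> Basis"
    then obtain i where "b = axis i 1" by (auto simp: Basis_vec_def)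
    then show "(\<lambda>z. (\<chi> i. z (h' i)) \<bullet> b) \<in> borel_measurable (lborel_pow m)"
      using h'_less[of i] by (simp add: inner_axis) measurable
  qed
  have "lborel = distr (lborel_pow m) borel (\<lambda>z. \<chi> i. z (h' i) :: real^'n)"
  proof (rule lborel_eqI)
    fix l u :: "real^'n" assume le: "\<And>b. b \<in> Basis \<Longrightarrow> l \<bullet> b \<le> u \<bullet> b"
    have le': "l $ i \<le> u $ i" for i
      using le[of "axis i 1"] by (simp add: inner_axis axis_in_Basis_iff)
    have "(\<lambda>z. \<chi> i. z (h' i)) -` box l u \<inter> space (lborel_pow m)
        = (\<Pi>\<^sub>E k\<in>{..<m}. {l $ h k <..< u $ h k})"
    proof -
      have "(\<forall>i. l $ i < z (h' i) \<and> z (h' i) < u $ i) \<longleftrightarrow> (\<forall>k<m. l $ h k < z k \<and> z k < u $ h k)" for z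
      proof -
        have "h' (h k) = k" if "k < m" for k
          using that h unfolding h'_def by (intro the_inv_into_f_f) (auto simp: bij_betw_def)
        moreover have "h (h' i) = i" for i
          using h unfolding h'_def by (intro f_the_inv_into_f) (auto simp: bij_betw_def)
        ultimately show ?thesis using h'_less by metis
      qed
      then show ?thesis
        by (auto simp: mem_box_cart space_PiM PiE_iff)
    qed
    then have "emeasure (distr (lborel_pow m) borel (\<lambda>z. \<chi> i. z (h' i) :: real^'n)) (box l u)
        = emeasure (lborel_pow m) (\<Pi>\<^sub>E k\<in>{..<m}. {l $ h k <..< u $ h k})"
      by (subst emeasure_distr) auto
    also have "\<dots> = (\<Prod>k<m. emeasure lborel {l $ h k <..< u $ h k})"
      by (rule emeasure_PiM) auto
    also have "\<dots> = (\<Prod>k<m. ennreal (u $ h k - l $ h k))"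
      using le' by simp
    also have "\<dots> = ennreal (\<Prod>k<m. u $ h k - l $ h k)"
      using le' by (intro prod_ennreal) simp
    also have "(\<Prod>k<m. u $ h k - l $ h k) = (\<Prod>i\<in>UNIV. u $ i - l $ i)"
      by (rule prod.reindex_bij_betw[OF h])
    also have "\<dots> = (\<Prod>b\<in>range (\<lambda>i. axis i 1 :: real^'n). (u - l) \<bullet> b)"
      by (subst prod.reindex) (auto simp: inj_on_def axis_eq_axis inner_axis)
    also have "range (\<lambda>i. axis i 1 :: real^'n) = Basis" by (auto simp: Basis_vec_def)
    finally show "emeasure (distr (lborel_pow m) borel (\<lambda>z. \<chi> i. z (h' i) :: real^'n)) (box l u)
        = ennreal (\<Prod>b\<in>Basis. (u - l) \<bullet> b)" .
  qed simp
  then have "(\<integral>\<^sup>+y. f y \<partial>lborel) = (\<integral>\<^sup>+y. f y \<partial>distr (lborel_pow m) borel (\<lambda>z. \<chi> i. z (h' i) :: real^'n))"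
    by simp
  also have "\<dots> = (\<integral>\<^sup>+z. f (\<chi> i. z (h' i)) \<partial>lborel_pow m)"
    by (rule nn_integral_distr) simp_all
  finally show ?thesis by (simp add: h'_def)
qed

lemma borel_measurable_L2_set [measurable]:
  "(\<lambda>z. L2_set z {..<m}) \<in> borel_measurable (lborel_pow m)"
  unfolding L2_set_def by measurable

lemma hyp_axis_eq_PiM:
  fixes k :: "'n::finite" and G :: "real \<Rightarrow> ennreal"
  assumes [measurable]: "G \<in> borel_measurable borel"
  defines "m \<equiv> CARD('n) - 1"
  shows "hyp (axis k 1 :: real^'n) (\<lambda>v. G (norm v)) = (\<integral>\<^sup>+z. G (L2_set z {..<m}) \<partial>lborel_pow m)"
proof -
  interpret product_sigma_finite "\<lambda>_::nat. lborel :: real measure" ..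
  have cardm: "CARD('n) = Suc m" by (simp add: m_def)
  have "card (UNIV - {k}) = m" by (simp add: m_def card_Diff_singleton)
  then obtain h0 where h0: "bij_betw h0 {..<m} (UNIV - {k})"
    using finite_same_card_bij[of "{..<m}" "UNIV - {k}"] by auto
  define h where "h = h0(m := k)"
  have h: "bij_betw h {..<Suc m} UNIV"
  proof -
    have "bij_betw h ({..<m} \<union> {m}) ((UNIV - {k}) \<union> {k})"
      using h0 unfolding h_def
      by (intro bij_betw_combine) (auto simp: bij_betw_def inj_on_def image_iff)
    then show ?thesis by (simp add: lessThan_Suc insert_commute Un_commute)
  qed
  define h' where "h' = the_inv_into {..<Suc m} h"
  have h'h: "h' (h i) = i" if "i \<le> m" for i
    using that h unfolding h'_def by (intro the_inv_into_f_f) (auto simp: bij_betw_def)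
  have h'k: "h' k = m" using h'h[of m] by (simp add: h_def)
  have hh': "h (h' j) = j" for j
    using h unfolding h'_def by (intro f_the_inv_into_f) (auto simp: bij_betw_def)
  define \<Phi> where "\<Phi> z = ((\<chi> j. z (h' j)) :: real^'n)" for z :: "nat \<Rightarrow> real"
  have e: "axis k 1 \<bullet> \<Phi> z = z m" for z
    by (simp add: inner_axis' \<Phi>_def h'k)
  have n: "norm (perp (axis k 1) (\<Phi> z)) = L2_set z {..<m}" for z
  proof -
    have "norm (perp (axis k 1) (\<Phi> z)) = sqrt (\<Sum>j\<in>UNIV. (if j = k then 0 else (z (h' j))\<^sup>2))"
      unfolding norm_vec_def L2_set_def perp_def e
      by (intro arg_cong[where f=sqrt] sum.cong) (auto simp: \<Phi>_def axis_def h'k)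
    also have "(\<Sum>j\<in>UNIV. (if j = k then 0 else (z (h' j))\<^sup>2)) = (\<Sum>j\<in>UNIV - {k}. (z (h' j))\<^sup>2)"
      by (intro sum.mono_neutral_cong_right) auto
    also have "\<dots> = (\<Sum>i<m. (z (h' (h0 i)))\<^sup>2)"
      by (rule sum.reindex_bij_betw[OF h0, symmetric])
    also have "\<dots> = (\<Sum>i<m. (z i)\<^sup>2)"
    proof (rule sum.cong[OF refl])
      fix i assume "i \<in> {..<m}"
      then show "(z (h' (h0 i)))\<^sup>2 = (z i)\<^sup>2" using h'h[of i] by (simp add: h_def)
    qed
    finally show ?thesis by (simp add: L2_set_def)
  qed
  have ins: "{..<Suc m} = insert m {..<m}" by (simp add: lessThan_Suc)
  have L: "L2_set (z(m := y)) {..<m} = L2_set z {..<m}" for z y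
    by (rule L2_set_cong) auto
  have "hyp (axis k 1 :: real^'n) (\<lambda>v. G (norm v))
      = (\<integral>\<^sup>+z. indicator {0..1} (axis k 1 \<bullet> \<Phi> z) * G (norm (perp (axis k 1) (\<Phi> z))) \<partial>lborel_pow (Suc m))"
    unfolding hyp_def \<Phi>_def h'_def by (rule nn_integral_vec_eq_PiM[OF h]) simp
  also have "\<dots> = (\<integral>\<^sup>+z. indicator {0..1} (z m) * G (L2_set z {..<m}) \<partial>lborel_pow (Suc m))"
    by (simp add: e n)
  also have "\<dots> = (\<integral>\<^sup>+z. \<integral>\<^sup>+(y::real). indicator {0..1} y * G (L2_set z {..<m}) \<partial>lborel \<partial>lborel_pow m)"
    unfolding ins
  proof (subst product_nn_integral_insert)
    have "(\<lambda>x. L2_set x {..<m}) \<in> borel_measurable (\<Pi>\<^sub>M i\<in>insert m {..<m}. lborel)"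
      unfolding L2_set_def by measurable
    then show "(\<lambda>x. indicator {0..1} (x m) * G (L2_set x {..<m})) \<in> borel_measurable (\<Pi>\<^sub>M i\<in>insert m {..<m}. lborel)"
      by measurable
  qed (simp_all add: L)
  also have "\<dots> = (\<integral>\<^sup>+z. G (L2_set z {..<m}) \<partial>lborel_pow m)"
    by (simp add: nn_integral_multc)
  finally show ?thesis .
qed

lemma hyp_radial_eq_PiM:
  fixes e :: "real^'n" and G :: "real \<Rightarrow> ennreal"
  assumes e: "norm e = 1" and G: "G \<in> borel_measurable borel"
  shows "hyp e (\<lambda>v. G (norm v)) = (\<integral>\<^sup>+z. G (L2_set z {..<CARD('n) - 1}) \<partial>lborel_pow (CARD('n) - 1))"
  using hyp_radial_rotate[of e "axis undefined 1" G] e G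
  by (simp add: hyp_axis_eq_PiM)

text \<open>
  Each factor satisfies \<open>1 + z_i^2 \<le> 1 + |z|^2\<close>, so the radial weight is at most a product of one-dimensional
  weights with exponent \<open>q/m > 1/2\<close>.
\<close>

lemma nn_integral_PiM_decay_finite:
  assumes q: "real m / 2 < q" and m: "0 < m"
  shows "(\<integral>\<^sup>+z. ennreal (1 / (1 + (L2_set z {..<m})\<^sup>2) powr q) \<partial>lborel_pow m) < \<infinity>"
proof -
  interpret product_sigma_finite "\<lambda>_::nat. lborel :: real measure" ..
  define r where "r = q / real m"
  have r: "1 / 2 < r" using q m by (simp add: r_def field_simps)
  have "(\<integral>\<^sup>+z. ennreal (1 / (1 + (L2_set z {..<m})\<^sup>2) powr q) \<partial>lborel_pow m)
      \<le> (\<integral>\<^sup>+z. (\<Prod>i<m. ennreal (1 / (1 + (z i)\<^sup>2) powr r)) \<partial>lborel_pow m)"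
  proof (rule nn_integral_mono)
    fix z :: "nat \<Rightarrow> real"
    define X where "X = 1 + (L2_set z {..<m})\<^sup>2"
    have X: "1 + (z i)\<^sup>2 \<le> X" if "i < m" for i
      using member_le_sum[of i "{..<m}" "\<lambda>i. (z i)\<^sup>2"] that
      by (simp add: X_def L2_set_def sum_nonneg)
    have "(\<Prod>i<m. (1 + (z i)\<^sup>2) powr r) \<le> (\<Prod>i<m. X powr r)"
      using X r by (intro prod_mono) (auto intro!: powr_mono2)
    also have "\<dots> = X powr q"
    proof -
      have "0 < X" by (simp add: X_def add_pos_nonneg)
      then have "(X powr r) ^ m = (X powr r) powr real m" by (simp add: powr_realpow)
      also have "\<dots> = X powr q" using m by (simp add: powr_powr r_def)
      finally show ?thesis by simp
    qed
    finally have le: "(\<Prod>i<m. (1 + (z i)\<^sup>2) powr r) \<le> X powr q" .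
    have pos: "1 + t\<^sup>2 \<noteq> 0" for t :: real
      by (metis add_pos_nonneg less_irrefl zero_le_power2 zero_less_one)
    have "1 / X powr q \<le> 1 / (\<Prod>i<m. (1 + (z i)\<^sup>2) powr r)"
      using le pos by (intro divide_left_mono) (auto intro!: prod_pos mult_pos_pos simp: X_def)
    also have "\<dots> = (\<Prod>i<m. 1 / (1 + (z i)\<^sup>2) powr r)"
      by (simp add: prod_dividef)
    finally show "ennreal (1 / (1 + (L2_set z {..<m})\<^sup>2) powr q) \<le> (\<Prod>i<m. ennreal (1 / (1 + (z i)\<^sup>2) powr r))"
      by (simp add: X_def prod_ennreal ennreal_leI)
  qed
  also have "\<dots> = (\<Prod>i<m. \<integral>\<^sup>+t. ennreal (1 / (1 + t\<^sup>2) powr r) \<partial>lborel)"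
    by (rule product_nn_integral_prod) auto
  also have "\<dots> < \<infinity>"
    using nn_integral_bell_finite[OF r] by (simp add: power_less_top_ennreal)
  finally show ?thesis .
qed

lemma hyp_decay_finite:
  fixes e :: "real^'n"
  assumes e: "norm e = 1" and q: "(real CARD('n) - 1) / 2 < q" and n: "2 \<le> CARD('n)"
  shows "hyp e (\<lambda>v. ennreal (1 / (1 + (norm v)\<^sup>2) powr q)) < \<infinity>"
  using nn_integral_PiM_decay_finite[of "CARD('n) - 1" q] assms
  by (subst hyp_radial_eq_PiM[OF e, of "\<lambda>r. ennreal (1 / (1 + r\<^sup>2) powr q)"]) (auto simp: of_nat_diff)

section \<open>The singular kernel and the majorant of second differences\<close>

text \<open>
  The majorant of the second differences of an \<open>L\<close>-Lipschitz function that is semiconcave with constant \<open>SC\<close>.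
\<close>

definition rho :: "real \<Rightarrow> real \<Rightarrow> real \<Rightarrow> real" where
  "rho L SC r = min (2 * L * r) (SC * r\<^sup>2)"

lemma rho_nonneg: "0 \<le> L \<Longrightarrow> 0 \<le> SC \<Longrightarrow> 0 \<le> r \<Longrightarrow> 0 \<le> rho L SC r"
  by (simp add: rho_def)

lemma rho_mono: "0 \<le> L \<Longrightarrow> 0 \<le> SC \<Longrightarrow> 0 \<le> r \<Longrightarrow> r \<le> r' \<Longrightarrow> rho L SC r \<le> rho L SC r'"
  unfolding rho_def by (intro min.mono mult_left_mono power_mono) auto

text \<open>
  The majorant grows at most quadratically.
\<close>

lemma rho_shrink:
  assumes "0 \<le> L" "0 \<le> SC" "0 \<le> r" "0 \<le> t" "t \<le> 1"
  shows "t\<^sup>2 * rho L SC r \<le> rho L SC (t * r)"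
proof -
  have "t\<^sup>2 \<le> t" using assms by (simp add: power2_eq_square mult_left_le)
  then have "t\<^sup>2 * (2 * L * r) \<le> t * (2 * L * r)" using assms by (intro mult_right_mono) auto
  moreover have "t\<^sup>2 * rho L SC r \<le> t\<^sup>2 * (2 * L * r)" "t\<^sup>2 * rho L SC r \<le> t\<^sup>2 * (SC * r\<^sup>2)"
    by (auto simp: rho_def intro!: mult_left_mono)
  ultimately show ?thesis by (simp add: rho_def power_mult_distrib mult_ac)
qed

text \<open>
  As a function of \<open>r^2\<close> the majorant is concave and vanishes at 0, hence subadditive.
\<close>

lemma rho_pythagoras:
  assumes "0 \<le> L" "0 \<le> SC" "0 \<le> a" "0 \<le> b" "0 \<le> r" "r\<^sup>2 = a\<^sup>2 + b\<^sup>2"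
  shows "rho L SC r \<le> rho L SC a + rho L SC b"
proof (cases "r = 0")
  case True
  then have "a = 0" "b = 0" using assms by (auto simp: sum_power2_eq_zero_iff)
  then show ?thesis using True by (simp add: rho_def)
next
  case False
  then have r: "0 < r" using assms by simp
  have a: "a / r \<le> 1" and b: "b / r \<le> 1"
    using assms r power2_le_imp_le[of a r] power2_le_imp_le[of b r] by auto
  have "rho L SC r = ((a / r)\<^sup>2 + (b / r)\<^sup>2) * rho L SC r"
    using assms(6)[symmetric] r by (simp add: power_divide add_divide_distrib[symmetric])
  also have "\<dots> = (a / r)\<^sup>2 * rho L SC r + (b / r)\<^sup>2 * rho L SC r" by (simp add: distrib_right)
  also have "\<dots> \<le> rho L SC (a / r * r) + rho L SC (b / r * r)"
    using assms a b r by (intro add_mono rho_shrink) auto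
  finally show ?thesis using r by simp
qed

lemma rho_sum:
  assumes "0 \<le> L" "0 \<le> SC" "finite I" "\<And>i. i \<in> I \<Longrightarrow> 0 \<le> a i"
  shows "rho L SC (sqrt (\<Sum>i\<in>I. (a i)\<^sup>2)) \<le> (\<Sum>i\<in>I. rho L SC (a i))"
  using assms(3,4)
proof (induction I)
  case empty then show ?case by (simp add: rho_def)
next
  case (insert j I)
  have "rho L SC (sqrt (\<Sum>i\<in>insert j I. (a i)\<^sup>2)) \<le> rho L SC (a j) + rho L SC (sqrt (\<Sum>i\<in>I. (a i)\<^sup>2))"
    using insert assms(1,2) by (intro rho_pythagoras) (auto simp: sum_nonneg)
  then show ?case using insert by fastforce
qed

lemma borel_measurable_rho [measurable]: "rho L SC \<in> borel_measurable borel"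
  unfolding rho_def by measurable

text \<open>
  Only the positive part of \<open>w\<close> enters, since \<open>ennreal\<close> truncates. Signed inequalities \<open>\<integral> w \<ge> c\<close> are stated below in the form
  \<open>kernel_integral s (- w) + c \<le> kernel_integral s w\<close>, which is meaningful without integrability.
\<close>

definition kernel_integral :: "real \<Rightarrow> (real^'n \<Rightarrow> real) \<Rightarrow> ennreal" where
  "kernel_integral s w = (\<integral>\<^sup>+y. ennreal (w y / norm y powr (real CARD('n) + 2 * s)) \<partial>lborel)"

lemma kernel_integral_mono: "(\<And>y. w y \<le> w' y) \<Longrightarrow> kernel_integral s w \<le> kernel_integral s w'"
  unfolding kernel_integral_def by (intro nn_integral_mono ennreal_leI divide_right_mono) auto

lemma kernel_integral_cmult:
  assumes "w \<in> borel_measurable borel" "0 \<le> c"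
  shows "kernel_integral s (\<lambda>y. c * w y) = ennreal c * kernel_integral s w"
  unfolding kernel_integral_def using assms
  by (subst nn_integral_cmult[symmetric]) (auto simp: ennreal_mult'[symmetric])

lemma kernel_integral_add:
  fixes w w' :: "real^'n \<Rightarrow> real"
  assumes [measurable]: "w \<in> borel_measurable borel" "w' \<in> borel_measurable borel"
    and "\<And>y. 0 \<le> w y" "\<And>y. 0 \<le> w' y"
  shows "kernel_integral s (\<lambda>y. w y + w' y) = kernel_integral s w + kernel_integral s w'"
  unfolding kernel_integral_def using assms(3,4)
  by (subst nn_integral_add[symmetric]) (auto simp: add_divide_distrib ennreal_plus[symmetric] simp del: ennreal_plus)

lemma kernel_integral_sum:
  fixes w :: "'i \<Rightarrow> real^'n \<Rightarrow> real"
  assumes "finite I" "\<And>i. i \<in> I \<Longrightarrow> w i \<in> borel_measurable borel" "\<And>i y. i \<in> I \<Longrightarrow> 0 \<le> w i y"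
  shows "kernel_integral s (\<lambda>y. \<Sum>i\<in>I. w i y) = (\<Sum>i\<in>I. kernel_integral s (w i))"
  using assms
proof (induction I)
  case empty then show ?case by (simp add: kernel_integral_def)
next
  case (insert i I)
  then show ?case by (simp add: kernel_integral_add sum_nonneg)
qed

lemma kernel_integral_orthogonal:
  fixes w :: "real^'n \<Rightarrow> real"
  assumes X: "orthogonal_matrix X" and [measurable]: "w \<in> borel_measurable borel"
  shows "kernel_integral s (\<lambda>y. w (X *v y)) = kernel_integral s w"
  unfolding kernel_integral_def
  by (subst (2) nn_integral_lborel_orthogonal[OF X, symmetric]) (simp_all add: orthogonal_matrix_norm[OF X])

lemma kernel_integral_scale:
  fixes w :: "real^'n \<Rightarrow> real"
  assumes c: "0 < c" and [measurable]: "w \<in> borel_measurable borel"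
  shows "kernel_integral s (\<lambda>y. w (c *\<^sub>R y)) = ennreal (c powr (2 * s)) * kernel_integral s w"
proof -
  define p where "p = real CARD('n) + 2 * s"
  have "kernel_integral s (\<lambda>y. w (c *\<^sub>R y))
      = (\<integral>\<^sup>+y. ennreal (c powr p) * ennreal (w (c *\<^sub>R y) / norm (c *\<^sub>R y) powr p) \<partial>lborel)"
    unfolding kernel_integral_def p_def[symmetric] using c
    by (intro nn_integral_cong) (simp add: ennreal_mult'[symmetric] powr_mult)
  also have "\<dots> = ennreal (c powr p) * (ennreal (c powr (- real CARD('n))) * kernel_integral s w)"
    unfolding kernel_integral_def p_def[symmetric]
    using nn_integral_lborel_scale[of "\<lambda>y. ennreal (w y / norm y powr p)" c] c
    by (simp add: nn_integral_cmult)
  also have "\<dots> = ennreal (c powr p * c powr (- real CARD('n))) * kernel_integral s w"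
    by (simp add: ennreal_mult mult.assoc)
  also have "c powr p * c powr (- real CARD('n)) = c powr (2 * s)"
    by (simp add: powr_add[symmetric] p_def)
  finally show ?thesis .
qed

lemma hyp_nn_integral_swap:
  fixes h :: "real^'n \<Rightarrow> real \<Rightarrow> ennreal"
  assumes [measurable]: "case_prod h \<in> borel_measurable (borel \<Otimes>\<^sub>M borel)"
  shows "hyp e (\<lambda>v. \<integral>\<^sup>+t. h v t \<partial>lborel) = (\<integral>\<^sup>+t. hyp e (\<lambda>v. h v t) \<partial>lborel)"
proof -
  have "hyp e (\<lambda>v. \<integral>\<^sup>+t. h v t \<partial>lborel)
      = (\<integral>\<^sup>+y. \<integral>\<^sup>+t. indicator {0..1} (e \<bullet> y) * h (perp e y) t \<partial>lborel \<partial>lborel)"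
    unfolding hyp_def by (simp add: nn_integral_cmult)
  also have "\<dots> = (\<integral>\<^sup>+t. \<integral>\<^sup>+y. indicator {0..1} (e \<bullet> y) * h (perp e y) t \<partial>lborel \<partial>lborel)"
    by (rule lborel_pair.Fubini') simp
  finally show ?thesis by (simp add: hyp_def)
qed

lemma norm_add_multiple_powr:
  "norm e = 1 \<Longrightarrow> e \<bullet> v = 0 \<Longrightarrow> norm (v + t *\<^sub>R e) powr p = ((norm v)\<^sup>2 + t\<^sup>2) powr (p / 2)"
  by (simp add: norm_powr_eq norm_add_multiple)

text \<open>
  Integrate first over the hyperplanes parallel to the orthogonal complement of \<open>e\<close>; scaling makes every
  slice a multiple of the slice at height 1.
\<close>

lemma kernel_integral_normal_direction:
  fixes e :: "real^'n" and \<phi> :: "real \<Rightarrow> real"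
  assumes e: "norm e = 1" and [measurable]: "\<phi> \<in> borel_measurable borel" and \<phi>: "\<And>r. 0 \<le> r \<Longrightarrow> 0 \<le> \<phi> r"
  shows "kernel_integral s (\<lambda>y. \<phi> \<bar>e \<bullet> y\<bar>)
    = (\<integral>\<^sup>+t. ennreal (\<phi> \<bar>t\<bar> / \<bar>t\<bar> powr (1 + 2 * s)) \<partial>lborel)
      * hyp e (\<lambda>v. ennreal (1 / (1 + (norm v)\<^sup>2) powr ((real CARD('n) + 2 * s) / 2)))"
proof -
  define p where "p = real CARD('n) + 2 * s"
  define C where "C = hyp e (\<lambda>v. ennreal (1 / (1 + (norm v)\<^sup>2) powr (p / 2)))"
  have "kernel_integral s (\<lambda>y. \<phi> \<bar>e \<bullet> y\<bar>)
      = hyp e (\<lambda>v. \<integral>\<^sup>+t. ennreal (\<phi> \<bar>e \<bullet> (v + t *\<^sub>R e)\<bar> / norm (v + t *\<^sub>R e) powr p) \<partial>lborel)"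
    unfolding kernel_integral_def p_def[symmetric] by (rule nn_integral_hyperplane_slices[OF e]) simp
  also have "\<dots> = hyp e (\<lambda>v. \<integral>\<^sup>+t. ennreal (\<phi> \<bar>t\<bar> / ((norm v)\<^sup>2 + t\<^sup>2) powr (p / 2)) \<partial>lborel)"
    using e by (intro hyp_cong) (simp_all add: norm_add_multiple_powr inner_add_right norm_eq_1)
  also have "\<dots> = (\<integral>\<^sup>+t. hyp e (\<lambda>v. ennreal (\<phi> \<bar>t\<bar> / ((norm v)\<^sup>2 + t\<^sup>2) powr (p / 2))) \<partial>lborel)"
    by (rule hyp_nn_integral_swap) measurable
  also have "\<dots> = (\<integral>\<^sup>+t. ennreal (\<phi> \<bar>t\<bar> / \<bar>t\<bar> powr (1 + 2 * s)) * C \<partial>lborel)"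
  proof (rule nn_integral_cong_AE, rule AE_mp[OF AE_lborel_singleton[of 0]], intro AE_I2 impI)
    fix t :: real assume t: "t \<noteq> 0"
    have "hyp e (\<lambda>v. ennreal (\<phi> \<bar>t\<bar> / ((norm v)\<^sup>2 + t\<^sup>2) powr (p / 2)))
        = hyp e (\<lambda>v. ennreal (\<phi> \<bar>t\<bar> / \<bar>t\<bar> powr p) * ennreal (1 / (1 + (norm ((1 / \<bar>t\<bar>) *\<^sub>R v))\<^sup>2) powr (p / 2)))"
    proof (rule hyp_cong[OF e])
      fix v :: "real^'n"
      have eq: "(norm v)\<^sup>2 + t\<^sup>2 = \<bar>t\<bar>\<^sup>2 * (1 + (norm ((1 / \<bar>t\<bar>) *\<^sub>R v))\<^sup>2)"
        using t by (simp add: power_mult_distrib power_divide field_simps)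
      have "((norm v)\<^sup>2 + t\<^sup>2) powr (p / 2) = (\<bar>t\<bar>\<^sup>2) powr (p / 2) * (1 + (norm ((1 / \<bar>t\<bar>) *\<^sub>R v))\<^sup>2) powr (p / 2)"
        unfolding eq by (rule powr_mult)
      also have "(\<bar>t\<bar>\<^sup>2) powr (p / 2) = \<bar>t\<bar> powr p" by (intro power2_powr_half) simp
      finally have "((norm v)\<^sup>2 + t\<^sup>2) powr (p / 2) = \<bar>t\<bar> powr p * (1 + (norm ((1 / \<bar>t\<bar>) *\<^sub>R v))\<^sup>2) powr (p / 2)" .
      then show "ennreal (\<phi> \<bar>t\<bar> / ((norm v)\<^sup>2 + t\<^sup>2) powr (p / 2))
          = ennreal (\<phi> \<bar>t\<bar> / \<bar>t\<bar> powr p) * ennreal (1 / (1 + (norm ((1 / \<bar>t\<bar>) *\<^sub>R v))\<^sup>2) powr (p / 2))"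
        using \<phi>[of "\<bar>t\<bar>"] by (simp add: ennreal_mult'[symmetric])
    qed
    also have "\<dots> = ennreal (\<phi> \<bar>t\<bar> / \<bar>t\<bar> powr p) * (ennreal ((1 / \<bar>t\<bar>) powr (1 - real CARD('n))) * C)"
      using hyp_scale[OF e, of "\<lambda>v. ennreal (1 / (1 + (norm v)\<^sup>2) powr (p / 2))" "1 / \<bar>t\<bar>"] t
      by (subst hyp_cmult) (auto simp: C_def)
    also have "\<dots> = ennreal (\<phi> \<bar>t\<bar> / \<bar>t\<bar> powr p * (1 / \<bar>t\<bar>) powr (1 - real CARD('n))) * C"
      using \<phi>[of "\<bar>t\<bar>"]
      by (subst ennreal_mult[where a="\<phi> \<bar>t\<bar> / \<bar>t\<bar> powr p"]) (auto simp: mult.assoc)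
    also have "\<phi> \<bar>t\<bar> / \<bar>t\<bar> powr p * (1 / \<bar>t\<bar>) powr (1 - real CARD('n)) = \<phi> \<bar>t\<bar> / \<bar>t\<bar> powr (1 + 2 * s)"
    proof -
      have "(1 / \<bar>t\<bar>) powr (1 - real CARD('n)) = \<bar>t\<bar> powr (real CARD('n) - 1)"
        using powr_minus_divide[of "\<bar>t\<bar>" "1 - real CARD('n)"] by (simp add: powr_divide)
      moreover have "\<bar>t\<bar> powr p = \<bar>t\<bar> powr (1 + 2 * s) * \<bar>t\<bar> powr (real CARD('n) - 1)"
        by (simp add: powr_add[symmetric] p_def algebra_simps)
      ultimately show ?thesis using t by simp
    qed
    finally show "hyp e (\<lambda>v. ennreal (\<phi> \<bar>t\<bar> / ((norm v)\<^sup>2 + t\<^sup>2) powr (p / 2)))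
        = ennreal (\<phi> \<bar>t\<bar> / \<bar>t\<bar> powr (1 + 2 * s)) * C" .
  qed
  finally show ?thesis by (simp add: nn_integral_multc C_def p_def)
qed

lemma nn_integral_bell_scale:
  fixes r :: real
  assumes r: "0 < r"
  shows "(\<integral>\<^sup>+t. ennreal (1 / (r\<^sup>2 + t\<^sup>2) powr (p / 2)) \<partial>lborel)
    = ennreal (r powr (1 - p)) * (\<integral>\<^sup>+t. ennreal (1 / (1 + t\<^sup>2) powr (p / 2)) \<partial>lborel)"
proof -
  have "(\<integral>\<^sup>+t. ennreal (1 / (r\<^sup>2 + t\<^sup>2) powr (p / 2)) \<partial>lborel)
      = ennreal r * (\<integral>\<^sup>+t. ennreal (1 / (r\<^sup>2 + (0 + r * t)\<^sup>2) powr (p / 2)) \<partial>lborel)"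
    using r by (subst nn_integral_real_affine[of _ r 0]) auto
  also have "(\<integral>\<^sup>+t. ennreal (1 / (r\<^sup>2 + (0 + r * t)\<^sup>2) powr (p / 2)) \<partial>lborel)
      = (\<integral>\<^sup>+t. ennreal (r powr (- p)) * ennreal (1 / (1 + t\<^sup>2) powr (p / 2)) \<partial>lborel)"
  proof (rule nn_integral_cong)
    fix t :: real
    have eq: "r\<^sup>2 + (0 + r * t)\<^sup>2 = r\<^sup>2 * (1 + t\<^sup>2)" by (simp add: power_mult_distrib algebra_simps)
    have "(r\<^sup>2 + (0 + r * t)\<^sup>2) powr (p / 2) = (r\<^sup>2) powr (p / 2) * (1 + t\<^sup>2) powr (p / 2)"
      unfolding eq by (rule powr_mult)
    also have "(r\<^sup>2) powr (p / 2) = r powr p" using r by (intro power2_powr_half) simp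
    finally have "(r\<^sup>2 + (0 + r * t)\<^sup>2) powr (p / 2) = r powr p * (1 + t\<^sup>2) powr (p / 2)" .
    then have "1 / (r\<^sup>2 + (0 + r * t)\<^sup>2) powr (p / 2) = r powr (- p) * (1 / (1 + t\<^sup>2) powr (p / 2))"
      by (simp only: powr_minus_divide) simp
    then show "ennreal (1 / (r\<^sup>2 + (0 + r * t)\<^sup>2) powr (p / 2)) = ennreal (r powr (- p)) * ennreal (1 / (1 + t\<^sup>2) powr (p / 2))"
      by (simp only: ennreal_mult'[OF powr_ge_zero])
  qed
  also have "\<dots> = ennreal (r powr (- p)) * (\<integral>\<^sup>+t. ennreal (1 / (1 + t\<^sup>2) powr (p / 2)) \<partial>lborel)"
    by (rule nn_integral_cmult) simp
  also have "ennreal r * (ennreal (r powr (- p)) * (\<integral>\<^sup>+t. ennreal (1 / (1 + t\<^sup>2) powr (p / 2)) \<partial>lborel))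
     = ennreal (r * r powr (- p)) * (\<integral>\<^sup>+t. ennreal (1 / (1 + t\<^sup>2) powr (p / 2)) \<partial>lborel)"
    using r by (simp add: ennreal_mult mult.assoc)
  also have "r * r powr (- p) = r powr (1 - p)"
    using r by (simp add: powr_diff powr_minus_divide)
  finally show ?thesis .
qed

text \<open>
  Integrate first along the lines parallel to \<open>e\<close>; scaling makes each of them a multiple of the line at distance 1.
\<close>

lemma kernel_integral_hyperplane_part:
  fixes e :: "real^'n" and \<phi> :: "real \<Rightarrow> real"
  assumes e: "norm e = 1" and [measurable]: "\<phi> \<in> borel_measurable borel" and \<phi>: "\<And>r. 0 \<le> r \<Longrightarrow> 0 \<le> \<phi> r"
    and \<phi>0: "\<phi> 0 = 0"
  shows "kernel_integral s (\<lambda>y. \<phi> (norm (perp e y)))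
    = (\<integral>\<^sup>+t. ennreal (1 / (1 + t\<^sup>2) powr ((real CARD('n) + 2 * s) / 2)) \<partial>lborel)
      * hyp e (\<lambda>v. ennreal (\<phi> (norm v) / norm v powr (real CARD('n) - 1 + 2 * s)))"
proof -
  define p where "p = real CARD('n) + 2 * s"
  define C where "C = (\<integral>\<^sup>+t. ennreal (1 / (1 + t\<^sup>2) powr (p / 2)) \<partial>lborel)"
  have "kernel_integral s (\<lambda>y. \<phi> (norm (perp e y)))
      = hyp e (\<lambda>v. \<integral>\<^sup>+t. ennreal (\<phi> (norm (perp e (v + t *\<^sub>R e))) / norm (v + t *\<^sub>R e) powr p) \<partial>lborel)"
    unfolding kernel_integral_def p_def[symmetric] by (rule nn_integral_hyperplane_slices[OF e]) simp
  also have "\<dots> = hyp e (\<lambda>v. C * ennreal (\<phi> (norm v) / norm v powr (p - 1)))"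
  proof (rule hyp_cong[OF e])
    fix v :: "real^'n" assume v: "e \<bullet> v = 0"
    show "(\<integral>\<^sup>+t. ennreal (\<phi> (norm (perp e (v + t *\<^sub>R e))) / norm (v + t *\<^sub>R e) powr p) \<partial>lborel)
      = C * ennreal (\<phi> (norm v) / norm v powr (p - 1))"
    proof (cases "v = 0")
      case True
      then show ?thesis using e by (simp add: \<phi>0 perp_def norm_eq_1)
    next
      case False
      have "(\<integral>\<^sup>+t. ennreal (\<phi> (norm (perp e (v + t *\<^sub>R e))) / norm (v + t *\<^sub>R e) powr p) \<partial>lborel)
          = (\<integral>\<^sup>+t. ennreal (\<phi> (norm v)) * ennreal (1 / ((norm v)\<^sup>2 + t\<^sup>2) powr (p / 2)) \<partial>lborel)"
        using e v \<phi>[of "norm v"]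
        by (intro nn_integral_cong) (simp add: perp_add_multiple norm_add_multiple_powr ennreal_mult'[symmetric])
      also have "\<dots> = ennreal (\<phi> (norm v)) * (ennreal (norm v powr (1 - p)) * C)"
        using False by (simp add: nn_integral_cmult nn_integral_bell_scale C_def)
      also have "\<dots> = C * ennreal (\<phi> (norm v) * norm v powr (1 - p))"
        using \<phi>[of "norm v"] by (simp add: ennreal_mult mult_ac)
      also have "norm v powr (1 - p) = 1 / norm v powr (p - 1)"
        using powr_minus_divide[of "norm v" "p - 1"] by simp
      finally show ?thesis by simp
    qed
  qed
  also have "\<dots> = C * hyp e (\<lambda>v. ennreal (\<phi> (norm v) / norm v powr (p - 1)))"
    by (rule hyp_cmult) simp
  finally show ?thesis by (simp add: C_def p_def algebra_simps)
qed

section \<open>The constants as kernel integrals\<close>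

lemma const_C1_nn:
  assumes s: "1 / 2 < s" "s < 1" and LSC: "0 \<le> L" "0 \<le> SC"
  shows "(\<integral>\<^sup>+t. ennreal (rho L SC \<bar>t\<bar> / \<bar>t\<bar> powr (1 + 2 * s)) \<partial>lborel) = ennreal (const_C1 s L SC)"
proof -
  have "(\<integral>\<^sup>+t. ennreal (rho L SC \<bar>t\<bar> / \<bar>t\<bar> powr (1 + 2 * s)) \<partial>lborel) < \<infinity>"
  proof (rule nn_integral_finite_by_powr[where a="1 - 2 * s" and A=SC and b="- 2 * s" and B="2 * L"])
    fix t :: real assume t: "0 < t"
    have "rho L SC t / t powr (1 + 2 * s) \<le> (SC * t\<^sup>2) / t powr (1 + 2 * s)"
      by (intro divide_right_mono) (auto simp: rho_def)
    also have "\<dots> = SC * t powr (1 - 2 * s)"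
    proof -
      have "t\<^sup>2 = t powr 2" using t by simp
      then show ?thesis using powr_diff[of t 2 "1 + 2 * s"] by simp
    qed
    finally show "rho L SC t / t powr (1 + 2 * s) \<le> SC * t powr (1 - 2 * s)" .
  next
    fix t :: real assume t: "1 \<le> t"
    have "rho L SC t / t powr (1 + 2 * s) \<le> (2 * L * t) / t powr (1 + 2 * s)"
      by (intro divide_right_mono) (auto simp: rho_def)
    also have "\<dots> = 2 * L * t powr (- 2 * s)"
      using t powr_diff[of t 1 "1 + 2 * s"] by simp
    finally show "rho L SC t / t powr (1 + 2 * s) \<le> 2 * L * t powr (- 2 * s)" .
  qed (use s LSC in auto)
  moreover have "const_C1 s L SC = enn2real (\<integral>\<^sup>+t. ennreal (rho L SC \<bar>t\<bar> / \<bar>t\<bar> powr (1 + 2 * s)) \<partial>lborel)"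
    unfolding const_C1_def rho_def
    by (rule integral_eq_nn_integral) (use LSC in auto)
  ultimately show ?thesis by (simp add: less_top)
qed

lemma const_C2_nn:
  fixes e :: "real^'n"
  assumes e: "norm e = 1" and s: "0 < s" and n: "2 \<le> CARD('n)"
  shows "hyp e (\<lambda>v. ennreal (1 / (1 + (norm v)\<^sup>2) powr ((real CARD('n) + 2 * s) / 2)))
    = ennreal (const_C2 CARD('n) s)"
proof -
  have meas: "(\<lambda>r. ennreal (1 / (1 + r\<^sup>2) powr ((real CARD('n) + 2 * s) / 2))) \<in> borel_measurable borel"
    by measurable
  have "const_C2 CARD('n) s
      = enn2real (hyp e (\<lambda>v. ennreal (1 / (1 + (norm v)\<^sup>2) powr ((real CARD('n) + 2 * s) / 2))))"
    unfolding const_C2_def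
      hyp_radial_eq_PiM[OF e, of "\<lambda>r. ennreal (1 / (1 + r\<^sup>2) powr ((real CARD('n) + 2 * s) / 2))", OF meas]
    by (rule integral_eq_nn_integral) auto
  moreover have "hyp e (\<lambda>v. ennreal (1 / (1 + (norm v)\<^sup>2) powr ((real CARD('n) + 2 * s) / 2))) < \<infinity>"
    by (rule hyp_decay_finite[OF e _ n]) (use s in simp)
  ultimately show ?thesis by (simp add: less_top)
qed

lemma const_C3_nn:
  assumes s: "0 < s" and n: "1 \<le> n"
  shows "(\<integral>\<^sup>+t. ennreal (1 / (1 + t\<^sup>2) powr ((real n + 2 * s) / 2)) \<partial>lborel) = ennreal (const_C3 n s)"
    and "0 < const_C3 n s"
proof -
  let ?f = "\<lambda>t::real. ennreal (1 / (1 + t\<^sup>2) powr ((real n + 2 * s) / 2))"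
  have "const_C3 n s = enn2real (\<integral>\<^sup>+t. ?f t \<partial>lborel)"
    unfolding const_C3_def by (rule integral_eq_nn_integral) auto
  moreover have fin: "(\<integral>\<^sup>+t. ?f t \<partial>lborel) < \<infinity>"
    by (rule nn_integral_bell_finite) (use s n in simp)
  ultimately show "(\<integral>\<^sup>+t. ?f t \<partial>lborel) = ennreal (const_C3 n s)" by (simp add: less_top)
  have "(\<integral>\<^sup>+t. ?f t \<partial>lborel) \<noteq> 0"
  proof
    assume "(\<integral>\<^sup>+t. ?f t \<partial>lborel) = 0"
    then have "emeasure lborel {t \<in> space lborel. ?f t \<noteq> 0} = 0"
      by (subst (asm) nn_integral_0_iff) auto
    moreover have "1 + t\<^sup>2 \<noteq> 0" for t :: real
      by (metis add_pos_nonneg less_irrefl zero_le_power2 zero_less_one)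
    then have "{t \<in> space lborel. ?f t \<noteq> 0} = UNIV"
      by (auto simp: ennreal_eq_0_iff not_le)
    ultimately show False by simp
  qed
  then show "0 < const_C3 n s"
    using \<open>(\<integral>\<^sup>+t. ?f t \<partial>lborel) = ennreal (const_C3 n s)\<close> by (cases "0 < const_C3 n s") (auto simp: ennreal_neg)
qed

lemma norm_axis_1: "norm (axis i 1 :: real^'n) = 1"
  by (simp add: norm_eq_1 inner_axis_axis)

text \<open>
  The product of the first two constants is a kernel integral over the full space.
\<close>

theorem kernel_integral_rho_normal:
  fixes e :: "real^'n"
  assumes s: "1 / 2 < s" "s < 1" and LSC: "0 \<le> L" "0 \<le> SC" and n: "2 \<le> CARD('n)" and e: "norm e = 1"
  shows "kernel_integral s (\<lambda>y. rho L SC \<bar>e \<bullet> y\<bar>) = ennreal (const_C1 s L SC * const_C2 CARD('n) s)"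
proof -
  have "0 \<le> const_C2 CARD('n) s" unfolding const_C2_def by (rule integral_nonneg_AE) simp
  moreover have "0 \<le> const_C1 s L SC"
    unfolding const_C1_def by (rule integral_nonneg_AE) (use LSC in simp)
  ultimately show ?thesis
    using kernel_integral_normal_direction[OF e, of "rho L SC" s] const_C1_nn[OF s LSC]
      const_C2_nn[OF e _ n, of s] s LSC
    by (simp add: rho_nonneg ennreal_mult)
qed

text \<open>
  Subadditivity of the majorant in \<open>r^2\<close> reduces the full norm to the \<open>n\<close> coordinates.
\<close>

lemma kernel_integral_rho_finite:
  assumes s: "1 / 2 < s" "s < 1" and LSC: "0 \<le> L" "0 \<le> SC" and n: "2 \<le> CARD('n)"
  shows "kernel_integral s (\<lambda>y::real^'n. rho L SC (norm y))
    \<le> ennreal (real CARD('n) * (const_C1 s L SC * const_C2 CARD('n) s))"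
proof -
  have "kernel_integral s (\<lambda>y::real^'n. rho L SC (norm y))
      \<le> kernel_integral s (\<lambda>y::real^'n. \<Sum>i\<in>UNIV. rho L SC \<bar>axis i 1 \<bullet> y\<bar>)"
  proof (rule kernel_integral_mono)
    fix y :: "real^'n"
    show "rho L SC (norm y) \<le> (\<Sum>i\<in>UNIV. rho L SC \<bar>axis i 1 \<bullet> y\<bar>)"
      using rho_sum[OF LSC, of UNIV "\<lambda>i. \<bar>y $ i\<bar>"]
      by (simp add: norm_vec_def L2_set_def inner_axis')
  qed
  also have "\<dots> = (\<Sum>i\<in>(UNIV::'n set). kernel_integral s (\<lambda>y::real^'n. rho L SC \<bar>axis i 1 \<bullet> y\<bar>))"
    by (rule kernel_integral_sum) (use LSC in \<open>auto simp: rho_nonneg\<close>)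
  also have "\<dots> = of_nat CARD('n) * ennreal (const_C1 s L SC * const_C2 CARD('n) s)"
    by (simp add: kernel_integral_rho_normal[OF s LSC n norm_axis_1])
  also have "\<dots> = ennreal (real CARD('n) * (const_C1 s L SC * const_C2 CARD('n) s))"
    by (simp only: ennreal_of_nat_eq_real_of_nat ennreal_mult'[OF of_nat_0_le_iff])
  finally show ?thesis .
qed

lemma norm_perp_le: "norm e = 1 \<Longrightarrow> norm (perp e y) \<le> norm y"
  using norm_perp_decomposition[of e y] zero_le_power2[of "e \<bullet> y"]
  by (intro power2_le_imp_le[OF _ norm_ge_zero]) linarith

text \<open>
  Up to the constant \<open>C3\<close> for the integration along the normal line, this is the
  integral over the hyperplane that defines \<open>\<mu>1\<close>.
\<close>

theorem kernel_integral_rho_tangential: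
  fixes e :: "real^'n"
  assumes s: "1 / 2 < s" "s < 1" and LSC: "0 \<le> L" "0 \<le> SC" and n: "2 \<le> CARD('n)" and e: "norm e = 1"
  shows "kernel_integral s (\<lambda>y. rho L SC (norm (perp e y)))
    = ennreal (const_C3 CARD('n) s * (const_mu1 CARD('n) s L SC / (1 - s)))"
proof -
  define h where "h = hyp e (\<lambda>v. ennreal (rho L SC (norm v) / norm v powr (real CARD('n) - 1 + 2 * s)))"
  have eq: "kernel_integral s (\<lambda>y. rho L SC (norm (perp e y))) = ennreal (const_C3 CARD('n) s) * h"
    using kernel_integral_hyperplane_part[OF e, of "rho L SC" s] const_C3_nn(1)[of s "CARD('n)"] s LSC
    by (simp add: rho_nonneg h_def rho_def)
  have c3: "0 < const_C3 CARD('n) s" by (rule const_C3_nn) (use s in auto)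
  have "kernel_integral s (\<lambda>y. rho L SC (norm (perp e y))) \<le> kernel_integral s (\<lambda>y::real^'n. rho L SC (norm y))"
    by (intro kernel_integral_mono rho_mono) (use LSC norm_perp_le[OF e] in auto)
  also have "\<dots> < \<infinity>"
    using kernel_integral_rho_finite[OF s LSC n] by (simp add: order.strict_trans1)
  finally have "h < \<infinity>" unfolding eq using c3 by (auto simp: ennreal_mult_less_top ennreal_eq_0_iff)
  moreover have meas: "(\<lambda>r. ennreal (rho L SC r / r powr (real CARD('n) - 1 + 2 * s))) \<in> borel_measurable borel"
    by measurable
  have "const_mu1 CARD('n) s L SC = (1 - s) * enn2real h"
    unfolding h_def const_mu1_def
      hyp_radial_eq_PiM[OF e, of "\<lambda>r. ennreal (rho L SC r / r powr (real CARD('n) - 1 + 2 * s))", OF meas]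
    unfolding rho_def
    by (subst integral_eq_nn_integral) (use LSC in auto)
  ultimately have "h = ennreal (const_mu1 CARD('n) s L SC / (1 - s))" "0 \<le> const_mu1 CARD('n) s L SC / (1 - s)"
    using s by (simp_all add: less_top)
  then show ?thesis unfolding eq using c3 by (simp add: ennreal_mult del: times_divide_eq_right)
qed

text \<open>
  Sum over the coordinate hyperplanes: the squared cosines of the angles between \<open>y\<close> and its projections add up
  to \<open>n - 1\<close>, and the majorant shrinks at most by the squared cosine.
\<close>

lemma kernel_integral_rho_le_tangential:
  assumes s: "1 / 2 < s" "s < 1" and LSC: "0 \<le> L" "0 \<le> SC" and n: "2 \<le> CARD('n)"
  shows "ennreal (real CARD('n) - 1) * kernel_integral s (\<lambda>y::real^'n. rho L SC (norm y))
    \<le> ennreal (real CARD('n) * (const_C3 CARD('n) s * (const_mu1 CARD('n) s L SC / (1 - s))))"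
proof -
  have "ennreal (real CARD('n) - 1) * kernel_integral s (\<lambda>y::real^'n. rho L SC (norm y))
      = kernel_integral s (\<lambda>y::real^'n. (real CARD('n) - 1) * rho L SC (norm y))"
    using n by (subst kernel_integral_cmult) auto
  also have "\<dots> \<le> kernel_integral s (\<lambda>y::real^'n. \<Sum>i\<in>UNIV. rho L SC (norm (perp (axis i 1) y)))"
  proof (rule kernel_integral_mono)
    fix y :: "real^'n"
    show "(real CARD('n) - 1) * rho L SC (norm y) \<le> (\<Sum>i\<in>UNIV. rho L SC (norm (perp (axis i 1) y)))"
    proof (cases "y = 0")
      case True then show ?thesis by (simp add: rho_def perp_def)
    next
      case False
      define t where "t i = norm (perp (axis i 1) y) / norm y" for i
      have t: "0 \<le> t i" "t i \<le> 1" for i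
        using False norm_perp_le[OF norm_axis_1, of i y] by (simp_all add: t_def)
      have t2: "(t i)\<^sup>2 = 1 - (y $ i)\<^sup>2 / (norm y)\<^sup>2" for i
      proof -
        have "(norm (perp (axis i 1) y))\<^sup>2 = (norm y)\<^sup>2 - (y $ i)\<^sup>2"
          using norm_perp_decomposition[OF norm_axis_1, of y i] by (simp add: inner_axis')
        then show ?thesis using False by (simp add: t_def power_divide diff_divide_distrib)
      qed
      have "(\<Sum>i\<in>UNIV. (y $ i)\<^sup>2) = (norm y)\<^sup>2"
        by (simp add: norm_vec_def L2_set_def sum_nonneg)
      then have "(\<Sum>i\<in>UNIV. (t i)\<^sup>2) = real CARD('n) - 1"
        using False by (simp add: t2 sum_subtractf sum_divide_distrib[symmetric])
      then have "(real CARD('n) - 1) * rho L SC (norm y) = (\<Sum>i\<in>UNIV. (t i)\<^sup>2 * rho L SC (norm y))"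
        by (simp add: sum_distrib_right[symmetric])
      also have "\<dots> \<le> (\<Sum>i\<in>UNIV. rho L SC (t i * norm y))"
        using LSC t by (intro sum_mono rho_shrink) auto
      finally show ?thesis using False by (simp add: t_def)
    qed
  qed
  also have "\<dots> = (\<Sum>i\<in>(UNIV::'n set). kernel_integral s (\<lambda>y::real^'n. rho L SC (norm (perp (axis i 1) y))))"
    by (rule kernel_integral_sum) (use LSC in \<open>auto simp: rho_nonneg\<close>)
  also have "\<dots> = of_nat CARD('n) * ennreal (const_C3 CARD('n) s * (const_mu1 CARD('n) s L SC / (1 - s)))"
    by (simp add: kernel_integral_rho_tangential[OF s LSC n norm_axis_1])
  also have "\<dots> = ennreal (real CARD('n) * (const_C3 CARD('n) s * (const_mu1 CARD('n) s L SC / (1 - s))))"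
    by (simp only: ennreal_of_nat_eq_real_of_nat ennreal_mult'[OF of_nat_0_le_iff])
  finally show ?thesis .
qed

text \<open>
  A coordinate of \<open>y\<close> is bounded by the projection of \<open>y\<close> to another coordinate hyperplane.
\<close>

lemma const_product_le:
  assumes s: "1 / 2 < s" "s < 1" and LSC: "0 \<le> L" "0 \<le> SC" and n: "2 \<le> CARD('n::finite)"
  shows "const_C1 s L SC * const_C2 CARD('n) s \<le> const_C3 CARD('n) s * (const_mu1 CARD('n) s L SC / (1 - s))"
proof -
  obtain i j :: 'n where ij: "i \<noteq> j"
  proof -
    have "\<not> CARD('n) \<le> 1" using n by simp
    then have "\<not> (\<forall>i j::'n. i = j)" by (subst (asm) card_le_Suc0_iff_eq[unfolded One_nat_def[symmetric]]) auto
    then show ?thesis using that by blast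
  qed
  have "kernel_integral s (\<lambda>y::real^'n. rho L SC \<bar>axis i 1 \<bullet> y\<bar>)
      \<le> kernel_integral s (\<lambda>y::real^'n. rho L SC (norm (perp (axis j 1) y)))"
  proof (rule kernel_integral_mono)
    fix y :: "real^'n"
    have "axis i 1 \<bullet> perp (axis j 1) y = axis i 1 \<bullet> y"
      using ij by (simp add: perp_def inner_diff_right inner_axis_axis)
    then have "\<bar>axis i 1 \<bullet> y\<bar> \<le> norm (perp (axis j 1) y)"
      using Cauchy_Schwarz_ineq2[of "axis i 1" "perp (axis j 1) y"] by (simp add: norm_axis_1)
    then show "rho L SC \<bar>axis i 1 \<bullet> y\<bar> \<le> rho L SC (norm (perp (axis j 1) y))"
      using LSC by (intro rho_mono) auto
  qed
  moreover have "0 \<le> const_mu1 CARD('n) s L SC" unfolding const_mu1_def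
    using s LSC by (intro mult_nonneg_nonneg integral_nonneg_AE) auto
  moreover have "0 < const_C3 CARD('n) s" by (rule const_C3_nn) (use s in auto)
  ultimately show ?thesis
    using s unfolding kernel_integral_rho_normal[OF s LSC n norm_axis_1] kernel_integral_rho_tangential[OF s LSC n norm_axis_1]
    by (subst (asm) ennreal_le_iff) auto
qed

section \<open>From the viscosity condition to pointwise bounds\<close>

text \<open>
  On a segment, subtract the affine interpolation. If the difference had a positive maximum at \<open>m\<close>, midpoint
  convexity on the largest interval centred at \<open>m\<close> would contradict the value 0 at the nearer end.
\<close>

lemma midpoint_convex_imp_convex:
  fixes v :: "'a::real_normed_vector \<Rightarrow> real"
  assumes cont: "continuous_on UNIV v" and mid: "\<And>x y. 2 * v x \<le> v (x + y) + v (x - y)"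
  shows "convex_on UNIV v"
proof (rule convex_onI)
  fix t :: real and a b :: 'a
  assume t: "0 < t" "t < 1"
  define \<phi> where "\<phi> t = v (a + t *\<^sub>R (b - a)) - (1 - t) * v a - t * v b" for t
  have "continuous_on {0..1} \<phi>"
    unfolding \<phi>_def by (intro continuous_intros continuous_on_compose2[OF cont]) auto
  then have "\<exists>m\<in>{0..1}. \<forall>t\<in>{0..1}. \<phi> t \<le> \<phi> m"
    by (intro continuous_attains_sup) auto
  then obtain m where m: "0 \<le> m" "m \<le> 1" and max: "\<And>t. 0 \<le> t \<Longrightarrow> t \<le> 1 \<Longrightarrow> \<phi> t \<le> \<phi> m" by auto
  have ends: "\<phi> 0 = 0" "\<phi> 1 = 0" by (simp_all add: \<phi>_def)
  \<comment> \<open>the largest radius for which both endpoints stay in the segment; one of them is an end of it\<close>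
  define d where "d = min m (1 - m)"
  have "2 * \<phi> m \<le> \<phi> (m + d) + \<phi> (m - d)"
    using mid[of "a + m *\<^sub>R (b - a)" "d *\<^sub>R (b - a)"] by (simp add: \<phi>_def algebra_simps)
  moreover have "\<phi> (m + d) \<le> \<phi> m" "\<phi> (m - d) \<le> \<phi> m"
    using m by (auto intro!: max simp: d_def)
  moreover have "m + d = 1 \<or> m - d = 0" by (auto simp: d_def min_def)
  ultimately have "\<phi> m \<le> 0" using ends by auto
  then have "\<phi> t \<le> 0" using max[of t] t by simp
  then show "v ((1 - t) *\<^sub>R a + t *\<^sub>R b) \<le> (1 - t) * v a + t * v b"
    by (simp add: \<phi>_def algebra_simps)
qed simp

text \<open>
  Separate the point \<open>(x, v x)\<close> from the strict epigraph; the separating hyperplane is not vertical because the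
  epigraph lies over the whole space.
\<close>

lemma convex_subgradient:
  fixes v :: "'a::euclidean_space \<Rightarrow> real"
  assumes conv: "convex_on UNIV v"
  obtains q where "\<And>z. v x + q \<bullet> (z - x) \<le> v z"
proof -
  define T where "T = {(z, t). v z < t}"
  have "convex T"
  proof (rule convexI)
    fix X Y :: "'a \<times> real" and a b :: real
    assume XY: "X \<in> T" "Y \<in> T" and ab: "0 \<le> a" "0 \<le> b" "a + b = 1"
    obtain z t z' t' where X: "X = (z, t)" "Y = (z', t')" by (cases X, cases Y)
    have "v (a *\<^sub>R z + b *\<^sub>R z') \<le> a * v z + b * v z'"
      using conv ab by (auto simp: convex_on_def)
    also have "\<dots> < a * t + b * t'"
    proof (cases "a = 0")
      case True then show ?thesis using XY X ab by (simp add: T_def)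
    next
      case False
      then have "a * v z < a * t" "b * v z' \<le> b * t'"
        using XY X ab by (auto simp: T_def mult_left_mono)
      then show ?thesis by simp
    qed
    finally show "a *\<^sub>R X + b *\<^sub>R Y \<in> T" by (simp add: T_def X)
  qed
  moreover have "(x, v x + 1) \<in> T" by (simp add: T_def)
  moreover have "{(x, v x)} \<inter> T = {}" by (auto simp: T_def)
  ultimately have "\<exists>a b. a \<noteq> 0 \<and> (\<forall>X\<in>{(x, v x)}. a \<bullet> X \<le> b) \<and> (\<forall>X\<in>T. b \<le> a \<bullet> X)"
    by (intro separating_hyperplane_sets) auto
  then obtain a b where a: "a \<noteq> 0" "a \<bullet> (x, v x) \<le> b" "\<And>X. X \<in> T \<Longrightarrow> b \<le> a \<bullet> X"
    by blast
  obtain p c where pc: "a = (p, c)" by (cases a)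
  have sep: "p \<bullet> x + c * v x \<le> p \<bullet> z + c * t" if "v z < t" for z t
    using a(2) a(3)[of "(z, t)"] that by (simp add: pc T_def)
  have "0 \<le> c" using sep[of x "v x + 1"] by (simp add: algebra_simps)
  moreover have "c \<noteq> 0"
  proof
    assume "c = 0"
    then have "p \<bullet> x \<le> p \<bullet> (x - p)" using sep[of "x - p" "v (x - p) + 1"] by simp
    then have "p \<bullet> p \<le> 0" by (simp add: inner_diff_right)
    then have "p = 0" by (metis antisym inner_eq_zero_iff inner_ge_zero)
    then show False using a(1) pc \<open>c = 0\<close> by (simp add: zero_prod_def)
  qed
  ultimately have c: "0 < c" by simp
  have "v x + (- (1 / c) *\<^sub>R p) \<bullet> (z - x) \<le> v z" for z
  proof (rule field_le_epsilon)
    fix \<epsilon> :: real assume "0 < \<epsilon>"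
    then have "(p \<bullet> x + c * v x) / c \<le> (p \<bullet> z + c * (v z + \<epsilon>)) / c"
      using sep[of z "v z + \<epsilon>"] c by (intro divide_right_mono) auto
    then show "v x + (- (1 / c) *\<^sub>R p) \<bullet> (z - x) \<le> v z + \<epsilon>"
      using c by (simp add: inner_diff_right add_divide_distrib diff_divide_distrib)
  qed
  then show ?thesis by (rule that)
qed

text \<open>
  \<open>SC/2 |z|^2 - u\<close> is continuous and midpoint convex, so it has an affine minorant touching at \<open>x\<close>.
\<close>

theorem semiconcave_touching_paraboloid:
  fixes u :: "real^'n \<Rightarrow> real"
  assumes "semiconcave SC u"
  obtains q where "\<And>z. u z \<le> u x + q \<bullet> (z - x) + SC / 2 * ((z - x) \<bullet> (z - x))"
proof -
  define v where "v z = SC / 2 * (z \<bullet> z) - u z" for z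
  have cont: "continuous_on UNIV v"
    using assms unfolding v_def semiconcave_def by (intro continuous_intros) auto
  have "convex_on UNIV v"
  proof (rule midpoint_convex_imp_convex[OF cont])
    fix x y :: "real^'n"
    have "u (x + y) + u (x - y) - 2 * u x \<le> SC * (y \<bullet> y)"
      using assms by (simp add: semiconcave_def second_diff_def power2_norm_eq_inner)
    moreover have "SC / 2 * ((x + y) \<bullet> (x + y)) + SC / 2 * ((x - y) \<bullet> (x - y))
        = 2 * (SC / 2 * (x \<bullet> x)) + SC * (y \<bullet> y)"
      by (simp add: inner_add_left inner_add_right inner_diff_left inner_diff_right inner_commute algebra_simps)
    ultimately show "2 * v x \<le> v (x + y) + v (x - y)" by (simp add: v_def)
  qed
  then obtain q where q: "\<And>z. v x + q \<bullet> (z - x) \<le> v z" by (rule convex_subgradient) blast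
  show ?thesis
  proof (rule that[of "SC *\<^sub>R x - q"])
    fix z
    show "u z \<le> u x + (SC *\<^sub>R x - q) \<bullet> (z - x) + SC / 2 * ((z - x) \<bullet> (z - x))"
      using q[of z] by (simp add: v_def inner_diff_left inner_diff_right inner_commute algebra_simps)
  qed
qed

lemma C2_on_paraboloid:
  "C2_on N (\<lambda>z. a + q \<bullet> (z - x) + c / 2 * ((z - x) \<bullet> (z - x)))"
  unfolding C2_on_def
proof (intro exI conjI ballI)
  fix z
  show "((\<lambda>z. a + q \<bullet> (z - x) + c / 2 * ((z - x) \<bullet> (z - x))) has_derivative (\<lambda>h. (q + c *\<^sub>R (z - x)) \<bullet> h)) (at z)"
    by (auto intro!: derivative_eq_intros simp: inner_add_left inner_diff_left inner_diff_right inner_commute algebra_simps)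
  show "((\<lambda>z. q + c *\<^sub>R (z - x)) has_derivative (\<lambda>h. mat c *v h)) (at z)"
    by (auto intro!: derivative_eq_intros simp: mat_vector_mult)
  show "continuous_on N (\<lambda>z. mat c)" by simp
qed

lemma second_diff_le_rho:
  assumes "L-lipschitz_on UNIV u" "semiconcave SC u"
  shows "second_diff u x y \<le> rho L SC (norm y)"
proof -
  have "\<bar>u (x + y) - u x\<bar> \<le> L * norm y" "\<bar>u (x - y) - u x\<bar> \<le> L * norm y"
    using lipschitz_onD[OF assms(1), of "x + y" x] lipschitz_onD[OF assms(1), of "x - y" x]
    by (simp_all add: dist_norm)
  then have "second_diff u x y \<le> 2 * L * norm y" by (simp add: second_diff_def)
  then show ?thesis using assms(2) by (simp add: rho_def semiconcave_def)
qed

lemma kernel_integral_rho_linear_finite: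
  fixes X :: "real^'n^'n"
  assumes s: "1 / 2 < s" "s < 1" and LSC: "0 \<le> L" "0 \<le> SC" and n: "2 \<le> CARD('n)"
  shows "kernel_integral s (\<lambda>z. rho L SC (norm (X *v z))) < \<infinity>"
proof -
  obtain c where c: "0 < c" "\<And>z. norm (X *v z) \<le> norm z * c"
    using bounded_linear.pos_bounded[OF matrix_vector_mul_bounded_linear[of X]] by blast
  have "kernel_integral s (\<lambda>z. rho L SC (norm (X *v z))) \<le> kernel_integral s (\<lambda>z::real^'n. rho L SC (norm (c *\<^sub>R z)))"
    by (intro kernel_integral_mono rho_mono) (use LSC c in \<open>auto simp: mult.commute\<close>)
  also have "\<dots> = ennreal (c powr (2 * s)) * kernel_integral s (\<lambda>z::real^'n. rho L SC (norm z))"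
    by (rule kernel_integral_scale[OF c(1)]) simp
  also have "\<dots> < \<infinity>"
    using kernel_integral_rho_finite[OF s LSC n]
    by (simp add: ennreal_mult_less_top order.strict_trans1)
  finally show ?thesis .
qed

lemma ext_integral_F2_integrand:
  fixes M :: "real^'n^'n" and u :: "real^'n \<Rightarrow> real"
  assumes n: "2 \<le> CARD('n)" and M: "M \<in> M2" and u: "u \<in> borel_measurable borel"
    and f: "\<And>y. second_diff u x y = f y"
  shows "(\<integral>\<^sup>+y. ennreal (F2_integrand s M u x y) \<partial>lborel) = kernel_integral s (\<lambda>z. f (matrix_sqrt M *v z))"
    "(\<integral>\<^sup>+y. ennreal (- F2_integrand s M u x y) \<partial>lborel) = kernel_integral s (\<lambda>z. - f (matrix_sqrt M *v z))"
proof -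
  have f': "second_diff u x = f" using f by auto
  have [measurable]: "f \<in> borel_measurable borel" unfolding f'[symmetric] second_diff_def using u by measurable
  have S: "matrix_sqrt M ** transpose (matrix_sqrt M) = 1 *\<^sub>R M" using M2_sqrt[OF n M] by simp
  show "(\<integral>\<^sup>+y. ennreal (F2_integrand s M u x y) \<partial>lborel) = kernel_integral s (\<lambda>z. f (matrix_sqrt M *v z))"
    using nn_integral_M2_kernel[OF n M S zero_less_one, of f s] by (simp add: kernel_integral_def F2_integrand_def f')
  show "(\<integral>\<^sup>+y. ennreal (- F2_integrand s M u x y) \<partial>lborel) = kernel_integral s (\<lambda>z. - f (matrix_sqrt M *v z))"
    using nn_integral_M2_kernel[OF n M S zero_less_one, of "\<lambda>y. - f y" s] by (simp add: kernel_integral_def F2_integrand_def f')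
qed

lemma enn2ereal_diff_ge:
  assumes c: "0 \<le> c" and P: "P < \<infinity>" and ge: "ereal c \<le> enn2ereal P - enn2ereal N"
  shows "N + ennreal c \<le> P"
proof -
  obtain p where p: "P = ennreal p" "0 \<le> p" using P by (cases P) auto
  show ?thesis
  proof (cases N)
    case (real r)
    then have "c \<le> p - r" using ge p by (simp add: enn2ereal_ennreal)
    then show ?thesis using real p c by (simp add: ennreal_plus[symmetric] ennreal_leI del: ennreal_plus)
  next
    case top
    then show ?thesis using ge p by (simp add: enn2ereal_ennreal enn2ereal_top)
  qed
qed

text \<open>
  Test with the touching paraboloid on the ball of radius \<open>r\<close>. The second difference of the modified function
  is \<open>SC|y|^2\<close> for \<open>|y| < r\<close> and that of \<open>u\<close> outside, so the inequality obtained has an error \<open>T r\<close> which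
  tends to 0 by dominated convergence, while the negative parts increase to that of \<open>u\<close>.
\<close>

theorem viscosity_pointwise:
  fixes u :: "real^'n \<Rightarrow> real" and M :: "real^'n^'n"
  assumes n: "2 \<le> CARD('n)" and s: "1 / 2 < s" "s < 1"
    and lip: "L-lipschitz_on UNIV u" and semi: "semiconcave SC u" and \<eta>: "0 < \<eta>0"
    and visc: "viscosity_ge s u \<eta>0 x" and M: "M \<in> M2"
  defines "S \<equiv> matrix_sqrt M" and "f \<equiv> second_diff u x"
  shows "kernel_integral s (\<lambda>z. - f (S *v z)) + ennreal (2 * (\<eta>0 / (1 - s))) \<le> kernel_integral s (\<lambda>z. f (S *v z))"
proof -
  define c where "c = 2 * (\<eta>0 / (1 - s))"
  have c: "0 < c" using \<eta> s by (simp add: c_def)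
  have SC: "0 \<le> SC" and contu: "continuous_on UNIV u" using semi by (auto simp: semiconcave_def)
  have L: "0 \<le> L" using lipschitz_on_nonneg[OF lip] .
  have [measurable]: "u \<in> borel_measurable borel" by (rule borel_measurable_continuous_onI[OF contu])
  have [measurable]: "f \<in> borel_measurable borel" unfolding f_def second_diff_def by measurable
  obtain q where q: "\<And>z. u z \<le> u x + q \<bullet> (z - x) + SC / 2 * ((z - x) \<bullet> (z - x))"
    using semiconcave_touching_paraboloid[OF semi] by metis
  define p where "p z = u x + q \<bullet> (z - x) + SC / 2 * ((z - x) \<bullet> (z - x))" for z
  have [measurable]: "p \<in> borel_measurable borel"
    unfolding p_def by measurable
  \<comment> \<open>the second difference at \<open>x\<close> of the function that agrees with the paraboloid on the ball of radius \<open>r\<close>\<close>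
  define g where "g r y = (if norm y < r then SC * (norm y)\<^sup>2 else f y)" for r y
  define P where "P = kernel_integral s (\<lambda>z. f (S *v z))"
  define N where "N r = kernel_integral s (\<lambda>z. - f (S *v z) * indicator {y. r \<le> norm y} (S *v z))" for r
  define T where "T r = kernel_integral s (\<lambda>z. SC * (norm (S *v z))\<^sup>2 * indicator {y. norm y < r} (S *v z))" for r
  have step: "N r + ennreal c \<le> P + T r" if r: "0 < r" "r \<le> 1" for r
  proof -
    define w where "w z = (if z \<in> ball x r then p z else u z)" for z
    have [measurable]: "w \<in> borel_measurable borel" unfolding w_def mem_ball by measurable
    have w: "second_diff w x y = g r y" for y
    proof (cases "norm y < r")
      case True
      then have "x + y \<in> ball x r" "x - y \<in> ball x r" by (simp_all add: dist_norm)
      then show ?thesis using True r(1)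
        by (simp add: second_diff_def w_def p_def g_def power2_norm_eq_inner)
    next
      case False
      then have "x + y \<notin> ball x r" "x - y \<notin> ball x r" by (simp_all add: dist_norm)
      then show ?thesis using False r(1)
        by (simp add: second_diff_def w_def p_def g_def f_def)
    qed
    have "ereal \<eta>0 \<le> ereal (1 - s) * F2 s w x"
    proof -
      have "open (ball x r) \<and> x \<in> ball x r \<and> C2_on (ball x r) p \<and> p x = u x \<and> (\<forall>z\<in>ball x r. u z \<le> p z)"
        using r q C2_on_paraboloid[of "ball x r" "u x" q x SC] p_def[abs_def, symmetric] by (auto simp: p_def)
      then show ?thesis using visc unfolding viscosity_ge_def w_def by blast
    qed
    also have "\<dots> \<le> ereal (1 - s) * (ereal (1 / 2) * ext_integral (F2_integrand s M w x))"
      unfolding F2_def using s M by (intro ereal_mult_left_mono INF_lower) auto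
    also have "ext_integral (F2_integrand s M w x)
        = enn2ereal (kernel_integral s (\<lambda>z. g r (S *v z))) - enn2ereal (kernel_integral s (\<lambda>z. - g r (S *v z)))"
      unfolding ext_integral_def S_def by (simp add: ext_integral_F2_integrand[OF n M _ w])
    finally have ge: "ereal \<eta>0 \<le> ereal (1 - s) * (ereal (1 / 2)
        * (enn2ereal (kernel_integral s (\<lambda>z. g r (S *v z))) - enn2ereal (kernel_integral s (\<lambda>z. - g r (S *v z)))))" .
    have ge': "ereal c \<le> D" if "ereal \<eta>0 \<le> ereal (1 - s) * (ereal (1 / 2) * D)" for D
    proof (cases D)
      case (real d)
      then have "\<eta>0 \<le> (1 - s) * (1 / 2 * d)" using that by simp
      then have "c \<le> d" using s by (simp add: c_def field_simps)
      then show ?thesis using real by simp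
    next
      case MInf
      then show ?thesis using that s by simp
    qed simp
    have Pr: "kernel_integral s (\<lambda>z. g r (S *v z)) \<le> P + T r"
    proof -
      have "kernel_integral s (\<lambda>z. g r (S *v z))
         \<le> kernel_integral s (\<lambda>z. max 0 (f (S *v z)) + SC * (norm (S *v z))\<^sup>2 * indicator {y. norm y < r} (S *v z))"
        using SC by (intro kernel_integral_mono) (auto simp: g_def indicator_def)
      also have "\<dots> = kernel_integral s (\<lambda>z. max 0 (f (S *v z))) + T r"
        unfolding T_def using SC by (intro kernel_integral_add) auto
      also have "kernel_integral s (\<lambda>z. max 0 (f (S *v z))) = P"
        unfolding P_def kernel_integral_def
        by (intro nn_integral_cong) (auto simp: max_def ennreal_neg divide_nonpos_nonneg)
      finally show ?thesis .
    qed
    have Nr: "kernel_integral s (\<lambda>z. - g r (S *v z)) = N r"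
      unfolding N_def kernel_integral_def using SC
      by (intro nn_integral_cong) (auto simp: g_def indicator_def ennreal_neg)
    have "kernel_integral s (\<lambda>z. g r (S *v z)) \<le> kernel_integral s (\<lambda>z. rho (L + 1 + SC) SC (norm (S *v z)))"
    proof (rule kernel_integral_mono)
      fix z
      show "g r (S *v z) \<le> rho (L + 1 + SC) SC (norm (S *v z))"
      proof (cases "norm (S *v z) < r")
        case True
        then have "(norm (S *v z))\<^sup>2 \<le> norm (S *v z)"
          using r by (simp add: power2_eq_square mult_left_le)
        then have "SC * (norm (S *v z))\<^sup>2 \<le> 2 * SC * norm (S *v z)"
          using mult_left_mono[of "(norm (S *v z))\<^sup>2" "norm (S *v z)" SC] SC
            mult_nonneg_nonneg[OF SC norm_ge_zero[of "S *v z"]] by linarith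
        also have "\<dots> \<le> 2 * (L + 1 + SC) * norm (S *v z)" using L by (intro mult_right_mono) auto
        finally show ?thesis using True by (simp add: g_def rho_def)
      next
        case False
        have "f (S *v z) \<le> rho L SC (norm (S *v z))" unfolding f_def by (rule second_diff_le_rho[OF lip semi])
        also have "\<dots> \<le> rho (L + 1 + SC) SC (norm (S *v z))"
          using SC unfolding rho_def by (intro min.mono mult_right_mono) auto
        finally show ?thesis using False by (simp add: g_def)
      qed
    qed
    also have "\<dots> < \<infinity>"
      using L SC by (intro kernel_integral_rho_linear_finite[OF s _ _ n]) auto
    finally have "kernel_integral s (\<lambda>z. - g r (S *v z)) + ennreal c \<le> kernel_integral s (\<lambda>z. g r (S *v z))"
      using ge'[OF ge] c by (intro enn2ereal_diff_ge) auto
    also note Pr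
    finally show ?thesis by (simp add: Nr)
  qed
  define r where "r k = 1 / (real k + 1)" for k
  have r: "0 < r k" "r k \<le> 1" for k by (simp_all add: r_def)
  have r_mono: "r k' \<le> r k" if "k \<le> k'" for k k' using that by (simp add: r_def frac_le)
  have r_lim: "r \<longlonglongrightarrow> 0"
    unfolding r_def using LIMSEQ_inverse_real_of_nat by (simp add: inverse_eq_divide add.commute)
  have T_lim: "(\<lambda>k. T (r k)) \<longlonglongrightarrow> 0"
  proof -
    define h where "h k z = ennreal (SC * (norm (S *v z))\<^sup>2 * indicator {y. norm y < r k} (S *v z)
        / norm z powr (real CARD('n) + 2 * s))" for k z
    have "(\<lambda>k. \<integral>\<^sup>+z. h k z \<partial>lborel) \<longlonglongrightarrow> (\<integral>\<^sup>+(z::real^'n). 0 \<partial>lborel)"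
    proof (rule nn_integral_dominated_convergence[where w="\<lambda>z. ennreal (rho (SC + 1) SC (norm (S *v z)) / norm z powr (real CARD('n) + 2 * s))"])
      show "AE z in lborel. h k z \<le> ennreal (rho (SC + 1) SC (norm (S *v z)) / norm z powr (real CARD('n) + 2 * s))" for k
        unfolding h_def
      proof (intro AE_I2 ennreal_leI divide_right_mono)
        fix z
        show "SC * (norm (S *v z))\<^sup>2 * indicator {y. norm y < r k} (S *v z) \<le> rho (SC + 1) SC (norm (S *v z))"
        proof (cases "norm (S *v z) < r k")
          case True
          then have "(norm (S *v z))\<^sup>2 \<le> norm (S *v z)"
            using r[of k] by (simp add: power2_eq_square mult_left_le)
          then have "SC * (norm (S *v z))\<^sup>2 \<le> 2 * SC * norm (S *v z)"
            using mult_left_mono[of "(norm (S *v z))\<^sup>2" "norm (S *v z)" SC] SC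
            mult_nonneg_nonneg[OF SC norm_ge_zero[of "S *v z"]] by linarith
          also have "\<dots> \<le> 2 * (SC + 1) * norm (S *v z)" by (intro mult_right_mono) auto
          finally show ?thesis using True by (simp add: rho_def)
        next
          case False
          then show ?thesis using SC by (simp add: rho_nonneg)
        qed
      qed simp
      show "(\<integral>\<^sup>+z. ennreal (rho (SC + 1) SC (norm (S *v z)) / norm z powr (real CARD('n) + 2 * s)) \<partial>lborel) < \<infinity>"
        using kernel_integral_rho_linear_finite[OF s _ SC n, of "SC + 1" S] SC by (simp add: kernel_integral_def)
      show "AE z in lborel. (\<lambda>k. h k z) \<longlonglongrightarrow> 0"
      proof (rule AE_I2)
        fix z
        show "(\<lambda>k. h k z) \<longlonglongrightarrow> 0"
        proof (cases "S *v z = 0")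
          case True then show ?thesis by (simp add: h_def)
        next
          case False
          then have "eventually (\<lambda>k. r k < norm (S *v z)) sequentially"
            using r_lim by (intro order_tendstoD(2)) auto
          then have "eventually (\<lambda>k. h k z = 0) sequentially"
            by eventually_elim (simp add: h_def)
          then show ?thesis by (rule tendsto_eventually)
        qed
      qed
    qed (auto simp: h_def)
    then show ?thesis by (simp add: T_def kernel_integral_def h_def)
  qed
  have N_le: "N (r k) + ennreal c \<le> P" for k
  proof -
    have "(\<lambda>j. P + T (r j)) \<longlonglongrightarrow> P + 0"
      using T_lim by (intro tendsto_add tendsto_const) 
    moreover have "eventually (\<lambda>j. N (r k) + ennreal c \<le> P + T (r j)) sequentially"
      using eventually_ge_at_top[of k]
    proof eventually_elim
      case (elim j)
      have "ennreal (- f (S *v z) * indicator {y. r k \<le> norm y} (S *v z) / norm z powr (real CARD('n) + 2 * s))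
          \<le> ennreal (- f (S *v z) * indicator {y. r j \<le> norm y} (S *v z) / norm z powr (real CARD('n) + 2 * s))" for z
        using r_mono[OF elim] by (auto simp: indicator_def)
      then have "N (r k) \<le> N (r j)"
        unfolding N_def kernel_integral_def by (intro nn_integral_mono)
      then show ?case using step[OF r(1) r(2), of j] by (meson add_right_mono order_trans)
    qed
    ultimately have "N (r k) + ennreal c \<le> P + 0"
      by (intro tendsto_lowerbound[of _ _ sequentially]) auto
    then show ?thesis by simp
  qed
  have "kernel_integral s (\<lambda>z. - f (S *v z)) = (SUP k. N (r k))"
  proof -
    define h where "h k z = ennreal (- f (S *v z) * indicator {y. r k \<le> norm y} (S *v z)
        / norm z powr (real CARD('n) + 2 * s))" for k z
    have "(SUP k. \<integral>\<^sup>+z. h k z \<partial>lborel) = (\<integral>\<^sup>+z. (SUP k. h k z) \<partial>lborel)"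
    proof (rule nn_integral_monotone_convergence_SUP[symmetric])
      show "incseq h"
      proof (intro incseq_SucI le_funI)
        fix k z
        show "h k z \<le> h (Suc k) z"
          using r_mono[of k "Suc k"] by (auto simp: h_def indicator_def)
      qed
    qed (simp add: h_def)
    also have "\<dots> = (\<integral>\<^sup>+z. ennreal (- f (S *v z) / norm z powr (real CARD('n) + 2 * s)) \<partial>lborel)"
    proof (rule nn_integral_cong, rule antisym)
      fix z
      show "(SUP k. h k z) \<le> ennreal (- f (S *v z) / norm z powr (real CARD('n) + 2 * s))"
        by (rule SUP_least) (auto simp: h_def indicator_def)
      show "ennreal (- f (S *v z) / norm z powr (real CARD('n) + 2 * s)) \<le> (SUP k. h k z)"
      proof (cases "S *v z = 0")
        case True
        then show ?thesis by (simp add: f_def second_diff_def)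
      next
        case False
        then have "eventually (\<lambda>k. r k < norm (S *v z)) sequentially"
          using r_lim by (intro order_tendstoD(2)) auto
        then obtain k where "r k < norm (S *v z)" by (auto simp: eventually_sequentially)
        then show ?thesis by (intro SUP_upper2[of k]) (auto simp: h_def)
      qed
    qed
    finally show ?thesis by (simp add: kernel_integral_def N_def h_def)
  qed
  then have "kernel_integral s (\<lambda>z. - f (S *v z)) + ennreal c = (SUP k. N (r k) + ennreal c)"
    by (simp add: ennreal_SUP_add_left)
  also have "\<dots> \<le> P" using N_le by (intro SUP_least)
  finally show ?thesis by (simp add: P_def c_def)
qed

text \<open>
  The form used later: \<open>X\<close> need not be the symmetric square root, and \<open>X X^T\<close> may be any point of the cone over \<open>M2\<close>.
\<close>

theorem viscosity_pointwise_linear: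
  fixes u :: "real^'n \<Rightarrow> real" and M X :: "real^'n^'n"
  assumes n: "2 \<le> CARD('n)" and s: "1 / 2 < s" "s < 1"
    and lip: "L-lipschitz_on UNIV u" and semi: "semiconcave SC u" and \<eta>: "0 < \<eta>0"
    and visc: "viscosity_ge s u \<eta>0 x" and M: "M \<in> M2" and X: "X ** transpose X = c *\<^sub>R M" and c: "0 < c"
  shows "kernel_integral s (\<lambda>z. - second_diff u x (X *v z)) + ennreal (2 * c powr s * (\<eta>0 / (1 - s)))
    \<le> kernel_integral s (\<lambda>z. second_diff u x (X *v z))"
proof -
  define f where "f = second_diff u x"
  have [measurable]: "u \<in> borel_measurable borel"
    using semi by (intro borel_measurable_continuous_onI) (auto simp: semiconcave_def)
  have f[measurable]: "f \<in> borel_measurable borel" unfolding f_def second_diff_def by measurable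
  have S: "matrix_sqrt M ** transpose (matrix_sqrt M) = 1 *\<^sub>R M" using M2_sqrt[OF n M] by simp
  have eq: "kernel_integral s (\<lambda>z. g (X *v z)) = ennreal (c powr s) * kernel_integral s (\<lambda>z. g (matrix_sqrt M *v z))"
    if "g \<in> borel_measurable borel" for g
    using nn_integral_M2_kernel[OF n M X c that, of s] nn_integral_M2_kernel[OF n M S _ that, of s]
    by (simp add: kernel_integral_def)
  have "ennreal (c powr s) * (kernel_integral s (\<lambda>z. - f (matrix_sqrt M *v z)) + ennreal (2 * (\<eta>0 / (1 - s))))
      \<le> ennreal (c powr s) * kernel_integral s (\<lambda>z. f (matrix_sqrt M *v z))"
    using viscosity_pointwise[OF n s lip semi \<eta> visc M] unfolding f_def by (rule mult_left_mono) simp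
  moreover have "ennreal (c powr s) * ennreal (2 * (\<eta>0 / (1 - s))) = ennreal (2 * c powr s * (\<eta>0 / (1 - s)))"
    using \<eta> s by (subst ennreal_mult[symmetric]) (auto simp: mult_ac)
  ultimately show ?thesis
    using eq[of f] eq[of "\<lambda>y. - f y"] by (simp add: distrib_left f_def[symmetric])
qed

section \<open>Lower bounds on hyperplanes\<close>

lemma kernel_integral_positive_part: "kernel_integral s (\<lambda>z. max 0 (w z)) = kernel_integral s w"
  unfolding kernel_integral_def by (intro nn_integral_cong) (auto simp: max_def ennreal_neg divide_nonpos_nonneg)

text \<open>
  Moving the second difference by \<open>y\<close> to both sides costs the second differences of \<open>u\<close> at \<open>x + v\<close>
  and \<open>x - v\<close>, which semiconcavity bounds from above.
\<close>

lemma second_diff_pair: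
  assumes "L-lipschitz_on UNIV u" "semiconcave SC u"
  shows "second_diff u x (v + y) + second_diff u x (v - y) \<le> 2 * second_diff u x v + 2 * rho L SC (norm y)"
proof -
  have "second_diff u x (v + y) + second_diff u x (v - y) - 2 * second_diff u x v
      = second_diff u (x + v) y + second_diff u (x - v) y"
    by (simp add: second_diff_def algebra_simps)
  also have "\<dots> \<le> rho L SC (norm y) + rho L SC (norm y)"
    by (intro add_mono second_diff_le_rho[OF assms])
  finally show ?thesis by simp
qed

lemma perp_reflection:
  fixes w :: "real^'n"
  assumes w: "norm w = 1"
  defines "R \<equiv> mat 1 - 2 *\<^sub>R outer w w"
  shows "orthogonal_matrix R" "w \<bullet> (R *v z) = - (w \<bullet> z)" "perp w (R *v z) = perp w z"
proof -
  have R: "R *v z = z - (2 * (w \<bullet> z)) *\<^sub>R w" for z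
    by (simp add: R_def matrix_vector_mult_diff_rdistrib scaleR_matrix_vector_assoc[symmetric] outer_vector_mult)
  have ww: "w \<bullet> w = 1" using w by (simp add: norm_eq_1)
  show 1: "w \<bullet> (R *v z) = - (w \<bullet> z)" for z by (simp add: R inner_diff_right ww)
  have "(2 * t) *\<^sub>R w = t *\<^sub>R w + t *\<^sub>R w" for t by (simp add: scaleR_left_distrib[symmetric])
  then show "perp w (R *v z) = perp w z" by (simp add: perp_def 1 del: scaleR_scaleR) (simp add: R)
  have "(R ** R) *v z = z" for z
    by (simp add: matrix_vector_mul_assoc[symmetric] R[of "R *v z"] 1) (simp add: R)
  then have "R ** R = mat 1" by (simp add: matrix_eq)
  moreover have "transpose R = R" by (simp add: R_def transpose_linear transpose_outer)
  ultimately show "orthogonal_matrix R" by (simp add: orthogonal_matrix_def)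
qed

lemma borel_measurable_second_diff:
  assumes "continuous_on UNIV u"
  shows "second_diff u x \<in> borel_measurable borel"
proof -
  have [measurable]: "u \<in> borel_measurable borel" by (rule borel_measurable_continuous_onI[OF assms])
  show ?thesis unfolding second_diff_def by measurable
qed

text \<open>
  Average the hypothesis over the reflection in \<open>w\<close> and replace both reflected arguments by their common
  projection to the hyperplane; the error depends only on the component along \<open>w\<close> and integrates to a
  multiple of the product of the first two constants.
\<close>

theorem hyperplane_lower_bound:
  fixes u :: "real^'n \<Rightarrow> real" and V :: "real^'n^'n" and x :: "real^'n"
  assumes n: "2 \<le> CARD('n)" and s: "1 / 2 < s" "s < 1"
    and lip: "L-lipschitz_on UNIV u" and semi: "semiconcave SC u" and w: "norm w = 1" and k: "0 \<le> k"
    and V: "0 < norm (V *v w)"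
  defines "f \<equiv> second_diff u x"
  assumes thick: "kernel_integral s (\<lambda>z. - f (V *v (perp w z + (k * (w \<bullet> z)) *\<^sub>R w))) + c
    \<le> kernel_integral s (\<lambda>z. f (V *v (perp w z + (k * (w \<bullet> z)) *\<^sub>R w)))"
  shows "kernel_integral s (\<lambda>z. - f (V *v perp w z)) + c
    \<le> kernel_integral s (\<lambda>z. f (V *v perp w z))
      + ennreal ((k * norm (V *v w)) powr (2 * s) * (const_C1 s L SC * const_C2 CARD('n) s))"
proof -
  have SC: "0 \<le> SC" and contu: "continuous_on UNIV u" using semi by (auto simp: semiconcave_def)
  have L: "0 \<le> L" using lipschitz_on_nonneg[OF lip] .
  have f[measurable]: "f \<in> borel_measurable borel"
    unfolding f_def by (rule borel_measurable_second_diff[OF contu])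
  define R where "R = mat 1 - 2 *\<^sub>R outer w w"
  note R = perp_reflection[OF w, folded R_def]
  define g where "g z = f (V *v (perp w z + (k * (w \<bullet> z)) *\<^sub>R w))" for z
  define g' where "g' z = f (V *v (perp w z - (k * (w \<bullet> z)) *\<^sub>R w))" for z
  define h where "h z = f (V *v perp w z)" for z
  define \<rho> where "\<rho> z = rho L SC (norm ((k * (w \<bullet> z)) *\<^sub>R (V *v w)))" for z
  have [measurable]: "g \<in> borel_measurable borel" "g' \<in> borel_measurable borel"
    "h \<in> borel_measurable borel" "\<rho> \<in> borel_measurable borel"
    unfolding g_def g'_def h_def \<rho>_def by measurable
  have \<rho>_nonneg: "0 \<le> \<rho> z" for z using L SC by (simp add: \<rho>_def rho_nonneg)
  have g'R: "g' z = g (R *v z)" for z by (simp add: g_def g'_def R)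
  have pair: "g z + g' z \<le> 2 * h z + 2 * \<rho> z" for z
    using second_diff_pair[OF lip semi, of x "V *v perp w z" "(k * (w \<bullet> z)) *\<^sub>R (V *v w)"]
    by (simp add: g_def g'_def h_def \<rho>_def f_def matrix_vector_right_distrib matrix_vector_mult_diff_distrib
        matrix_vector_mult_scaleR)
  define Gp Gm Hp Hm \<R> where "Gp = kernel_integral s g" and "Gm = kernel_integral s (\<lambda>z. - g z)"
    and "Hp = kernel_integral s h" and "Hm = kernel_integral s (\<lambda>z. - h z)" and "\<R> = kernel_integral s \<rho>"
  have parts: "kernel_integral s (\<lambda>z. max 0 (g z)) = Gp" "kernel_integral s (\<lambda>z. max 0 (- g z)) = Gm"
    "kernel_integral s (\<lambda>z. max 0 (h z)) = Hp" "kernel_integral s (\<lambda>z. max 0 (- h z)) = Hm"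
    "kernel_integral s (\<lambda>z. max 0 (g' z)) = Gp" "kernel_integral s (\<lambda>z. max 0 (- g' z)) = Gm"
    using kernel_integral_orthogonal[OF R(1), of g s] kernel_integral_orthogonal[OF R(1), of "\<lambda>z. - g z" s]
    by (simp_all add: kernel_integral_positive_part Gp_def Gm_def Hp_def Hm_def g'R)
  have "2 * Gp + 2 * Hm = kernel_integral s (\<lambda>z. (max 0 (g z) + max 0 (g' z)) + 2 * max 0 (- h z))"
    by (simp add: kernel_integral_add kernel_integral_cmult parts mult_2[of Gp])
  also have "\<dots> \<le> kernel_integral s (\<lambda>z. (max 0 (- g z) + max 0 (- g' z)) + (2 * max 0 (h z) + 2 * \<rho> z))"
  proof (rule kernel_integral_mono)
    fix z
    show "(max 0 (g z) + max 0 (g' z)) + 2 * max 0 (- h z)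
        \<le> (max 0 (- g z) + max 0 (- g' z)) + (2 * max 0 (h z) + 2 * \<rho> z)"
      using pair[of z] by (simp add: max_def split: if_splits)
  qed
  also have "\<dots> = 2 * Gm + (2 * Hp + 2 * \<R>)"
    by (simp add: kernel_integral_add kernel_integral_cmult parts \<rho>_nonneg \<R>_def mult_2[of Gm])
  finally have ineq: "2 * Gp + 2 * Hm \<le> 2 * Gm + (2 * Hp + 2 * \<R>)" .
  have thick': "Gm + c \<le> Gp" using thick by (simp add: Gm_def Gp_def g_def[abs_def])
  have "Gm < \<infinity>"
  proof -
    define X where "X = V ** (mat 1 + (k - 1) *\<^sub>R outer w w)"
    have X: "X *v z = V *v (perp w z + (k * (w \<bullet> z)) *\<^sub>R w)" for z
      by (simp add: X_def matrix_vector_mul_assoc[symmetric] matrix_vector_mult_add_rdistrib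
          scaleR_matrix_vector_assoc[symmetric] outer_vector_mult perp_def algebra_simps)
    have "Gp \<le> kernel_integral s (\<lambda>z. rho L SC (norm (X *v z)))"
      unfolding Gp_def by (rule kernel_integral_mono) (simp add: g_def X f_def second_diff_le_rho[OF lip semi])
    also have "\<dots> < \<infinity>" by (rule kernel_integral_rho_linear_finite[OF s L SC n])
    finally show ?thesis using thick' by (metis add_increasing2 le_less_trans order_trans zero_le le_iff_add)
  qed
  have "2 * (Gm + (Hm + c)) = 2 * (Gm + c) + 2 * Hm" by (simp add: distrib_left ac_simps)
  also have "\<dots> \<le> 2 * Gp + 2 * Hm" using thick' by (intro add_mono mult_left_mono) auto
  also have "\<dots> \<le> 2 * (Gm + (Hp + \<R>))" using ineq by (simp add: distrib_left)
  finally have "Gm + (Hm + c) \<le> Gm + (Hp + \<R>)"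
    by (subst (asm) ennreal_mult_le_mult_iff) auto
  then have "Hm + c \<le> Hp + \<R>" using \<open>Gm < \<infinity>\<close> by (auto simp: ennreal_add_left_cancel_le)
  moreover have "\<R> = ennreal ((k * norm (V *v w)) powr (2 * s) * (const_C1 s L SC * const_C2 CARD('n) s))"
  proof (cases "k = 0")
    case True then show ?thesis by (simp add: \<R>_def \<rho>_def[abs_def] rho_def kernel_integral_def)
  next
    case False
    then have kV: "0 < k * norm (V *v w)" using k V by simp
    have "\<R> = kernel_integral s (\<lambda>z. rho L SC \<bar>w \<bullet> ((k * norm (V *v w)) *\<^sub>R z)\<bar>)"
      using k by (simp add: \<R>_def \<rho>_def[abs_def] abs_mult mult_ac)
    also have "\<dots> = ennreal ((k * norm (V *v w)) powr (2 * s)) * kernel_integral s (\<lambda>z. rho L SC \<bar>w \<bullet> z\<bar>)"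
      by (rule kernel_integral_scale[OF kV]) simp
    finally show ?thesis by (simp add: kernel_integral_rho_normal[OF s L SC n w] ennreal_mult')
  qed
  ultimately show ?thesis by (simp add: Hm_def Hp_def h_def[abs_def])
qed

section \<open>Averages over tilted hyperplanes\<close>

text \<open>
  The same integral for functions with values in the extended half-line, where superposition needs no integrability.
\<close>

definition kernel_mass :: "real \<Rightarrow> (real^'n \<Rightarrow> ennreal) \<Rightarrow> ennreal" where
  "kernel_mass s G = (\<integral>\<^sup>+y. G y * ennreal (norm y powr (- (real CARD('n) + 2 * s))) \<partial>lborel)"

text \<open>
  Up to a Jacobian, the isotropic kernel integral over the hyperplane \<open>{v + (a.v) e | v orthogonal to e}\<close>, parametrized over the
  orthogonal complement of \<open>e\<close>; the coordinate \<open>e.y\<close> runs along the normal of the tilted hyperplane.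
\<close>

definition tilted_mass :: "real \<Rightarrow> real^'n \<Rightarrow> real^'n \<Rightarrow> (real^'n \<Rightarrow> ennreal) \<Rightarrow> ennreal" where
  "tilted_mass s e a G = (\<integral>\<^sup>+y. G (perp e y + (a \<bullet> perp e y) *\<^sub>R e)
     * ennreal (((e \<bullet> y)\<^sup>2 + ((norm (perp e y))\<^sup>2 + (a \<bullet> perp e y)\<^sup>2)) powr (- (real CARD('n) + 2 * s) / 2)) \<partial>lborel)"

text \<open>
  The terms of the binomial series for the thin kernels.
\<close>

definition zonal_mass :: "real \<Rightarrow> real^'n \<Rightarrow> nat \<Rightarrow> (real^'n \<Rightarrow> ennreal) \<Rightarrow> ennreal" where
  "zonal_mass s e k G = (\<integral>\<^sup>+y. G y * ennreal (norm (perp e y) ^ (2 * k)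
     * norm y powr (- (real CARD('n) + 2 * s) - 2 * real k)) \<partial>lborel)"

lemma norm_powr_minus: "norm y powr (- p) = ((norm y)\<^sup>2) powr (- p / 2)"
  using norm_powr_eq[of y "- p"] by simp

lemma injective_matrix_right_inverse:
  fixes X :: "real^'n^'n"
  assumes "\<And>x. X *v x = 0 \<Longrightarrow> x = 0"
  obtains Y where "X ** Y = mat 1"
proof -
  obtain Y where "Y ** X = mat 1"
    using assms matrix_left_invertible_ker[of X] by blast
  then have "X ** Y = mat 1" by (simp add: matrix_left_right_inverse)
  then show ?thesis by (rule that)
qed

text \<open>
  The linear map sending \<open>x\<close> to the point of the tilted hyperplane over the projection of \<open>x\<close>, plus \<open>e.x\<close> times the unit normal
  \<open>w\<close>, turns the tilted integral into an isotropic one; its Jacobian \<open>K\<close> depends on \<open>a\<close> only.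
\<close>

lemma tilted_mass_eq:
  fixes e a :: "real^'n"
  assumes e: "norm e = 1"
  obtains w K where "norm w = 1" "0 < K" "K < \<infinity>"
    "\<And>G. G \<in> borel_measurable borel \<Longrightarrow> tilted_mass s e a G = K * kernel_mass s (\<lambda>y. G (perp w y))"
proof -
  define a' where "a' = perp e a"
  \<comment> \<open>the unit normal of the tilted hyperplane is \<open>(e - a')/r\<close>\<close>
  define r where "r = sqrt (1 + (norm a')\<^sup>2)"
  have r2: "r\<^sup>2 = 1 + (norm a')\<^sup>2" and r: "0 < r" by (simp_all add: r_def add_pos_nonneg)
  define w where "w = (1 / r) *\<^sub>R (e - a')"
  have ee: "e \<bullet> e = 1" using e by (simp add: norm_eq_1)
  have ea: "e \<bullet> a' = 0" unfolding a'_def by (rule inner_perp[OF e])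
  have ap: "a \<bullet> perp e x = a' \<bullet> perp e x" for x
    using inner_perp[OF e, of x] by (simp add: a'_def perp_def[of e a] inner_diff_left)
  have nw: "norm w = 1"
  proof -
    have "(e - a') \<bullet> (e - a') = r\<^sup>2"
      using ee ea by (simp add: r2 inner_diff_left inner_diff_right inner_commute power2_norm_eq_inner)
    then have "norm (e - a') = r" using r by (metis norm_eq_sqrt_inner real_sqrt_unique less_imp_le)
    then show ?thesis using r by (simp add: w_def)
  qed
  define v where "v x = perp e x + (a \<bullet> perp e x) *\<^sub>R e" for x
  have wv: "w \<bullet> v x = 0" for x
    using ee ea inner_perp[OF e, of x]
    by (simp add: w_def v_def ap inner_diff_left inner_diff_right inner_add_right inner_commute)
  define X where "X = matrix (\<lambda>x. v x + (e \<bullet> x) *\<^sub>R w)"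
  have "linear (\<lambda>x. v x + (e \<bullet> x) *\<^sub>R w)"
    unfolding v_def perp_def by (rule linearI) (simp_all add: algebra_simps inner_add_right inner_diff_right)
  then have X: "X *v x = v x + (e \<bullet> x) *\<^sub>R w" for x
    by (simp add: X_def matrix_works)
  have perpX: "perp w (X *v x) = v x" for x
    by (simp add: X perp_add_multiple[OF nw wv])
  have nv: "(norm (v x))\<^sup>2 = (norm (perp e x))\<^sup>2 + (a \<bullet> perp e x)\<^sup>2" for x
    unfolding v_def by (rule norm_add_multiple[OF e inner_perp[OF e]])
  have nX: "(norm (X *v x))\<^sup>2 = (e \<bullet> x)\<^sup>2 + ((norm (perp e x))\<^sup>2 + (a \<bullet> perp e x)\<^sup>2)" for x
    by (simp add: X norm_add_multiple[OF nw wv] nv)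
  have "x = 0" if "X *v x = 0" for x
  proof -
    have "(e \<bullet> x)\<^sup>2 + ((norm (perp e x))\<^sup>2 + (a \<bullet> perp e x)\<^sup>2) = 0" using nX[of x] that by simp
    then have "e \<bullet> x = 0" "norm (perp e x) = 0"
      by (metis add_nonneg_eq_0_iff add_nonneg_nonneg power2_eq_iff_nonneg zero_le_power2 zero_eq_power2)+
    then show ?thesis by (simp add: perp_def)
  qed
  then obtain Y where "X ** Y = mat 1" using injective_matrix_right_inverse by metis
  then obtain K where K: "0 < K" "K < \<infinity>"
    "\<And>f. f \<in> borel_measurable borel \<Longrightarrow> (\<integral>\<^sup>+z. f (X *v z) \<partial>lborel) = K * (\<integral>\<^sup>+z. f z \<partial>lborel)"
    by (rule nn_integral_lborel_linear) blast
  have "tilted_mass s e a G = K * kernel_mass s (\<lambda>y. G (perp w y))" if [measurable]: "G \<in> borel_measurable borel" for G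
  proof -
    have "(\<integral>\<^sup>+x. (\<lambda>y. G (perp w y) * ennreal (norm y powr (- (real CARD('n) + 2 * s)))) (X *v x) \<partial>lborel)
        = K * kernel_mass s (\<lambda>y. G (perp w y))"
      unfolding kernel_mass_def by (rule K(3)) simp
    moreover have "norm (X *v x) powr (- (real CARD('n) + 2 * s))
        = ((e \<bullet> x)\<^sup>2 + ((norm (perp e x))\<^sup>2 + (a \<bullet> perp e x)\<^sup>2)) powr (- (real CARD('n) + 2 * s) / 2)" for x
      by (simp only: norm_powr_minus nX)
    ultimately show ?thesis
      by (simp only: tilted_mass_def perpX v_def[symmetric])
  qed
  with nw K show ?thesis using that by blast
qed

lemma AE_perp_nonzero:
  fixes e :: "real^'n"
  assumes n: "2 \<le> CARD('n)"
  shows "AE y in lborel. perp e y \<noteq> 0"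
proof -
  have "{y. perp e y = 0} \<subseteq> span {e}"
    by (auto simp: perp_def span_singleton)
  moreover have "negligible (span {e})"
    by (rule negligible_lowdim) (use n in \<open>auto intro: le_less_trans[OF dim_le_card]\<close>)
  ultimately have "negligible {y. perp e y = 0}" by (rule negligible_subset[rotated])
  moreover have "{y. perp e y = 0} \<in> sets borel" by measurable
  ultimately have "{y. perp e y = 0} \<in> null_sets lborel"
    by (simp add: negligible_iff_null_sets null_sets_def)
  then show ?thesis by (rule AE_I') auto
qed

text \<open>
  The weight is radial, so \<open>a.y\<close> may be replaced by \<open>|y|\<close> times one coordinate of \<open>a\<close>; integrating out the other
  coordinates leaves the power \<open>-k - 1/2\<close> by scaling.
\<close>

lemma nn_integral_radial_weight:
  fixes e y :: "real^'n" and H :: "real \<Rightarrow> ennreal" and k :: nat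
  assumes e: "norm e = 1" and y: "y \<noteq> 0" and [measurable]: "H \<in> borel_measurable borel"
  defines "q \<equiv> real k + real CARD('n) / 2"
  shows "(\<integral>\<^sup>+a. ennreal ((1 + (norm a)\<^sup>2) powr (- q)) * H (a \<bullet> y) \<partial>lborel)
    = hyp e (\<lambda>v. ennreal ((1 + (norm v)\<^sup>2) powr (- q)))
      * (\<integral>\<^sup>+t. H t * ennreal (norm y ^ (2 * k) * ((norm y)\<^sup>2 + t\<^sup>2) powr (- real k - 1 / 2)) \<partial>lborel)"
proof -
  define b where "b = hyp e (\<lambda>v. ennreal ((1 + (norm v)\<^sup>2) powr (- q)))"
  define r where "r = norm y"
  have r: "0 < r" using y by (simp add: r_def)
  obtain X where X: "orthogonal_matrix X" "X *v e = (1 / r) *\<^sub>R y" "\<And>x y. (X *v x) \<bullet> (X *v y) = x \<bullet> y"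
    using orthogonal_matrix_moving_unit_vector[of e "(1 / r) *\<^sub>R y"] e y by (auto simp: r_def)
  have Xy: "(X *v a) \<bullet> y = r * (e \<bullet> a)" for a
  proof -
    have "y = r *\<^sub>R (X *v e)" using X(2) r by simp
    then have "(X *v a) \<bullet> y = r * ((X *v a) \<bullet> (X *v e))" by (metis inner_scaleR_right)
    then show ?thesis by (simp add: X(3) inner_commute)
  qed
  have "(\<integral>\<^sup>+a. ennreal ((1 + (norm a)\<^sup>2) powr (- q)) * H (a \<bullet> y) \<partial>lborel)
      = (\<integral>\<^sup>+a. ennreal ((1 + (norm a)\<^sup>2) powr (- q)) * H (r * (e \<bullet> a)) \<partial>lborel)"
    by (subst nn_integral_lborel_orthogonal[OF X(1), symmetric]) (simp_all add: Xy orthogonal_matrix_norm[OF X(1)])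
  also have "\<dots> = hyp e (\<lambda>v. \<integral>\<^sup>+t. ennreal ((1 + (norm (v + t *\<^sub>R e))\<^sup>2) powr (- q)) * H (r * (e \<bullet> (v + t *\<^sub>R e))) \<partial>lborel)"
    by (rule nn_integral_hyperplane_slices[OF e]) simp
  also have "\<dots> = hyp e (\<lambda>v. \<integral>\<^sup>+t. ennreal ((1 + ((norm v)\<^sup>2 + t\<^sup>2)) powr (- q)) * H (r * t) \<partial>lborel)"
    using e by (intro hyp_cong) (simp_all add: norm_add_multiple inner_add_right norm_eq_1)
  also have "\<dots> = (\<integral>\<^sup>+t. hyp e (\<lambda>v. ennreal ((1 + ((norm v)\<^sup>2 + t\<^sup>2)) powr (- q)) * H (r * t)) \<partial>lborel)"
    by (rule hyp_nn_integral_swap) measurable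
  also have "\<dots> = (\<integral>\<^sup>+t. b * (H (r * t) * ennreal ((1 + t\<^sup>2) powr (- real k - 1 / 2))) \<partial>lborel)"
  proof (rule nn_integral_cong)
    fix t :: real
    define c where "c = sqrt (1 + t\<^sup>2)"
    have c: "0 < c" "c\<^sup>2 = 1 + t\<^sup>2" by (simp_all add: c_def add_pos_nonneg)
    have "hyp e (\<lambda>v. ennreal ((1 + ((norm v)\<^sup>2 + t\<^sup>2)) powr (- q)) * H (r * t))
        = hyp e (\<lambda>v. (H (r * t) * ennreal (c powr (- 2 * q))) * ennreal ((1 + (norm ((1 / c) *\<^sub>R v))\<^sup>2) powr (- q)))"
    proof (rule hyp_cong[OF e])
      fix v :: "real^'n"
      have eq: "1 + ((norm v)\<^sup>2 + t\<^sup>2) = c\<^sup>2 * (1 + (norm ((1 / c) *\<^sub>R v))\<^sup>2)"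
      proof -
        have "c\<^sup>2 * (1 + (norm ((1 / c) *\<^sub>R v))\<^sup>2) = c\<^sup>2 + (norm v)\<^sup>2"
          using c(1) by (simp add: power_mult_distrib power_divide distrib_left)
        then show ?thesis by (simp add: c(2))
      qed
      have "(1 + ((norm v)\<^sup>2 + t\<^sup>2)) powr (- q) = (c\<^sup>2) powr (- q) * (1 + (norm ((1 / c) *\<^sub>R v))\<^sup>2) powr (- q)"
        unfolding eq by (rule powr_mult)
      also have "(c\<^sup>2) powr (- q) = c powr (- 2 * q)"
        using power2_powr_half[of c "- 2 * q"] c(1) by simp
      finally show "ennreal ((1 + ((norm v)\<^sup>2 + t\<^sup>2)) powr (- q)) * H (r * t)
          = (H (r * t) * ennreal (c powr (- 2 * q))) * ennreal ((1 + (norm ((1 / c) *\<^sub>R v))\<^sup>2) powr (- q))"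
        by (simp only: ennreal_mult'[OF powr_ge_zero] mult_ac)
    qed
    also have "\<dots> = (H (r * t) * ennreal (c powr (- 2 * q))) * (ennreal ((1 / c) powr (1 - real CARD('n))) * b)"
      using hyp_scale[OF e, of "\<lambda>v. ennreal ((1 + (norm v)\<^sup>2) powr (- q))" "1 / c"] c(1)
      by (subst hyp_cmult) (auto simp: b_def)
    also have "\<dots> = b * (H (r * t) * ennreal (c powr (- 2 * q) * (1 / c) powr (1 - real CARD('n))))"
      by (simp only: ennreal_mult'[OF powr_ge_zero] mult_ac)
    also have "c powr (- 2 * q) * (1 / c) powr (1 - real CARD('n)) = (1 + t\<^sup>2) powr (- real k - 1 / 2)"
    proof -
      have "(1 / c) powr (1 - real CARD('n)) = c powr (real CARD('n) - 1)"
        using powr_minus_divide[of c "1 - real CARD('n)"] by (simp add: powr_divide)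
      then have "c powr (- 2 * q) * (1 / c) powr (1 - real CARD('n)) = c powr (- 2 * q + (real CARD('n) - 1))"
        by (simp only: powr_add)
      also have "- 2 * q + (real CARD('n) - 1) = 2 * (- real k - 1 / 2)" by (simp add: q_def)
      also have "c powr (2 * (- real k - 1 / 2)) = (c\<^sup>2) powr (- real k - 1 / 2)"
      proof -
        have "c powr (2 * m) = (c\<^sup>2) powr m" for m
          using power2_powr_half[of c "2 * m"] c(1) by simp
        then show ?thesis .
      qed
      finally show ?thesis by (simp add: c)
    qed
    finally show "hyp e (\<lambda>v. ennreal ((1 + ((norm v)\<^sup>2 + t\<^sup>2)) powr (- q)) * H (r * t))
        = b * (H (r * t) * ennreal ((1 + t\<^sup>2) powr (- real k - 1 / 2)))" .
  qed
  also have "\<dots> = b * (\<integral>\<^sup>+t. H (r * t) * ennreal ((1 + t\<^sup>2) powr (- real k - 1 / 2)) \<partial>lborel)"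
    by (rule nn_integral_cmult) simp
  also have "(\<integral>\<^sup>+t. H (r * t) * ennreal ((1 + t\<^sup>2) powr (- real k - 1 / 2)) \<partial>lborel)
      = (\<integral>\<^sup>+t. H t * ennreal (r ^ (2 * k) * (r\<^sup>2 + t\<^sup>2) powr (- real k - 1 / 2)) \<partial>lborel)"
  proof -
    have "(\<integral>\<^sup>+t. H t * ennreal (r ^ (2 * k) * (r\<^sup>2 + t\<^sup>2) powr (- real k - 1 / 2)) \<partial>lborel)
        = ennreal r * (\<integral>\<^sup>+t. H (0 + r * t) * ennreal (r ^ (2 * k) * (r\<^sup>2 + (0 + r * t)\<^sup>2) powr (- real k - 1 / 2)) \<partial>lborel)"
      using r by (subst nn_integral_real_affine[of _ r 0]) auto
    also have "\<dots> = (\<integral>\<^sup>+t. ennreal r * (H (0 + r * t) * ennreal (r ^ (2 * k) * (r\<^sup>2 + (0 + r * t)\<^sup>2) powr (- real k - 1 / 2))) \<partial>lborel)"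
      by (rule nn_integral_cmult[symmetric]) simp
    also have "\<dots> = (\<integral>\<^sup>+t. H (r * t) * ennreal ((1 + t\<^sup>2) powr (- real k - 1 / 2)) \<partial>lborel)"
    proof (rule nn_integral_cong)
      fix t :: real
      have eq: "r\<^sup>2 + (0 + r * t)\<^sup>2 = r\<^sup>2 * (1 + t\<^sup>2)" by (simp add: power_mult_distrib algebra_simps)
      have "(r\<^sup>2 + (0 + r * t)\<^sup>2) powr (- real k - 1 / 2) = (r\<^sup>2) powr (- real k - 1 / 2) * (1 + t\<^sup>2) powr (- real k - 1 / 2)"
        unfolding eq by (rule powr_mult)
      also have "(r\<^sup>2) powr (- real k - 1 / 2) = r powr (2 * (- real k - 1 / 2))"
      proof -
        have "(r\<^sup>2) powr m = r powr (2 * m)" for m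
          using power2_powr_half[of r "2 * m"] r by simp
        then show ?thesis .
      qed
      finally have "r * (r ^ (2 * k) * (r\<^sup>2 + (0 + r * t)\<^sup>2) powr (- real k - 1 / 2))
          = (r * r ^ (2 * k) * r powr (2 * (- real k - 1 / 2))) * (1 + t\<^sup>2) powr (- real k - 1 / 2)"
        by simp
      also have "r * r ^ (2 * k) * r powr (2 * (- real k - 1 / 2)) = 1"
      proof -
        have "r * r ^ (2 * k) = r powr (1 + 2 * real k)"
          using r by (simp add: powr_add powr_realpow[symmetric])
        then show ?thesis using r by (simp add: powr_add[symmetric])
      qed
      finally have "r * (r ^ (2 * k) * (r\<^sup>2 + (0 + r * t)\<^sup>2) powr (- real k - 1 / 2)) = (1 + t\<^sup>2) powr (- real k - 1 / 2)"
        by simp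
      then have "ennreal r * ennreal (r ^ (2 * k) * (r\<^sup>2 + (0 + r * t)\<^sup>2) powr (- real k - 1 / 2))
          = ennreal ((1 + t\<^sup>2) powr (- real k - 1 / 2))"
        using r by (subst ennreal_mult[symmetric]) auto
      then show "ennreal r * (H (0 + r * t) * ennreal (r ^ (2 * k) * (r\<^sup>2 + (0 + r * t)\<^sup>2) powr (- real k - 1 / 2)))
          = H (r * t) * ennreal ((1 + t\<^sup>2) powr (- real k - 1 / 2))"
        by (metis add_0 mult.left_commute)
    qed
    finally show ?thesis by simp
  qed
  finally show ?thesis by (simp add: b_def r_def)
qed


text \<open>
  After exchanging the integrations, \<open>a\<close> enters only through \<open>a.y'\<close>, which becomes the new \<open>e\<close>-coordinate of the
  point, while the old \<open>e\<close>-coordinate is a free variable that integrates to a power of the norm.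
  The weight \<open>(1+|a|^2)^(-k-n/2)\<close> is the one whose marginal produces \<open>|y'|^(2k)\<close>.
\<close>

lemma tilted_average:
  fixes e :: "real^'n" and k :: nat
  assumes n: "2 \<le> CARD('n)" and s: "0 < s" and e: "norm e = 1"
  defines "q \<equiv> real k + real CARD('n) / 2"
  obtains C where "0 < C" "C < \<infinity>"
    "\<And>G. G \<in> borel_measurable borel \<Longrightarrow>
      (\<integral>\<^sup>+a. ennreal ((1 + (norm a)\<^sup>2) powr (- q)) * tilted_mass s e a G \<partial>lborel) = C * zonal_mass s e k G"
proof -
  define p where "p = real CARD('n) + 2 * s"
  define b where "b = hyp e (\<lambda>v. ennreal ((1 + (norm v)\<^sup>2) powr (- q)))"
  define C3 where "C3 = ennreal (const_C3 CARD('n) s)"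
  have C3: "0 < C3" "C3 < \<infinity>" "(\<integral>\<^sup>+t. ennreal (1 / (1 + t\<^sup>2) powr (p / 2)) \<partial>lborel) = C3"
    using const_C3_nn[OF s, of "CARD('n)"] by (simp_all add: C3_def p_def)
  have bfin: "b < \<infinity>"
    unfolding b_def powr_minus_divide by (rule hyp_decay_finite[OF e _ n]) (simp add: q_def)
  have bpos: "0 < b"
  proof -
    have "b \<noteq> 0"
    proof
      assume "b = 0"
      have nz: "(1 + (norm v)\<^sup>2) powr (- q) \<noteq> 0" for v :: "real^'n"
        by (metis add_pos_nonneg less_irrefl powr_eq_0_iff zero_le_power2 zero_less_one)
      have "(\<integral>\<^sup>+y. ennreal ((1 + (norm (perp e y))\<^sup>2) powr (- q)) \<partial>lborel)
          = (\<integral>\<^sup>+t. (1::ennreal) \<partial>(lborel :: real measure)) * b"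
        using nn_integral_product_hyperplane[OF e, of "\<lambda>_. 1" "\<lambda>v. ennreal ((1 + (norm v)\<^sup>2) powr (- q))"]
        by (simp add: b_def)
      then have "(\<integral>\<^sup>+y. ennreal ((1 + (norm (perp e y))\<^sup>2) powr (- q)) \<partial>lborel) = 0"
        using \<open>b = 0\<close> by simp
      then have "emeasure lborel {y \<in> space lborel. ennreal ((1 + (norm (perp e y))\<^sup>2) powr (- q)) \<noteq> 0} = 0"
        by (subst (asm) nn_integral_0_iff) auto
      moreover have "{y \<in> space lborel. ennreal ((1 + (norm (perp e y))\<^sup>2) powr (- q)) \<noteq> 0} = UNIV"
      proof -
        have "ennreal ((1 + (norm (perp e y))\<^sup>2) powr (- q)) \<noteq> 0" for y
          using nz[of "perp e y"] powr_ge_zero[of "1 + (norm (perp e y))\<^sup>2" "- q"]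
          by (simp add: ennreal_eq_0_iff)
        then show ?thesis by auto
      qed
      ultimately show False by simp
    qed
    then show ?thesis by (simp add: zero_less_iff_neq_zero)
  qed
  have main: "(\<integral>\<^sup>+a. ennreal ((1 + (norm a)\<^sup>2) powr (- q)) * tilted_mass s e a G \<partial>lborel) = b * C3 * zonal_mass s e k G"
    if G[measurable]: "G \<in> borel_measurable borel" for G
  proof -
    define h where "h c v t = G (v + t *\<^sub>R e) * ennreal ((c\<^sup>2 + ((norm v)\<^sup>2 + t\<^sup>2)) powr (- p / 2))" for c v t
    define \<omega> where "\<omega> v t = ennreal (norm v ^ (2 * k) * ((norm v)\<^sup>2 + t\<^sup>2) powr (- real k - 1 / 2))" for v :: "real^'n" and t :: real
    have "(\<integral>\<^sup>+a. ennreal ((1 + (norm a)\<^sup>2) powr (- q)) * tilted_mass s e a G \<partial>lborel)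
        = (\<integral>\<^sup>+a. \<integral>\<^sup>+y. ennreal ((1 + (norm a)\<^sup>2) powr (- q)) * h (e \<bullet> y) (perp e y) (a \<bullet> perp e y) \<partial>lborel \<partial>lborel)"
      unfolding tilted_mass_def h_def p_def by (subst nn_integral_cmult[symmetric]) simp_all
    also have "\<dots> = (\<integral>\<^sup>+y. \<integral>\<^sup>+a. ennreal ((1 + (norm a)\<^sup>2) powr (- q)) * h (e \<bullet> y) (perp e y) (a \<bullet> perp e y) \<partial>lborel \<partial>lborel)"
      by (rule lborel_pair.Fubini') (simp add: h_def)
    also have "\<dots> = (\<integral>\<^sup>+y. b * (\<integral>\<^sup>+t. h (e \<bullet> y) (perp e y) t * \<omega> (perp e y) t \<partial>lborel) \<partial>lborel)"
    proof (rule nn_integral_cong_AE, rule AE_mp[OF AE_perp_nonzero[OF n, of e]], intro AE_I2 impI)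
      fix y :: "real^'n" assume y: "perp e y \<noteq> 0"
      show "(\<integral>\<^sup>+a. ennreal ((1 + (norm a)\<^sup>2) powr (- q)) * h (e \<bullet> y) (perp e y) (a \<bullet> perp e y) \<partial>lborel)
          = b * (\<integral>\<^sup>+t. h (e \<bullet> y) (perp e y) t * \<omega> (perp e y) t \<partial>lborel)"
        unfolding b_def q_def \<omega>_def by (rule nn_integral_radial_weight[OF e y]) (simp add: h_def)
    qed
    also have "\<dots> = b * (\<integral>\<^sup>+y. \<integral>\<^sup>+t. h (e \<bullet> y) (perp e y) t * \<omega> (perp e y) t \<partial>lborel \<partial>lborel)"
      by (rule nn_integral_cmult) (simp add: h_def \<omega>_def)
    also have "(\<integral>\<^sup>+y. \<integral>\<^sup>+t. h (e \<bullet> y) (perp e y) t * \<omega> (perp e y) t \<partial>lborel \<partial>lborel)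
        = hyp e (\<lambda>v. \<integral>\<^sup>+c. \<integral>\<^sup>+t. h (e \<bullet> (v + c *\<^sub>R e)) (perp e (v + c *\<^sub>R e)) t * \<omega> (perp e (v + c *\<^sub>R e)) t \<partial>lborel \<partial>lborel)"
      by (rule nn_integral_hyperplane_slices[OF e]) (simp add: h_def \<omega>_def)
    also have "\<dots> = hyp e (\<lambda>v. C3 * (\<integral>\<^sup>+t. G (v + t *\<^sub>R e) * ennreal (norm (perp e (v + t *\<^sub>R e)) ^ (2 * k)
        * norm (v + t *\<^sub>R e) powr (- p - 2 * real k)) \<partial>lborel))"
    proof (rule hyp_cong[OF e])
      fix v :: "real^'n" assume v: "e \<bullet> v = 0"
      have "(\<integral>\<^sup>+c. \<integral>\<^sup>+t. h (e \<bullet> (v + c *\<^sub>R e)) (perp e (v + c *\<^sub>R e)) t * \<omega> (perp e (v + c *\<^sub>R e)) t \<partial>lborel \<partial>lborel)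
          = (\<integral>\<^sup>+c. \<integral>\<^sup>+t. h c v t * \<omega> v t \<partial>lborel \<partial>lborel)"
        using e v by (simp add: perp_add_multiple inner_add_right norm_eq_1)
      also have "\<dots> = (\<integral>\<^sup>+t. \<integral>\<^sup>+c. h c v t * \<omega> v t \<partial>lborel \<partial>lborel)"
        by (rule lborel_pair.Fubini') (simp add: h_def \<omega>_def)
      also have "\<dots> = (\<integral>\<^sup>+t. C3 * (G (v + t *\<^sub>R e) * ennreal (norm v ^ (2 * k) * norm (v + t *\<^sub>R e) powr (- p - 2 * real k))) \<partial>lborel)"
      proof (rule nn_integral_cong_AE, rule AE_mp[OF AE_lborel_singleton[of 0]], intro AE_I2 impI)
        fix t :: real assume t: "t \<noteq> 0"
        define r where "r = norm (v + t *\<^sub>R e)"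
        have r2: "r\<^sup>2 = (norm v)\<^sup>2 + t\<^sup>2" unfolding r_def by (rule norm_add_multiple[OF e v])
        have "0 < r\<^sup>2" unfolding r2 using t by (simp add: add_nonneg_pos)
        then have r: "0 < r" by (simp add: r_def)
        have "(\<integral>\<^sup>+c. h c v t * \<omega> v t \<partial>lborel)
            = (\<integral>\<^sup>+c. (G (v + t *\<^sub>R e) * \<omega> v t) * ennreal (1 / (r\<^sup>2 + c\<^sup>2) powr (p / 2)) \<partial>lborel)"
        proof (rule nn_integral_cong)
          fix c :: real
          have "(c\<^sup>2 + ((norm v)\<^sup>2 + t\<^sup>2)) powr (- p / 2) = 1 / (r\<^sup>2 + c\<^sup>2) powr (p / 2)"
            using powr_minus_divide[of "r\<^sup>2 + c\<^sup>2" "p / 2"] by (simp add: r2 add.commute)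
          then show "h c v t * \<omega> v t = (G (v + t *\<^sub>R e) * \<omega> v t) * ennreal (1 / (r\<^sup>2 + c\<^sup>2) powr (p / 2))"
            by (simp only: h_def mult_ac)
        qed
        also have "\<dots> = (G (v + t *\<^sub>R e) * \<omega> v t) * (ennreal (r powr (1 - p)) * C3)"
          by (subst nn_integral_cmult) (simp_all add: nn_integral_bell_scale[OF r] C3(3))
        also have "\<dots> = C3 * (G (v + t *\<^sub>R e) * (ennreal (r powr (1 - p)) * \<omega> v t))"
          by (simp only: mult_ac)
        also have "ennreal (r powr (1 - p)) * \<omega> v t = ennreal (norm v ^ (2 * k) * r powr (- p - 2 * real k))"
        proof -
          have "(r\<^sup>2) powr m = r powr (2 * m)" for m
            using power2_powr_half[of r "2 * m"] r by simp
          then have "(r\<^sup>2) powr (- real k - 1 / 2) = r powr (2 * (- real k - 1 / 2))" .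
          then have "r powr (1 - p) * (norm v ^ (2 * k) * (r\<^sup>2) powr (- real k - 1 / 2))
              = norm v ^ (2 * k) * r powr ((1 - p) + 2 * (- real k - 1 / 2))"
            by (simp only: powr_add mult_ac)
          also have "(1 - p) + 2 * (- real k - 1 / 2) = - p - 2 * real k" by simp
          finally show ?thesis by (simp only: \<omega>_def r2[symmetric] ennreal_mult'[OF powr_ge_zero, symmetric])
        qed
        finally show "(\<integral>\<^sup>+c. h c v t * \<omega> v t \<partial>lborel)
            = C3 * (G (v + t *\<^sub>R e) * ennreal (norm v ^ (2 * k) * norm (v + t *\<^sub>R e) powr (- p - 2 * real k)))"
          by (simp only: r_def)
      qed
      also have "\<dots> = C3 * (\<integral>\<^sup>+t. G (v + t *\<^sub>R e) * ennreal (norm (perp e (v + t *\<^sub>R e)) ^ (2 * k)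
          * norm (v + t *\<^sub>R e) powr (- p - 2 * real k)) \<partial>lborel)"
        using e v by (subst nn_integral_cmult) (simp_all add: perp_add_multiple)
      finally show "(\<integral>\<^sup>+c. \<integral>\<^sup>+t. h (e \<bullet> (v + c *\<^sub>R e)) (perp e (v + c *\<^sub>R e)) t * \<omega> (perp e (v + c *\<^sub>R e)) t \<partial>lborel \<partial>lborel)
         = C3 * (\<integral>\<^sup>+t. G (v + t *\<^sub>R e) * ennreal (norm (perp e (v + t *\<^sub>R e)) ^ (2 * k)
          * norm (v + t *\<^sub>R e) powr (- p - 2 * real k)) \<partial>lborel)" .
    qed
    also have "\<dots> = C3 * hyp e (\<lambda>v. \<integral>\<^sup>+t. G (v + t *\<^sub>R e) * ennreal (norm (perp e (v + t *\<^sub>R e)) ^ (2 * k)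
          * norm (v + t *\<^sub>R e) powr (- p - 2 * real k)) \<partial>lborel)"
      by (rule hyp_cmult) simp
    also have "hyp e (\<lambda>v. \<integral>\<^sup>+t. G (v + t *\<^sub>R e) * ennreal (norm (perp e (v + t *\<^sub>R e)) ^ (2 * k)
          * norm (v + t *\<^sub>R e) powr (- p - 2 * real k)) \<partial>lborel) = zonal_mass s e k G"
      unfolding zonal_mass_def p_def by (rule nn_integral_hyperplane_slices[OF e, symmetric]) simp
    finally show ?thesis by (simp only: mult.assoc)
  qed
  show ?thesis
    by (rule that[of "b * C3"])
       (use C3 bpos bfin main in \<open>auto simp: ennreal_zero_less_mult_iff ennreal_mult_less_top\<close>)
qed

lemma zonal_mass_mono:
  fixes e :: "real^'n"
  assumes n: "2 \<le> CARD('n)" and s: "0 < s" and e: "norm e = 1"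
    and G: "G \<in> borel_measurable borel" "G' \<in> borel_measurable borel"
    and le: "\<And>w. norm w = 1 \<Longrightarrow> kernel_mass s (\<lambda>y. G (perp w y)) \<le> kernel_mass s (\<lambda>y. G' (perp w y))"
  shows "zonal_mass s e k G \<le> zonal_mass s e k G'"
proof -
  have "tilted_mass s e a G \<le> tilted_mass s e a G'" for a
  proof -
    obtain w K where w: "norm w = 1" "0 < K" "K < \<infinity>"
      "\<And>G. G \<in> borel_measurable borel \<Longrightarrow> tilted_mass s e a G = K * kernel_mass s (\<lambda>y. G (perp w y))"
      using tilted_mass_eq[OF e, of s a] by blast
    show ?thesis unfolding w(4)[OF G(1)] w(4)[OF G(2)] by (intro mult_left_mono le w) simp
  qed
  then have le': "(\<integral>\<^sup>+a. ennreal ((1 + (norm a)\<^sup>2) powr (- (real k + real CARD('n) / 2))) * tilted_mass s e a G \<partial>lborel)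
      \<le> (\<integral>\<^sup>+a. ennreal ((1 + (norm a)\<^sup>2) powr (- (real k + real CARD('n) / 2))) * tilted_mass s e a G' \<partial>lborel)"
    by (intro nn_integral_mono mult_left_mono) auto
  obtain C where C: "0 < C" "C < \<infinity>"
    "\<And>G. G \<in> borel_measurable borel \<Longrightarrow>
      (\<integral>\<^sup>+a. ennreal ((1 + (norm a)\<^sup>2) powr (- (real k + real CARD('n) / 2))) * tilted_mass s e a G \<partial>lborel) = C * zonal_mass s e k G"
    using tilted_average[OF n s e, of k] by blast
  from le' have "C * zonal_mass s e k G \<le> C * zonal_mass s e k G'" by (simp only: C(3)[OF G(1)] C(3)[OF G(2)])
  then show ?thesis using C by (subst (asm) ennreal_mult_le_mult_iff) auto
qed

section \<open>Thin kernels as superpositions of hyperplane kernels\<close>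

text \<open>
  The kernel in question is \<open>\<kappa>^(p/2) (|y|^2 - (1-\<kappa>)|y'|^2)^(-p/2)\<close> with \<open>\<kappa> = t^2\<close> and \<open>p = n + 2s\<close>; its binomial series in
  \<open>(1-\<kappa>)|y'|^2/|y|^2 < 1\<close> has positive coefficients because the exponent is negative.
\<close>

lemma kernel_mass_zonal_series:
  fixes e :: "real^'n"
  assumes e: "norm e = 1" and s: "0 < s" and t: "0 < t" "t < 1"
  obtains C a where "\<And>G. G \<in> borel_measurable borel \<Longrightarrow>
    kernel_mass s (\<lambda>z. G (perp e z + (t * (e \<bullet> z)) *\<^sub>R e)) = C * (\<Sum>k. a k * zonal_mass s e k G)"
proof -
  define p where "p = real CARD('n) + 2 * s"
  have p: "0 < p" using s by (simp add: p_def add_nonneg_pos)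
  define Y where "Y = mat 1 + (t - 1) *\<^sub>R outer e e"
  have Y: "Y *v z = perp e z + (t * (e \<bullet> z)) *\<^sub>R e" for z
    by (simp add: Y_def matrix_vector_mult_add_rdistrib scaleR_matrix_vector_assoc[symmetric]
        outer_vector_mult perp_def algebra_simps)
  have eY: "e \<bullet> (Y *v z) = t * (e \<bullet> z)" and pY: "perp e (Y *v z) = perp e z" for z
    using e inner_perp[OF e, of z] by (simp_all add: Y inner_add_right norm_eq_1 perp_add_multiple)
  define \<kappa> where "\<kappa> = t\<^sup>2"
  have \<kappa>: "0 < \<kappa>" "\<kappa> < 1" using t by (simp_all add: \<kappa>_def power_less_one_iff)
  have "z = 0" if "Y *v z = 0" for z
    using that eY[of z] pY[of z] t by (simp add: perp_def)
  then obtain Z where "Y ** Z = mat 1" using injective_matrix_right_inverse by metis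
  then obtain K where K: "0 < K" "K < \<infinity>"
    "\<And>f. f \<in> borel_measurable borel \<Longrightarrow> (\<integral>\<^sup>+z. f (Y *v z) \<partial>lborel) = K * (\<integral>\<^sup>+z. f z \<partial>lborel)"
    by (rule nn_integral_lborel_linear) blast
  define d where "d k = pochhammer (p / 2) k / fact k * (1 - \<kappa>) ^ k" for k
  have d: "0 \<le> d k" for k using p \<kappa> by (simp add: d_def pochhammer_nonneg)
  have series: "(\<lambda>k. ennreal (d k) * ennreal (norm (perp e y) ^ (2 * k) * norm y powr (- p - 2 * real k))) sums
      ennreal (((e \<bullet> y)\<^sup>2 + \<kappa> * (norm (perp e y))\<^sup>2) powr (- p / 2))" (is "?f sums _") for y
  proof (cases "y = 0")
    case True
    then show ?thesis by (simp add: perp_def)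
  next
    case False
    then have y: "0 < norm y" by simp
    define r where "r = (norm (perp e y))\<^sup>2 / (norm y)\<^sup>2"
    have dec: "(norm y)\<^sup>2 = (norm (perp e y))\<^sup>2 + (e \<bullet> y)\<^sup>2" by (rule norm_perp_decomposition[OF e])
    have "(norm (perp e y))\<^sup>2 \<le> (norm y)\<^sup>2" using dec zero_le_power2[of "e \<bullet> y"] by linarith
    then have r: "0 \<le> r" "r \<le> 1" using y by (auto simp: r_def divide_le_eq_1)
    define z where "z = - ((1 - \<kappa>) * r)"
    have "(1 - \<kappa>) * r \<le> 1 - \<kappa>" using r \<kappa> by (simp add: mult_left_le)
    also have "1 - \<kappa> < 1" using \<kappa> by simp
    finally have "(1 - \<kappa>) * r < 1" .
    moreover have "0 \<le> (1 - \<kappa>) * r" using r \<kappa> by simp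
    ultimately have z: "\<bar>z\<bar> < 1" unfolding z_def by simp
    have "(\<lambda>k. ((- p / 2) gchoose k) * z ^ k) sums (1 + z) powr (- p / 2)"
      by (rule gen_binomial_real[OF z])
    then have "(\<lambda>k. ((- p / 2) gchoose k) * z ^ k * norm y powr (- p)) sums ((1 + z) powr (- p / 2) * norm y powr (- p))"
      by (rule sums_mult2)
    also have "(\<lambda>k. ((- p / 2) gchoose k) * z ^ k * norm y powr (- p))
        = (\<lambda>k. d k * (norm (perp e y) ^ (2 * k) * norm y powr (- p - 2 * real k)))"
    proof
      fix k
      have "((- p / 2) gchoose k) * z ^ k = d k * r ^ k"
      proof -
        have one: "(- 1 :: real) ^ k * (- 1) ^ k = 1" by (simp add: power_mult_distrib[symmetric])
        have "((- p / 2) gchoose k) = (- 1) ^ k * (pochhammer (p / 2) k / fact k)"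
          using gbinomial_pochhammer[of "- p / 2" k] by simp
        moreover have "z ^ k = (- 1) ^ k * ((1 - \<kappa>) ^ k * r ^ k)"
          by (simp only: z_def power_minus[of "(1 - \<kappa>) * r"] power_mult_distrib)
        ultimately have eq: "((- p / 2) gchoose k) * z ^ k
            = ((- 1) ^ k * (- 1) ^ k) * (pochhammer (p / 2) k / fact k * (1 - \<kappa>) ^ k * r ^ k)"
          by (simp only: mult_ac)
        show ?thesis unfolding eq one d_def by simp
      qed
      moreover have "r ^ k * norm y powr (- p) = norm (perp e y) ^ (2 * k) * norm y powr (- p - 2 * real k)"
      proof -
        have "norm y powr (- p - 2 * real k) = norm y powr (- p) / norm y powr (real (2 * k))"
          by (simp add: powr_diff)
        also have "norm y powr (real (2 * k)) = norm y ^ (2 * k)" using y by (rule powr_realpow)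
        finally show ?thesis by (simp add: r_def power_divide power_mult)
      qed
      ultimately show "((- p / 2) gchoose k) * z ^ k * norm y powr (- p)
          = d k * (norm (perp e y) ^ (2 * k) * norm y powr (- p - 2 * real k))"
        by (simp add: mult.assoc)
    qed
    also have "(1 + z) powr (- p / 2) * norm y powr (- p) = ((e \<bullet> y)\<^sup>2 + \<kappa> * (norm (perp e y))\<^sup>2) powr (- p / 2)"
    proof -
      have "(1 + z) * (norm y)\<^sup>2 = (norm y)\<^sup>2 - (1 - \<kappa>) * (norm (perp e y))\<^sup>2"
      proof -
        have "r * (norm y)\<^sup>2 = (norm (perp e y))\<^sup>2" using y by (simp add: r_def)
        moreover have "(1 + z) * (norm y)\<^sup>2 = (norm y)\<^sup>2 - (1 - \<kappa>) * (r * (norm y)\<^sup>2)"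
          by (simp add: z_def algebra_simps)
        ultimately show ?thesis by simp
      qed
      also have "\<dots> = (e \<bullet> y)\<^sup>2 + \<kappa> * (norm (perp e y))\<^sup>2" by (simp add: dec algebra_simps)
      finally have eq: "(e \<bullet> y)\<^sup>2 + \<kappa> * (norm (perp e y))\<^sup>2 = (1 + z) * (norm y)\<^sup>2" by simp
      show ?thesis unfolding eq powr_mult norm_powr_minus ..
    qed
    finally have sums: "(\<lambda>k. d k * (norm (perp e y) ^ (2 * k) * norm y powr (- p - 2 * real k)))
        sums ((e \<bullet> y)\<^sup>2 + \<kappa> * (norm (perp e y))\<^sup>2) powr (- p / 2)" .
    have nonneg: "0 \<le> d k * (norm (perp e y) ^ (2 * k) * norm y powr (- p - 2 * real k))" for k
      using d by (intro mult_nonneg_nonneg) auto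
    have f: "?f = (\<lambda>k. ennreal (d k * (norm (perp e y) ^ (2 * k) * norm y powr (- p - 2 * real k))))"
      using d by (simp add: ennreal_mult)
    show ?thesis unfolding f using sums nonneg by (subst sums_ennreal) auto
  qed
  show ?thesis
  proof (rule that[of "K * ennreal (\<kappa> powr (p / 2))" "\<lambda>k. ennreal (d k)"])
    fix G :: "real^'n \<Rightarrow> ennreal" assume [measurable]: "G \<in> borel_measurable borel"
    define H where "H y = G y * ennreal (\<kappa> powr (p / 2) * ((e \<bullet> y)\<^sup>2 + \<kappa> * (norm (perp e y))\<^sup>2) powr (- p / 2))" for y
    have "kernel_mass s (\<lambda>z. G (perp e z + (t * (e \<bullet> z)) *\<^sub>R e)) = (\<integral>\<^sup>+z. H (Y *v z) \<partial>lborel)"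
      unfolding kernel_mass_def p_def[symmetric]
    proof (rule nn_integral_cong)
      fix z :: "real^'n"
      have "(e \<bullet> (Y *v z))\<^sup>2 + \<kappa> * (norm (perp e (Y *v z)))\<^sup>2 = \<kappa> * (norm z)\<^sup>2"
        unfolding eY pY by (simp add: norm_perp_decomposition[OF e, of z] \<kappa>_def power_mult_distrib algebra_simps)
      then have "\<kappa> powr (p / 2) * ((e \<bullet> (Y *v z))\<^sup>2 + \<kappa> * (norm (perp e (Y *v z)))\<^sup>2) powr (- p / 2)
          = \<kappa> powr (p / 2) * (\<kappa> powr (- p / 2) * ((norm z)\<^sup>2) powr (- p / 2))"
        by (simp only: powr_mult)
      also have "\<dots> = (\<kappa> powr (p / 2) * \<kappa> powr (- p / 2)) * norm z powr (- p)"
        by (simp only: norm_powr_minus mult.assoc)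
      also have "\<kappa> powr (p / 2) * \<kappa> powr (- p / 2) = 1"
        using \<kappa> by (simp add: powr_add[symmetric])
      finally have "\<kappa> powr (p / 2) * ((e \<bullet> (Y *v z))\<^sup>2 + \<kappa> * (norm (perp e (Y *v z)))\<^sup>2) powr (- p / 2)
          = norm z powr (- p)" by (simp only: mult_1_left)
      then show "G (perp e z + (t * (e \<bullet> z)) *\<^sub>R e) * ennreal (norm z powr (- p)) = H (Y *v z)"
        by (simp only: H_def Y[symmetric])
    qed
    also have "\<dots> = K * (\<integral>\<^sup>+y. H y \<partial>lborel)"
      by (rule K(3)) (simp add: H_def)
    also have "(\<integral>\<^sup>+y. H y \<partial>lborel) = (\<integral>\<^sup>+y. ennreal (\<kappa> powr (p / 2))
        * (\<Sum>k. ennreal (d k) * (G y * ennreal (norm (perp e y) ^ (2 * k) * norm y powr (- p - 2 * real k)))) \<partial>lborel)"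
    proof (rule nn_integral_cong)
      fix y :: "real^'n"
      have "ennreal (((e \<bullet> y)\<^sup>2 + \<kappa> * (norm (perp e y))\<^sup>2) powr (- p / 2))
          = (\<Sum>k. ennreal (d k) * ennreal (norm (perp e y) ^ (2 * k) * norm y powr (- p - 2 * real k)))"
        by (rule sums_unique[OF series])
      then have "H y = ennreal (\<kappa> powr (p / 2)) * (G y
          * (\<Sum>k. ennreal (d k) * ennreal (norm (perp e y) ^ (2 * k) * norm y powr (- p - 2 * real k))))"
        by (simp only: H_def ennreal_mult'[OF powr_ge_zero] mult_ac)
      also have "G y * (\<Sum>k. ennreal (d k) * ennreal (norm (perp e y) ^ (2 * k) * norm y powr (- p - 2 * real k)))
          = (\<Sum>k. G y * (ennreal (d k) * ennreal (norm (perp e y) ^ (2 * k) * norm y powr (- p - 2 * real k))))"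
        by (rule ennreal_suminf_cmult[symmetric])
      finally show "H y = ennreal (\<kappa> powr (p / 2))
        * (\<Sum>k. ennreal (d k) * (G y * ennreal (norm (perp e y) ^ (2 * k) * norm y powr (- p - 2 * real k))))"
        by (simp only: mult.left_commute)
    qed
    also have "\<dots> = ennreal (\<kappa> powr (p / 2)) * (\<Sum>k. ennreal (d k) * zonal_mass s e k G)"
      unfolding zonal_mass_def p_def[symmetric]
      by (subst nn_integral_cmult) (simp_all add: nn_integral_suminf nn_integral_cmult)
    finally show "kernel_mass s (\<lambda>z. G (perp e z + (t * (e \<bullet> z)) *\<^sub>R e))
        = K * ennreal (\<kappa> powr (p / 2)) * (\<Sum>k. ennreal (d k) * zonal_mass s e k G)"
      by (simp only: mult.assoc)
  qed
qed

text \<open>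
  An inequality between nonnegative functions that holds for the isotropic integral on every hyperplane holds for
  every kernel that is a positive superposition of these.
\<close>

theorem kernel_mass_mono_from_hyperplanes:
  fixes e :: "real^'n"
  assumes n: "2 \<le> CARD('n)" and s: "0 < s" and e: "norm e = 1" and t: "0 < t" "t < 1"
    and G: "G \<in> borel_measurable borel" "G' \<in> borel_measurable borel"
    and le: "\<And>w. norm w = 1 \<Longrightarrow> kernel_mass s (\<lambda>y. G (perp w y)) \<le> kernel_mass s (\<lambda>y. G' (perp w y))"
  shows "kernel_mass s (\<lambda>z. G (perp e z + (t * (e \<bullet> z)) *\<^sub>R e))
    \<le> kernel_mass s (\<lambda>z. G' (perp e z + (t * (e \<bullet> z)) *\<^sub>R e))"
proof -
  obtain C a where C: "\<And>G. G \<in> borel_measurable borel \<Longrightarrow>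
    kernel_mass s (\<lambda>z. G (perp e z + (t * (e \<bullet> z)) *\<^sub>R e)) = C * (\<Sum>k. a k * zonal_mass s e k G)"
    using kernel_mass_zonal_series[OF e s t] by blast
  show ?thesis
    unfolding C[OF G(1)] C[OF G(2)]
    by (intro mult_left_mono suminf_le zonal_mass_mono[OF n s e G le] summableI) auto
qed

lemma kernel_integral_eq_kernel_mass: "kernel_integral s w = kernel_mass s (\<lambda>y. ennreal (w y))"
  unfolding kernel_integral_def kernel_mass_def
  by (intro nn_integral_cong) (simp only: powr_minus_divide ennreal_mult''[OF divide_nonneg_nonneg[OF zero_le_one powr_ge_zero], symmetric] times_divide_eq_right mult_1_right)

lemma kernel_mass_add_cmult:
  fixes G G' :: "real^'n \<Rightarrow> ennreal"
  assumes [measurable]: "G \<in> borel_measurable borel" "G' \<in> borel_measurable borel"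
  shows "kernel_mass s (\<lambda>y. G y + c * G' y) = kernel_mass s G + c * kernel_mass s G'"
  unfolding kernel_mass_def
  by (subst nn_integral_cmult[symmetric], simp, subst nn_integral_add[symmetric]) (simp_all add: distrib_right mult.assoc)

text \<open>
  The signed form: move the negative part of \<open>F\<close> to the other side and compare nonnegative functions.
\<close>

theorem kernel_integral_lower_bound_from_hyperplanes:
  fixes e :: "real^'n" and F W :: "real^'n \<Rightarrow> real"
  assumes n: "2 \<le> CARD('n)" and s: "0 < s" and e: "norm e = 1" and t: "0 < t" "t < 1"
    and [measurable]: "F \<in> borel_measurable borel" "W \<in> borel_measurable borel"
    and le: "\<And>w. norm w = 1 \<Longrightarrow> kernel_integral s (\<lambda>y. - F (perp w y)) + c * kernel_integral s (\<lambda>y. W (perp w y))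
      \<le> kernel_integral s (\<lambda>y. F (perp w y))"
  shows "kernel_integral s (\<lambda>z. - F (perp e z + (t * (e \<bullet> z)) *\<^sub>R e))
      + c * kernel_integral s (\<lambda>z. W (perp e z + (t * (e \<bullet> z)) *\<^sub>R e))
    \<le> kernel_integral s (\<lambda>z. F (perp e z + (t * (e \<bullet> z)) *\<^sub>R e))"
proof -
  have "kernel_mass s (\<lambda>z. ennreal (- F (perp e z + (t * (e \<bullet> z)) *\<^sub>R e)) + c * ennreal (W (perp e z + (t * (e \<bullet> z)) *\<^sub>R e)))
    \<le> kernel_mass s (\<lambda>z. ennreal (F (perp e z + (t * (e \<bullet> z)) *\<^sub>R e)))"
    by (rule kernel_mass_mono_from_hyperplanes[OF n s e t, where G="\<lambda>y. ennreal (- F y) + c * ennreal (W y)" and G'="\<lambda>y. ennreal (F y)"])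
       (use le in \<open>simp_all add: kernel_integral_eq_kernel_mass kernel_mass_add_cmult\<close>)
  then show ?thesis
    by (simp add: kernel_integral_eq_kernel_mass kernel_mass_add_cmult)
qed

section \<open>Rank-one compressions inside the cone over M2\<close>

text \<open>
  In dimension 2 the two eigenvalues are determined by the trace, and \<open>M\<close> has exactly the eigenvalues
  \<open>\<lambda>_min\<close> and \<open>tr M - \<lambda>_min\<close>; this excludes any deviation from the two-eigenvalue model.
\<close>

lemma lambda_min_eigenvector:
  fixes M :: "real^'n^'n"
  assumes n: "2 \<le> CARD('n)" and M: "M \<in> M2"
  obtains e where "norm e = 1" "M *v e = lambda_min M *\<^sub>R e" "0 < lambda_min M"
    "CARD('n) = 2 \<Longrightarrow> M \<bullet> M = (lambda_min M)\<^sup>2 + (trace M - lambda_min M)\<^sup>2"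
proof -
  have sym: "transpose M = M" using M M2_iff[OF n] by blast
  have "lambda_min M \<in> range (\<lambda>i. eigenvalues M $ i)"
    unfolding lambda_min_def by (rule Min_in) auto
  then obtain i where i: "lambda_min M = eigenvalues M $ i" by auto
  obtain e where e: "norm e = 1" "M *v e = (eigenvalues M $ i) *\<^sub>R e"
    using eigenvalue_has_eigenvector[OF sym] by metis
  have "0 < lambda_min M"
    using M2_direction_pos[OF n M e(1)] e i by (simp add: norm_eq_1)
  moreover have "M \<bullet> M = (lambda_min M)\<^sup>2 + (trace M - lambda_min M)\<^sup>2" if two: "CARD('n) = 2"
  proof -
    have "card (UNIV - {i}) = 1" using two by (simp add: card_Diff_singleton)
    then obtain j where j: "UNIV - {i} = {j}" by (rule card_1_singletonE)
    then have U: "UNIV = {i, j}" and ij: "i \<noteq> j" by auto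
    have "trace M = eigenvalues M $ i + eigenvalues M $ j"
      using sum_eigenvalues_eq_trace[OF sym] ij unfolding U by simp
    moreover have "M \<bullet> M = (eigenvalues M $ i)\<^sup>2 + (eigenvalues M $ j)\<^sup>2"
      using sum_eigenvalues_squared_eq_inner[OF sym] ij unfolding U by simp
    ultimately show ?thesis by (simp add: i)
  qed
  ultimately show ?thesis using that e i by metis
qed

lemma scaled_matrix_in_M2:
  fixes B :: "real^'n^'n"
  assumes n: "2 \<le> CARD('n)" and sym: "transpose B = B" and tr: "0 < trace B" and c: "0 < c"
    and Q: "c\<^sup>2 = 2 * ((trace B)\<^sup>2 / (real CARD('n) - 1) - B \<bullet> B)"
  shows "(1 / c) *\<^sub>R B \<in> M2"
proof -
  have "(trace ((1 / c) *\<^sub>R B))\<^sup>2 / (real CARD('n) - 1) - ((1 / c) *\<^sub>R B) \<bullet> ((1 / c) *\<^sub>R B)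
      = ((trace B)\<^sup>2 / (real CARD('n) - 1) - B \<bullet> B) / c\<^sup>2"
    by (simp add: trace_scaleR power_divide diff_divide_distrib power2_eq_square)
  also have "\<dots> = 1 / 2" using Q c by (simp add: field_simps)
  finally show ?thesis using c tr sym by (simp add: M2_iff[OF n] transpose_linear trace_scaleR)
qed

text \<open>
  \<open>X\<close> first shrinks the direction \<open>w\<close> by the factor \<open>k\<close> and then applies \<open>V\<close>.
\<close>

lemma compressed_square:
  fixes V :: "real^'n^'n" and k :: real
  assumes V: "transpose V = V" and w: "norm w = 1"
  defines "X \<equiv> V ** (mat 1 + (k - 1) *\<^sub>R outer w w)"
  shows "X *v z = V *v (perp w z + (k * (w \<bullet> z)) *\<^sub>R w)"
    and "X ** transpose X = V ** V - (1 - k\<^sup>2) *\<^sub>R outer (V *v w) (V *v w)"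
proof -
  have ww: "w \<bullet> w = 1" using w by (simp add: norm_eq_1)
  have C: "(mat 1 + (k - 1) *\<^sub>R outer w w) *v z = z + ((k - 1) * (w \<bullet> z)) *\<^sub>R w" for z
    by (simp add: matrix_vector_mult_add_rdistrib scaleR_matrix_vector_assoc[symmetric] outer_vector_mult)
  have XV: "X *v z = V *v (z + ((k - 1) * (w \<bullet> z)) *\<^sub>R w)" for z
    by (simp add: X_def matrix_vector_mul_assoc[symmetric] C)
  show "X *v z = V *v (perp w z + (k * (w \<bullet> z)) *\<^sub>R w)"
    by (simp add: XV perp_def algebra_simps)
  have XT: "transpose X *v z = V *v z + ((k - 1) * (w \<bullet> (V *v z))) *\<^sub>R w" for z
    by (simp add: X_def matrix_transpose_mul V transpose_linear transpose_outer C
        matrix_vector_mul_assoc[symmetric] del: vector_transpose_matrix)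
  show "X ** transpose X = V ** V - (1 - k\<^sup>2) *\<^sub>R outer (V *v w) (V *v w)"
  proof (rule matrix_eq[THEN iffD2], intro allI)
    fix z
    define a where "a = w \<bullet> (V *v z)"
    have "w \<bullet> (V *v z + ((k - 1) * a) *\<^sub>R w) = k * a"
      by (simp add: inner_add_right ww a_def algebra_simps)
    then have "(X ** transpose X) *v z = V *v (V *v z + ((k - 1) * a) *\<^sub>R w + ((k - 1) * (k * a)) *\<^sub>R w)"
      by (simp only: matrix_vector_mul_assoc[symmetric] XT XV a_def)
    also have "\<dots> = V *v (V *v z) + ((k\<^sup>2 - 1) * a) *\<^sub>R (V *v w)"
      by (simp add: matrix_vector_right_distrib matrix_vector_mult_scaleR power2_eq_square algebra_simps
          flip: scaleR_add_left)
    also have "\<dots> = (V ** V - (1 - k\<^sup>2) *\<^sub>R outer (V *v w) (V *v w)) *v z"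
      using symmetric_inner_swap[OF V, of w z]
      by (simp add: matrix_vector_mult_diff_rdistrib matrix_vector_mul_assoc scaleR_matrix_vector_assoc[symmetric]
          outer_vector_mult a_def algebra_simps)
    finally show "(X ** transpose X) *v z = (V ** V - (1 - k\<^sup>2) *\<^sub>R outer (V *v w) (V *v w)) *v z" .
  qed
qed

lemma norm_matrix_vector_le_frobenius:
  fixes A :: "real^'n^'n"
  assumes sym: "transpose A = A" and w: "norm w = 1"
  shows "(norm (A *v w))\<^sup>2 \<le> A \<bullet> A"
proof -
  have "(norm (A *v w))\<^sup>2 = A \<bullet> outer (A *v w) w"
    using symmetric_inner_swap[OF sym, of "A *v w" w] by (simp add: inner_outer power2_norm_eq_inner)
  also have "\<dots> \<le> norm A * norm (outer (A *v w) w)" by (rule norm_cauchy_schwarz)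
  also have "norm (outer (A *v w) w) = norm (A *v w)"
    using w by (simp add: norm_eq_sqrt_inner inner_outer outer_vector_mult)
  finally have "norm (A *v w) * norm (A *v w) \<le> norm A * norm (A *v w)" by (simp add: power2_eq_square)
  then have "norm (A *v w) \<le> norm A"
    by (metis mult_right_le_imp_le norm_ge_zero less_eq_real_def)
  then have "(norm (A *v w))\<^sup>2 \<le> (norm A)\<^sup>2" by (intro power_mono) auto
  then show ?thesis by (simp add: power2_norm_eq_inner)
qed

lemma trace_add: "trace (A + B) = trace A + trace (B :: real^'n^'n)"
  by (simp add: trace_def sum.distrib)

text \<open>
  The trace and the norm that decide whether the compressed matrix lies in the cone over \<open>M2\<close>.
\<close>

lemma rank_one_update_invariants:
  fixes V :: "real^'n^'n" and w :: "real^'n" and \<tau> :: real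
  assumes V: "transpose V = V" and D: "V ** V = mat h + \<Delta>" and \<Delta>: "trace \<Delta> = 0" and w: "norm w = 1"
  defines "B \<equiv> V ** V - \<tau> *\<^sub>R outer (V *v w) (V *v w)"
  shows "(norm (V *v w))\<^sup>2 = h + w \<bullet> (\<Delta> *v w)"
    and "trace B = real CARD('n) * h - \<tau> * (h + w \<bullet> (\<Delta> *v w))"
    and "B \<bullet> B = real CARD('n) * h\<^sup>2 + \<Delta> \<bullet> \<Delta>
      - 2 * \<tau> * (h\<^sup>2 + 2 * h * (w \<bullet> (\<Delta> *v w)) + (norm (\<Delta> *v w))\<^sup>2) + \<tau>\<^sup>2 * (h + w \<bullet> (\<Delta> *v w))\<^sup>2"
    and "transpose B = B"
proof -
  have ww: "w \<bullet> w = 1" using w by (simp add: norm_eq_1)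
  have Dv: "V *v (V *v z) = h *\<^sub>R z + \<Delta> *v z" for z
    by (simp add: matrix_vector_mul_assoc D matrix_vector_mult_add_rdistrib mat_vector_mult)
  have vv: "(V *v w) \<bullet> (V *v w) = h + w \<bullet> (\<Delta> *v w)"
    using symmetric_inner_swap[OF V, of w "V *v w"] by (simp add: Dv inner_add_right ww)
  then show "(norm (V *v w))\<^sup>2 = h + w \<bullet> (\<Delta> *v w)" by (simp add: power2_norm_eq_inner)
  show "trace B = real CARD('n) * h - \<tau> * (h + w \<bullet> (\<Delta> *v w))"
    by (simp add: B_def trace_sub trace_scaleR trace_outer vv D trace_add \<Delta> trace_mat)
  have oo: "outer (V *v w) (V *v w) \<bullet> outer (V *v w) (V *v w) = (h + w \<bullet> (\<Delta> *v w))\<^sup>2"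
    by (simp add: inner_outer outer_vector_mult vv power2_eq_square)
  have "(V *v w) \<bullet> (V *v (V *v (V *v w))) = (V *v (V *v w)) \<bullet> (V *v (V *v w))"
    using symmetric_inner_swap[OF V, of "V *v w" "V *v (V *v w)"] by simp
  also have "\<dots> = h\<^sup>2 + 2 * h * (w \<bullet> (\<Delta> *v w)) + (norm (\<Delta> *v w))\<^sup>2"
    unfolding power2_norm_eq_inner power2_eq_square[of h]
    by (simp add: Dv inner_add_left inner_add_right ww inner_commute)
  finally have Do: "(V ** V) \<bullet> outer (V *v w) (V *v w) = h\<^sup>2 + 2 * h * (w \<bullet> (\<Delta> *v w)) + (norm (\<Delta> *v w))\<^sup>2"
    by (simp add: inner_outer matrix_vector_mul_assoc[symmetric])
  have DD: "(V ** V) \<bullet> (V ** V) = real CARD('n) * h\<^sup>2 + \<Delta> \<bullet> \<Delta>"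
    unfolding D
    by (simp add: inner_add_left inner_add_right inner_mat_eq_trace trace_mat \<Delta> inner_commute[of \<Delta> "mat h"] power2_eq_square)
  have "B \<bullet> B = (V ** V) \<bullet> (V ** V) - 2 * \<tau> * ((V ** V) \<bullet> outer (V *v w) (V *v w))
      + \<tau>\<^sup>2 * (outer (V *v w) (V *v w) \<bullet> outer (V *v w) (V *v w))"
    by (simp add: B_def inner_diff_left inner_diff_right inner_commute[of "outer _ _" "V ** V"] power2_eq_square algebra_simps)
  then show "B \<bullet> B = real CARD('n) * h\<^sup>2 + \<Delta> \<bullet> \<Delta>
      - 2 * \<tau> * (h\<^sup>2 + 2 * h * (w \<bullet> (\<Delta> *v w)) + (norm (\<Delta> *v w))\<^sup>2) + \<tau>\<^sup>2 * (h + w \<bullet> (\<Delta> *v w))\<^sup>2"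
    by (simp only: DD Do oo)
  show "transpose B = B"
    by (simp add: B_def transpose_linear transpose_outer matrix_transpose_mul V)
qed

text \<open>
  The quantity bounded below is \<open>(tr B)^2/(n-1) - |B|^2\<close>, divided by \<open>h^2\<close>, for the compressed matrix \<open>B\<close>: here
  \<open>q = w.\<Delta>w/h\<close>, \<open>S = |\<Delta>w|^2/h^2\<close> and \<open>d = |\<Delta>|^2/h^2\<close> measure the deviation of \<open>V^2\<close> from \<open>h I\<close>. Without deviation it
  equals \<open>\<kappa>(2-b)\<close> with \<open>b = \<kappa>(N-2)/(N-1) \<le> 1\<close>. The terms linear in \<open>q\<close> carry a factor \<open>\<kappa>\<close>, so the loss is relative and does
  not grow with the dimension; the quadratic ones are at most \<open>3d\<close>. In total at least half survives.
\<close>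

lemma cone_estimate:
  fixes N \<kappa> q S d \<epsilon> :: real
  assumes N: "N = 2 \<and> d = 0 \<or> 3 \<le> N" and \<kappa>: "0 < \<kappa>" "\<kappa> * (N - 2) \<le> N - 1"
    and q: "q\<^sup>2 \<le> S" "S \<le> d" "d \<le> 2 * \<epsilon>\<^sup>2" and \<epsilon>: "45 * \<epsilon>\<^sup>2 \<le> \<kappa>" "135 * \<epsilon>\<^sup>2 \<le> 1"
  shows "\<bar>q\<bar> \<le> 1 / 8"
    and "(2 * \<kappa> - \<kappa>\<^sup>2 * (N - 2) / (N - 1)) / 2
      \<le> (N - (1 - \<kappa>) * (1 + q))\<^sup>2 / (N - 1)
        - (N + d - 2 * (1 - \<kappa>) * (1 + 2 * q + S) + (1 - \<kappa>)\<^sup>2 * (1 + q)\<^sup>2)"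
proof -
  \<comment> \<open>the final linear arithmetic: \<open>21/32 - 2/15 \<ge> 1/2\<close>\<close>
  have combine: "Z / 2 \<le> T" if "T = a1 + a2 + a3 - d" "A * (21 / 32) \<le> a1" "3 * d \<le> A * (2 / 15)"
    "0 \<le> a2" "0 \<le> A" "Z = A" "- (2 * d) \<le> a3" for T a1 a2 a3 A Z :: real
    using that by linarith
  have N1: "1 \<le> N - 1" using N by auto
  have "q\<^sup>2 \<le> (1 / 8)\<^sup>2" using q \<epsilon> by (simp add: power2_eq_square)
  then show q8: "\<bar>q\<bar> \<le> 1 / 8" by (metis abs_le_square_iff abs_of_nonneg zero_le_divide_1_iff zero_le_numeral)
  define c where "c = 1 / (N - 1)"
  define b where "b = \<kappa> * (N - 2) / (N - 1)"
  have c: "0 < c" using N1 by (simp add: c_def)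
  have b01: "0 \<le> b" "b \<le> 1" using \<kappa> N N1 by (auto simp: b_def divide_le_eq_1)
  have bc2: "b + 2 * c \<le> 2"
  proof (cases "N = 2")
    case True then show ?thesis by (simp add: b_def c_def)
  next
    case False
    then have "c \<le> 1 / 2" using N by (auto simp: c_def divide_le_eq)
    then show ?thesis using b01 by simp
  qed
  have \<kappa>2: "- (2 * d) \<le> 2 * (1 - \<kappa>) * (S - q\<^sup>2)"
  proof (cases "d = 0")
    case True
    then have "S = q\<^sup>2" using q zero_le_power2[of q] by linarith
    then show ?thesis using True by simp
  next
    case False
    then have N3: "3 \<le> N" using N by auto
    have "N - 1 \<le> 2 * (N - 2)" using N3 by simp
    with \<kappa>(2) have "\<kappa> * (N - 2) \<le> 2 * (N - 2)" by (rule order_trans)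
    moreover have "0 < N - 2" using N3 by simp
    ultimately have "\<kappa> \<le> 2" by (simp only: mult_le_cancel_right_pos)
    define Y where "Y = (1 - \<kappa>) * (S - q\<^sup>2)"
    have "(- 1) * (S - q\<^sup>2) \<le> Y"
      unfolding Y_def using q \<open>\<kappa> \<le> 2\<close> by (intro mult_right_mono) auto
    then have "q\<^sup>2 - S \<le> Y" by simp
    then have "- (2 * d) \<le> 2 * Y" using q zero_le_power2[of q] by linarith
    then show ?thesis by (simp only: Y_def mult.assoc)
  qed
  have b: "\<kappa> * b = \<kappa>\<^sup>2 * (N - 2) / (N - 1)" by (simp add: b_def power2_eq_square)
  have kbc: "\<kappa>\<^sup>2 * c = \<kappa>\<^sup>2 - \<kappa> * b"
  proof -
    have "(N - 2) / (N - 1) = 1 - c" using N1 by (simp add: c_def field_simps)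
    then have "b = \<kappa> * (1 - c)" by (simp add: b_def flip: times_divide_eq_right)
    then have "\<kappa> * b = \<kappa>\<^sup>2 * (1 - c)" by (simp add: power2_eq_square)
    then show ?thesis by (simp add: right_diff_distrib)
  qed
  have sq: "(N - (1 - \<kappa>) * (1 + q))\<^sup>2 / (N - 1) = (N - 1) + 2 * (\<kappa> * (1 + q) - q) + c * (\<kappa> * (1 + q) - q)\<^sup>2"
  proof -
    define K where "K = N - 1"
    have K: "K \<noteq> 0" using N1 by (simp add: K_def)
    have "N - (1 - \<kappa>) * (1 + q) = K + (\<kappa> * (1 + q) - q)" by (simp add: K_def algebra_simps)
    then show ?thesis using K by (simp add: power2_sum c_def flip: K_def) (simp add: field_simps power2_eq_square)
  qed
  have "(N - (1 - \<kappa>) * (1 + q))\<^sup>2 / (N - 1)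
        - (N + d - 2 * (1 - \<kappa>) * (1 + 2 * q + S) + (1 - \<kappa>)\<^sup>2 * (1 + q)\<^sup>2)
      = \<kappa> * (1 + q) * (2 - b * (1 + q) - 2 * (q * c)) + (1 + c) * q\<^sup>2 + 2 * (1 - \<kappa>) * (S - q\<^sup>2) - d"
  proof -
    have "c * (\<kappa> * (1 + q) - q)\<^sup>2 = (\<kappa>\<^sup>2 * c) * (1 + q)\<^sup>2 - 2 * c * \<kappa> * (1 + q) * q + c * q\<^sup>2"
      by (simp add: power2_eq_square algebra_simps)
    then have "c * (\<kappa> * (1 + q) - q)\<^sup>2 = (\<kappa>\<^sup>2 - \<kappa> * b) * (1 + q)\<^sup>2 - 2 * c * \<kappa> * (1 + q) * q + c * q\<^sup>2"
      by (simp only: kbc)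
    then show ?thesis unfolding sq by (simp add: power2_eq_square algebra_simps)
  qed
  moreover have "\<kappa> * (2 - b) * (21 / 32) \<le> \<kappa> * (1 + q) * (2 - b * (1 + q) - 2 * (q * c))"
  proof -
    have "q * (b + 2 * c) \<le> 1 / 8 * 2"
    proof -
      have "q * (b + 2 * c) \<le> \<bar>q\<bar> * (b + 2 * c)" using b01 c by (intro mult_right_mono) auto
      also have "\<dots> \<le> 1 / 8 * 2" using q8 bc2 b01 c by (intro mult_mono) auto
      finally show ?thesis .
    qed
    moreover define Y where "Y = q * (b + 2 * c)"
    ultimately have "Y \<le> 1 / 4" by simp
    moreover have "2 - b * (1 + q) - 2 * (q * c) = 2 - b - Y" by (simp add: Y_def algebra_simps)
    ultimately have 1: "(2 - b) * (3 / 4) \<le> 2 - b * (1 + q) - 2 * (q * c)"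
      using b01 by simp
    have 2: "7 / 8 \<le> 1 + q" using q8 by linarith
    have "7 / 8 * ((2 - b) * (3 / 4)) \<le> (1 + q) * (2 - b * (1 + q) - 2 * (q * c))"
      using 1 2 b01 by (intro mult_mono) auto
    from mult_left_mono[OF this, of \<kappa>] show ?thesis using \<kappa> by (simp add: mult.assoc algebra_simps)
  qed
  moreover have "3 * d \<le> \<kappa> * (2 - b) * (2 / 15)"
  proof -
    have "3 * d \<le> \<kappa> * 1 * (2 / 15)" using q \<epsilon> by simp
    also have "\<dots> \<le> \<kappa> * (2 - b) * (2 / 15)" using \<kappa> b01 by (intro mult_right_mono mult_left_mono) auto
    finally show ?thesis .
  qed
  moreover have "0 \<le> (1 + c) * q\<^sup>2" using c by simp
  moreover have "0 \<le> \<kappa> * (2 - b)" using \<kappa> b01 by simp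
  moreover have "2 * \<kappa> - \<kappa>\<^sup>2 * (N - 2) / (N - 1) = \<kappa> * (2 - b)" using b by (simp add: algebra_simps)
  ultimately show "(2 * \<kappa> - \<kappa>\<^sup>2 * (N - 2) / (N - 1)) / 2
      \<le> (N - (1 - \<kappa>) * (1 + q))\<^sup>2 / (N - 1)
        - (N + d - 2 * (1 - \<kappa>) * (1 + 2 * q + S) + (1 - \<kappa>)\<^sup>2 * (1 + q)\<^sup>2)"
    using \<kappa>2 by (rule combine)
qed

text \<open>
  If \<open>e\<close> is an eigenvalue of an element of \<open>M2\<close>, this is the least possible mean of the others, attained when they are equal. It
  equals \<open>g(e)^(-2)\<close>.
\<close>

definition companion :: "real \<Rightarrow> real \<Rightarrow> real" where
  "companion N e = 1 / (4 * e) + (N - 2) / (2 * (N - 1)) * e"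

text \<open>
  The last identity says that a matrix with eigenvalues \<open>e\<close> once and \<open>companion N e\<close> otherwise lies on the quadric.
\<close>

lemma companion_facts:
  assumes N: "2 \<le> N" and e: "0 < e"
  shows "0 < companion N e" "4 * e * companion N e = 1 + 2 * (N - 2) / (N - 1) * e\<^sup>2"
    "2 * (e / companion N e) - (e / companion N e)\<^sup>2 * (N - 2) / (N - 1) = 1 / (2 * (companion N e)\<^sup>2)"
proof -
  define a where "a = (N - 2) / (N - 1)"
  have a: "0 \<le> a" using N by (simp add: a_def)
  have c: "companion N e = 1 / (4 * e) + a / 2 * e" by (simp add: companion_def a_def)
  show pos: "0 < companion N e" unfolding c using e a by (simp add: add_pos_nonneg)
  have eq: "4 * e * companion N e = 1 + 2 * a * e\<^sup>2"
    unfolding c using e by (simp add: distrib_left power2_eq_square)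
  then show "4 * e * companion N e = 1 + 2 * (N - 2) / (N - 1) * e\<^sup>2" by (simp add: a_def)
  define h where "h = companion N e"
  have h: "0 < h" using pos by (simp add: h_def)
  have "2 * (e / h) - (e / h)\<^sup>2 * a = (2 * (e * h) - e\<^sup>2 * a) / h\<^sup>2"
    using h by (simp add: field_simps power2_eq_square)
  also have "2 * (e * h) - e\<^sup>2 * a = 1 / 2" using eq unfolding h_def by (simp add: algebra_simps)
  finally show "2 * (e / companion N e) - (e / companion N e)\<^sup>2 * (N - 2) / (N - 1) = 1 / (2 * (companion N e)\<^sup>2)"
    by (simp add: h_def a_def)
qed

text \<open>
  If \<open>e1\<close> lies beyond the minimum of the companion function, both eigenvalues would be large and the matrix close to the boundary of the
  cone. Then the minimizer is the better choice: it is smaller than \<open>e1\<close> and its companion is not larger.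
\<close>

lemma companion_optimal:
  assumes N: "2 \<le> N" and e: "0 < e1"
  obtains e where "0 < e" "e \<le> e1" "companion N e \<le> companion N e1"
    "e / companion N e * (N - 2) \<le> N - 1" "min 1 (e1 / companion N e1) \<le> e / companion N e"
proof (cases "2 * (N - 2) * e1\<^sup>2 \<le> N - 1")
  case True
  have "e1 / companion N e1 * (N - 2) \<le> N - 1"
  proof -
    have "e1 * (N - 2) \<le> (N - 1) * companion N e1"
    proof -
      have "(N - 1) * companion N e1 = (N - 1) / (4 * e1) + (N - 2) * e1 / 2"
      proof -
        define K where "K = N - 1"
        have "N = K + 1" "K \<noteq> 0" using N by (simp_all add: K_def)
        then show ?thesis by (simp add: companion_def distrib_left)
      qed
      moreover have "(N - 2) * e1 / 2 \<le> (N - 1) / (4 * e1)"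
        using True e by (simp add: field_simps power2_eq_square)
      moreover have "e1 * (N - 2) = (N - 2) * e1 / 2 + (N - 2) * e1 / 2" by simp
      ultimately show ?thesis by linarith
    qed
    then show ?thesis using companion_facts(1)[OF N e] by (simp add: field_simps)
  qed
  then show ?thesis using that[of e1] e by simp
next
  case False
  then have N2: "2 < N" using N by (cases "N = 2") auto
  define e where "e = sqrt ((N - 1) / (2 * (N - 2)))"
  have e2: "e\<^sup>2 = (N - 1) / (2 * (N - 2))" and e0: "0 < e" using N2 by (simp_all add: e_def)
  have "e\<^sup>2 \<le> e1\<^sup>2" 
  proof -
    have "N - 1 \<le> e1\<^sup>2 * (2 * (N - 2))" using False by (simp add: mult_ac)
    then show ?thesis unfolding e2 using N2 by (subst pos_divide_le_eq) auto
  qed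
  then have ee1: "e \<le> e1" by (rule power2_le_imp_le) (use \<open>0 < e1\<close> in simp)
  define a where "a = (N - 2) / (2 * (N - 1))"
  have a: "0 < a" using N2 by (simp add: a_def)
  have inv: "1 / (4 * x) = a * (e\<^sup>2 / x)" for x
  proof -
    define K L where "K = N - 1" and "L = N - 2"
    have "K \<noteq> 0" "L \<noteq> 0" using N2 by (simp_all add: K_def L_def)
    then have ae: "a * e\<^sup>2 = 1 / 4" unfolding e2 a_def K_def[symmetric] L_def[symmetric] by simp
    show ?thesis by (simp only: times_divide_eq_right ae divide_divide_eq_left)
  qed
  have cx: "companion N x = a * (e\<^sup>2 / x) + a * x" for x
    unfolding companion_def inv a_def[symmetric] by (rule refl)
  have ce: "companion N e = 2 * a * e"
    unfolding cx using e0 by (simp add: power2_eq_square)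
  have "companion N e \<le> companion N e1"
  proof -
    have "2 * e \<le> e\<^sup>2 / e1 + e1"
    proof -
      have "e\<^sup>2 / e1 + e1 - 2 * e = (e - e1)\<^sup>2 / e1"
        using \<open>0 < e1\<close> by (simp add: power2_diff add_divide_distrib diff_divide_distrib) (simp add: power2_eq_square)
      moreover have "0 \<le> (e - e1)\<^sup>2 / e1" using \<open>0 < e1\<close> by simp
      ultimately show ?thesis by linarith
    qed
    from mult_left_mono[OF this less_imp_le[OF a]] show ?thesis
      unfolding ce cx[of e1] by (simp add: distrib_left mult.left_commute mult.commute)
  qed
  moreover have \<kappa>: "e / companion N e = (N - 1) / (N - 2)"
  proof -
    have "e / companion N e = 1 / (2 * a)" unfolding ce using e0 a by simp
    moreover define K L where "K = N - 1" and "L = N - 2"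
    have "1 / (2 * a) = K / L" unfolding a_def K_def[symmetric] L_def[symmetric] by simp
    ultimately show ?thesis by (simp only: K_def L_def)
  qed
  moreover have "e / companion N e * (N - 2) \<le> N - 1" unfolding \<kappa> using N2 by simp
  moreover have "min 1 (e1 / companion N e1) \<le> e / companion N e" 
  proof -
    have "1 \<le> (N - 1) / (N - 2)" using N2 by (simp add: pos_le_divide_eq)
    then show ?thesis unfolding \<kappa> by (rule min.coboundedI1)
  qed
  ultimately show ?thesis using that[of e] e0 ee1 by simp
qed

section \<open>Special and almost degenerate elements of M2\<close>

lemma isotropic_in_M2:
  assumes n: "2 \<le> CARD('n)"
  shows "(mat (sqrt ((real CARD('n) - 1) / (2 * real CARD('n)))) :: real^'n^'n) \<in> M2" (is "mat ?\<gamma> \<in> M2")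
proof -
  define N where "N = real CARD('n)"
  have N: "2 \<le> N" using n by (simp add: N_def)
  have g: "0 < ?\<gamma>" "?\<gamma>\<^sup>2 = (N - 1) / (2 * N)" using N by (simp_all add: N_def)
  have "(N * ?\<gamma>)\<^sup>2 / (N - 1) - N * ?\<gamma>\<^sup>2 = ?\<gamma>\<^sup>2 * (N / (N - 1))"
    using N by (simp add: power_mult_distrib field_simps power2_eq_square)
  also have "\<dots> = 1 / 2" unfolding g(2) using N by simp
  finally have "(N * ?\<gamma>)\<^sup>2 / (N - 1) - N * ?\<gamma>\<^sup>2 = 1 / 2" .
  moreover have "(mat ?\<gamma> :: real^'n^'n) \<bullet> mat ?\<gamma> = N * ?\<gamma>\<^sup>2"
    by (simp only: inner_mat_eq_trace trace_mat N_def power2_eq_square mult_ac)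
  moreover have "trace (mat ?\<gamma> :: real^'n^'n) = N * ?\<gamma>" by (simp only: trace_mat N_def)
  moreover have "transpose (mat ?\<gamma> :: real^'n^'n) = mat ?\<gamma>" by (simp add: transpose_mat)
  moreover have "0 < N * ?\<gamma>" using N g(1) by simp
  ultimately show ?thesis unfolding M2_iff[OF n] N_def[symmetric] by simp
qed

lemma lambda_min_mat: "lambda_min (mat c :: real^'n^'n) = c"
proof -
  have "eigenvalues (mat c :: real^'n^'n) $ i = c" for i
  proof -
    have sym: "transpose (mat c :: real^'n^'n) = mat c" by (simp add: transpose_mat)
    obtain v where v: "norm v = 1" "(mat c :: real^'n^'n) *v v = (eigenvalues (mat c :: real^'n^'n) $ i) *\<^sub>R v"
      using eigenvalue_has_eigenvector[OF sym] by metis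
    then have "(c - eigenvalues (mat c :: real^'n^'n) $ i) *\<^sub>R v = 0"
      by (simp add: mat_vector_mult algebra_simps)
    then show ?thesis using v(1) by auto
  qed
  then show ?thesis by (simp add: lambda_min_def image_constant_conv)
qed

text \<open>
  The extremal matrices for a given smallest eigenvalue.
\<close>

lemma two_eigenvalue_matrix_in_M2:
  fixes e :: "real^'n"
  assumes n: "2 \<le> CARD('n)" and e: "norm e = 1" and \<epsilon>: "0 < \<epsilon>"
  defines "h \<equiv> companion CARD('n) \<epsilon>"
  shows "mat h + (\<epsilon> - h) *\<^sub>R outer e e \<in> M2"
proof -
  define N where "N = real CARD('n)"
  have N: "2 \<le> N" using n by (simp add: N_def)
  have ee: "e \<bullet> e = 1" using e by (simp add: norm_eq_1)
  define M where "M = mat h + (\<epsilon> - h) *\<^sub>R outer e e"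
  have h: "0 < h" "4 * \<epsilon> * h = 1 + 2 * (N - 2) / (N - 1) * \<epsilon>\<^sup>2"
    using companion_facts(1,2)[OF N \<epsilon>] by (simp_all add: h_def N_def)
  have tr: "trace M = (N - 1) * h + \<epsilon>"
    unfolding M_def trace_add trace_mat trace_scaleR trace_outer ee by (simp add: N_def algebra_simps)
  have MM: "M \<bullet> M = (N - 1) * h\<^sup>2 + \<epsilon>\<^sup>2"
  proof -
    define E where "E = outer e e"
    have EE: "E \<bullet> E = 1" "mat h \<bullet> E = h" "mat h \<bullet> (mat h :: real^'n^'n) = N * h\<^sup>2"
      by (simp_all add: E_def inner_outer outer_vector_mult ee mat_vector_mult inner_mat_eq_trace trace_mat N_def power2_eq_square)
    have "M \<bullet> M = mat h \<bullet> (mat h :: real^'n^'n) + 2 * (\<epsilon> - h) * (mat h \<bullet> E) + (\<epsilon> - h)\<^sup>2 * (E \<bullet> E)"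
      unfolding M_def E_def[symmetric]
      by (simp only: inner_add_left inner_add_right inner_scaleR_left inner_scaleR_right inner_commute[of E "mat h"])
         (simp add: power2_eq_square algebra_simps)
    then show ?thesis unfolding EE by (simp add: power2_eq_square algebra_simps)
  qed
  define K where "K = N - 1"
  have K: "0 < K" "N = K + 1" using N by (simp_all add: K_def)
  have "(K * h + \<epsilon>)\<^sup>2 / K = K * h\<^sup>2 + 2 * \<epsilon> * h + \<epsilon>\<^sup>2 / K"
    using K by (simp add: power2_eq_square field_simps)
  then have "(trace M)\<^sup>2 / (N - 1) - M \<bullet> M = 2 * \<epsilon> * h + \<epsilon>\<^sup>2 / K - \<epsilon>\<^sup>2"
    unfolding tr MM K_def[symmetric] by simp
  also have "\<dots> = 1 / 2"
  proof -
    define W where "W = (N - 2) / (N - 1) * \<epsilon>\<^sup>2"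
    have "(N - 2) / (N - 1) = 1 - 1 / K" using K by (simp add: field_simps)
    then have "\<epsilon>\<^sup>2 / K - \<epsilon>\<^sup>2 = - W" unfolding W_def by (simp add: left_diff_distrib)
    moreover have "4 * \<epsilon> * h = 1 + 2 * W" using h(2) by (simp add: W_def)
    ultimately show ?thesis by linarith
  qed
  finally have "(trace M)\<^sup>2 / (N - 1) - M \<bullet> M = 1 / 2" .
  moreover have "0 < trace M" unfolding tr using K h(1) \<epsilon> by (simp add: K_def[symmetric] add_pos_pos)
  moreover have "transpose M = M" by (simp add: M_def transpose_linear transpose_outer transpose_mat)
  ultimately show ?thesis unfolding M2_iff[OF n] by (simp add: M_def N_def)
qed

text \<open>
  Subtracting from \<open>M\<close> its two-eigenvalue model, with the mean \<open>h\<close> of the other eigenvalues, leaves a traceless \<open>\<Delta>\<close> that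
  vanishes on \<open>e\<close>. The quadric gives \<open>|\<Delta>|^2 \<le> 2\<epsilon>h - 1/2\<close>, which is at least 0 and, by completing the square, at most \<open>2\<epsilon>^2h^2\<close>.
\<close>

lemma M2_deviation:
  fixes M :: "real^'n^'n"
  assumes n: "2 \<le> CARD('n)" and M: "M \<in> M2" and e: "norm e = 1" and Me: "M *v e = \<epsilon> *\<^sub>R e" and \<epsilon>: "0 < \<epsilon>"
  defines "h \<equiv> (trace M - \<epsilon>) / (real CARD('n) - 1)"
  defines "\<Delta> \<equiv> M + (h - \<epsilon>) *\<^sub>R outer e e - mat h"
  shows "1 \<le> 4 * \<epsilon> * h" "0 < h" "trace \<Delta> = 0" "transpose \<Delta> = \<Delta>"
    "\<Delta> \<bullet> \<Delta> = M \<bullet> M - \<epsilon>\<^sup>2 - (real CARD('n) - 1) * h\<^sup>2" "\<Delta> \<bullet> \<Delta> \<le> 2 * \<epsilon>\<^sup>2 * h\<^sup>2"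
proof -
  define N where "N = real CARD('n)"
  define K where "K = N - 1"
  have K: "1 \<le> K" "N = K + 1" using n by (simp_all add: K_def N_def)
  have ee: "e \<bullet> e = 1" using e by (simp add: norm_eq_1)
  have sym: "transpose M = M" and t: "0 < trace M" and Q: "(trace M)\<^sup>2 / K - M \<bullet> M = 1 / 2"
    using M M2_iff[OF n, of M] by (simp_all add: K_def N_def)
  have trM: "trace M = \<epsilon> + K * h" using K by (simp add: h_def K_def N_def)
  show tr\<Delta>: "trace \<Delta> = 0"
    by (simp add: \<Delta>_def trace_add trace_sub trace_scaleR trace_outer ee trace_mat trM K_def N_def algebra_simps)
  show "transpose \<Delta> = \<Delta>" by (simp add: \<Delta>_def transpose_linear transpose_outer transpose_mat sym)
  define E where "E = outer e e"
  have EE: "E \<bullet> E = 1" "M \<bullet> E = \<epsilon>" "mat h \<bullet> E = h" "mat h \<bullet> M = h * trace M" "mat h \<bullet> (mat h :: real^'n^'n) = N * h\<^sup>2"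
    by (simp_all add: E_def inner_outer outer_vector_mult Me ee mat_vector_mult inner_mat_eq_trace trace_mat N_def power2_eq_square)
  have "\<Delta> \<bullet> \<Delta> = M \<bullet> M + (h - \<epsilon>)\<^sup>2 * (E \<bullet> E) + mat h \<bullet> (mat h :: real^'n^'n) + 2 * (h - \<epsilon>) * (M \<bullet> E)
      - 2 * (mat h \<bullet> M) - 2 * (h - \<epsilon>) * (mat h \<bullet> E)"
    unfolding \<Delta>_def E_def[symmetric]
    by (simp add: inner_add_left inner_add_right inner_diff_left inner_diff_right
        inner_commute[of E M] inner_commute[of E "mat h"] inner_commute[of M "mat h"]
        power2_eq_square algebra_simps)
  also have "\<dots> = M \<bullet> M - \<epsilon>\<^sup>2 - K * h\<^sup>2"
    unfolding EE trM K(2) by (simp add: power2_eq_square algebra_simps)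
  finally have \<Delta>\<Delta>: "\<Delta> \<bullet> \<Delta> = M \<bullet> M - \<epsilon>\<^sup>2 - K * h\<^sup>2" .
  then show "\<Delta> \<bullet> \<Delta> = M \<bullet> M - \<epsilon>\<^sup>2 - (real CARD('n) - 1) * h\<^sup>2" by (simp add: K_def N_def)
  have "(\<epsilon> + K * h)\<^sup>2 / K = \<epsilon>\<^sup>2 / K + 2 * \<epsilon> * h + K * h\<^sup>2"
    using K(1) by (simp add: power2_eq_square field_simps)
  then have \<Delta>2: "\<Delta> \<bullet> \<Delta> = \<epsilon>\<^sup>2 / K - \<epsilon>\<^sup>2 + 2 * \<epsilon> * h - 1 / 2" using \<Delta>\<Delta> Q unfolding trM by linarith
  have "\<epsilon>\<^sup>2 / K \<le> \<epsilon>\<^sup>2" using K(1) by (simp add: divide_le_eq mult_le_cancel_left1)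
  then have \<Delta>3: "\<Delta> \<bullet> \<Delta> \<le> 2 * \<epsilon> * h - 1 / 2" using \<Delta>2 by linarith
  then show "1 \<le> 4 * \<epsilon> * h" using inner_ge_zero[of \<Delta>] by linarith
  then have "0 < \<epsilon> * h" by simp
  then show "0 < h" using \<epsilon> by (simp add: zero_less_mult_iff)
  have "0 \<le> (2 * \<epsilon> * h - 1)\<^sup>2 / 2" by simp
  also have "(2 * \<epsilon> * h - 1)\<^sup>2 / 2 = 2 * \<epsilon>\<^sup>2 * h\<^sup>2 - 2 * \<epsilon> * h + 1 / 2"
    by (simp add: power2_eq_square field_simps)
  finally show "\<Delta> \<bullet> \<Delta> \<le> 2 * \<epsilon>\<^sup>2 * h\<^sup>2" using \<Delta>3 by linarith
qed

text \<open>
  Enlarging the small eigenvalue of the square root to \<open>sqrt h\<close> makes \<open>V^2\<close> close to \<open>h I\<close>, and the square root itself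
  is recovered by first shrinking the direction \<open>e\<close>.
\<close>

lemma stretched_sqrt:
  fixes M :: "real^'n^'n"
  assumes n: "2 \<le> CARD('n)" and M: "M \<in> M2" and e: "norm e = 1" and Me: "M *v e = \<epsilon> *\<^sub>R e"
    and \<epsilon>: "0 < \<epsilon>" and h: "0 < h"
  defines "V \<equiv> matrix_sqrt M + (sqrt h - sqrt \<epsilon>) *\<^sub>R outer e e"
  shows "transpose V = V" "V ** V = M + (h - \<epsilon>) *\<^sub>R outer e e"
    "V *v (perp e z + (sqrt (\<epsilon> / h) * (e \<bullet> z)) *\<^sub>R e) = matrix_sqrt M *v z"
proof -
  define S where "S = matrix_sqrt M"
  have S: "transpose S = S" "S ** S = M" "\<And>v. v \<noteq> 0 \<Longrightarrow> 0 < v \<bullet> (S *v v)"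
    using M2_sqrt[OF n M] by (simp_all add: S_def)
  have psd: "0 \<le> v \<bullet> (S *v v)" for v using S(3)[of v] by (cases "v = 0") auto
  have Se: "S *v e = sqrt \<epsilon> *\<^sub>R e" by (rule psd_sqrt_eigenvector[OF psd S(2) Me \<epsilon>])
  have ee: "e \<bullet> e = 1" using e by (simp add: norm_eq_1)
  define a where "a = sqrt h - sqrt \<epsilon>"
  have V: "V *v z = S *v z + (a * (e \<bullet> z)) *\<^sub>R e" for z
    by (simp add: V_def S_def a_def matrix_vector_mult_add_rdistrib scaleR_matrix_vector_assoc[symmetric] outer_vector_mult)
  show "transpose V = V" by (simp add: V_def transpose_linear transpose_outer S(1)[unfolded S_def])
  have a2: "a * (2 * sqrt \<epsilon> + a) = h - \<epsilon>"
    using h \<epsilon> by (simp add: a_def algebra_simps)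
  show "V ** V = M + (h - \<epsilon>) *\<^sub>R outer e e"
  proof (rule matrix_eq[THEN iffD2], intro allI)
    fix z
    have eSz: "e \<bullet> (S *v z) = sqrt \<epsilon> * (e \<bullet> z)"
      using symmetric_inner_swap[OF S(1), of e z] by (simp add: Se)
    have "(V ** V) *v z = V *v (V *v z)" by (simp add: matrix_vector_mul_assoc)
    also have "\<dots> = S *v (S *v z) + (a * (e \<bullet> z)) *\<^sub>R (S *v e) + (a * (sqrt \<epsilon> * (e \<bullet> z) + a * (e \<bullet> z))) *\<^sub>R e"
      by (simp add: V[of "V *v z"]) (simp add: V matrix_vector_right_distrib matrix_vector_mult_scaleR inner_add_right eSz ee)
    also have "\<dots> = M *v z + (a * (2 * sqrt \<epsilon> + a) * (e \<bullet> z)) *\<^sub>R e"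
    proof -
      have coef: "a * (2 * sqrt \<epsilon> + a) * (e \<bullet> z) = a * (e \<bullet> z) * sqrt \<epsilon> + a * (sqrt \<epsilon> * (e \<bullet> z) + a * (e \<bullet> z))"
        by (simp add: algebra_simps)
      show ?thesis unfolding coef by (simp add: matrix_vector_mul_assoc S(2) Se scaleR_left_distrib)
    qed
    also have "\<dots> = (M + (h - \<epsilon>) *\<^sub>R outer e e) *v z"
      unfolding a2 by (simp add: matrix_vector_mult_add_rdistrib scaleR_matrix_vector_assoc[symmetric] outer_vector_mult)
    finally show "(V ** V) *v z = (M + (h - \<epsilon>) *\<^sub>R outer e e) *v z" .
  qed
  have Ve: "V *v e = sqrt h *\<^sub>R e" by (simp add: V Se ee a_def algebra_simps)
  have Vp: "V *v perp e z = S *v perp e z" by (simp add: V inner_perp[OF e])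
  have "V *v (perp e z + (sqrt (\<epsilon> / h) * (e \<bullet> z)) *\<^sub>R e) = S *v perp e z + (sqrt (\<epsilon> / h) * (e \<bullet> z) * sqrt h) *\<^sub>R e"
    by (simp add: matrix_vector_right_distrib matrix_vector_mult_scaleR Ve Vp)
  also have "sqrt (\<epsilon> / h) * (e \<bullet> z) * sqrt h = sqrt \<epsilon> * (e \<bullet> z)"
    using h by (simp add: real_sqrt_divide)
  also have "S *v perp e z + (sqrt \<epsilon> * (e \<bullet> z)) *\<^sub>R e = S *v (perp e z + (e \<bullet> z) *\<^sub>R e)"
    by (simp add: matrix_vector_right_distrib matrix_vector_mult_scaleR Se)
  also have "perp e z + (e \<bullet> z) *\<^sub>R e = z" by (simp add: perp_def)
  finally show "V *v (perp e z + (sqrt (\<epsilon> / h) * (e \<bullet> z)) *\<^sub>R e) = matrix_sqrt M *v z"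
    by (simp add: S_def)
qed

section \<open>The value at an almost degenerate matrix\<close>

text \<open>
  For each unit \<open>w\<close> the hyperplane bound is applied to \<open>f \<circ> V\<close> and then fed into the superposition theorem in
  direction \<open>e\<close>. The numbers: the compression lies in the cone with at least half of the undisturbed value, so the pointwise bound loses
  at most a factor \<open>7/10\<close>; the reflection error is at most \<open>9/16\<close>; and \<open>2 * 7/10 - 9/16 \<ge> 4/5\<close>.
\<close>

theorem degenerate_value_bound:
  fixes u :: "real^'n \<Rightarrow> real" and M :: "real^'n^'n" and x :: "real^'n"
  assumes n: "2 \<le> CARD('n)" and s: "1 / 2 < s" "s < 1"
    and lip: "L-lipschitz_on UNIV u" and semi: "semiconcave SC u" and \<eta>: "0 < \<eta>0"
    and visc: "viscosity_ge s u \<eta>0 x" and M: "M \<in> M2"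
  defines "\<eta>' \<equiv> \<eta>0 / (1 - s)"
    and "Z1 \<equiv> const_C1 s L SC * const_C2 CARD('n) s"
    and "Z2 \<equiv> const_C3 CARD('n) s * (const_mu1 CARD('n) s L SC / (1 - s))"
    and "\<epsilon> \<equiv> lambda_min M" and "f \<equiv> second_diff u x"
  assumes e1: "0 < e1" "e1 powr s * Z1 = \<eta>' / 2" and Z: "0 < Z1" "0 < Z2"
  defines "h1 \<equiv> companion CARD('n) e1"
  defines "m \<equiv> \<eta>' / (2 * h1 powr s * Z2)"
  assumes m: "m powr (1 / s) \<le> min 1 (e1 / h1)"
    and \<epsilon>m: "45 * \<epsilon>\<^sup>2 \<le> m powr (1 / s)" "135 * \<epsilon>\<^sup>2 \<le> 1"
  obtains h where "1 \<le> 4 * \<epsilon> * h" "0 < h"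
    "kernel_integral s (\<lambda>z. - f (matrix_sqrt M *v z)) + ennreal (8 / 5 * m * h powr s * Z2)
      \<le> kernel_integral s (\<lambda>z. f (matrix_sqrt M *v z))"
proof -
  have SC: "0 \<le> SC" and contu: "continuous_on UNIV u" using semi by (auto simp: semiconcave_def)
  have L: "0 \<le> L" using lipschitz_on_nonneg[OF lip] .
  have f[measurable]: "f \<in> borel_measurable borel"
    unfolding f_def by (rule borel_measurable_second_diff[OF contu])
  define N where "N = real CARD('n)"
  have N: "2 \<le> N" using n by (simp add: N_def)
  have \<eta>': "0 < \<eta>'" using \<eta> s by (simp add: \<eta>'_def)
  have h1: "0 < h1" unfolding h1_def using companion_facts(1)[OF N e1(1)] by (simp add: N_def)
  have m0: "0 < m" using \<eta>' h1 Z by (simp add: m_def)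
  obtain e where e: "norm e = 1" "M *v e = \<epsilon> *\<^sub>R e" "0 < \<epsilon>"
    "CARD('n) = 2 \<Longrightarrow> M \<bullet> M = \<epsilon>\<^sup>2 + (trace M - \<epsilon>)\<^sup>2"
    using lambda_min_eigenvector[OF n M] unfolding \<epsilon>_def by metis
  define h where "h = (trace M - \<epsilon>) / (real CARD('n) - 1)"
  define \<Delta> where "\<Delta> = M + (h - \<epsilon>) *\<^sub>R outer e e - mat h"
  note dev = M2_deviation[OF n M e(1,2,3), folded h_def, folded \<Delta>_def]
  have h: "0 < h" by (rule dev(2))
  define V where "V = matrix_sqrt M + (sqrt h - sqrt \<epsilon>) *\<^sub>R outer e e"
  note V = stretched_sqrt[OF n M e(1,2,3) h, folded V_def]
  have D: "V ** V = mat h + \<Delta>" by (simp add: V(2) \<Delta>_def)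
  \<comment> \<open>\<open>\<epsilon>1\<close> is lowered to the minimum of the companion function if it lies beyond; this keeps the matrix away from the cone boundary\<close>
  obtain es where es: "0 < es" "es \<le> e1" "companion N es \<le> h1"
    "es / companion N es * (N - 2) \<le> N - 1" "min 1 (e1 / h1) \<le> es / companion N es"
    using companion_optimal[OF N e1(1)] unfolding h1_def N_def by blast
  define hs where "hs = companion N es"
  define \<kappa> where "\<kappa> = es / hs"
  have hs: "0 < hs" "2 * \<kappa> - \<kappa>\<^sup>2 * (N - 2) / (N - 1) = 1 / (2 * hs\<^sup>2)"
    using companion_facts(1,3)[OF N es(1)] by (simp_all add: hs_def \<kappa>_def)
  have \<kappa>: "0 < \<kappa>" "\<kappa> * (N - 2) \<le> N - 1" "45 * \<epsilon>\<^sup>2 \<le> \<kappa>"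
    using es hs(1) m \<epsilon>m(1) by (auto simp: \<kappa>_def hs_def)
  define k where "k = sqrt \<kappa>"
  have k: "0 < k" "k\<^sup>2 = \<kappa>" using \<kappa> by (simp_all add: k_def)
  define d where "d = \<Delta> \<bullet> \<Delta> / h\<^sup>2"
  have d: "d \<le> 2 * \<epsilon>\<^sup>2" using dev(6) h by (simp add: d_def divide_le_eq)
  have Nd: "N = 2 \<and> d = 0 \<or> 3 \<le> N"
  proof (cases "CARD('n) = 2")
    case True
    then have "\<Delta> \<bullet> \<Delta> = 0" unfolding dev(5) e(4)[OF True] by (simp add: h_def)
    then show ?thesis using True by (simp add: d_def N_def)
  next
    case False
    then have "3 \<le> CARD('n)" using n by simp
    then show ?thesis by (simp add: N_def)
  qed
  define U where "U = (h / hs) powr s"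
  have U: "0 < U" using h hs by (simp add: U_def)
  \<comment> \<open>the factor between the hyperplane integrals of \<open>f \<circ> V\<close> and of the majorant\<close>
  define c0 where "c0 = 8 / 5 * m * h powr s"
  have c0: "0 \<le> c0" using m0 by (simp add: c0_def)
  have c0U: "c0 * Z2 \<le> 4 / 5 * U * \<eta>'"
  proof -
    have "(h / h1) powr s \<le> U" unfolding U_def
      using h hs es(3) s by (intro powr_mono2 divide_left_mono) (auto simp: hs_def h1)
    moreover have "c0 * Z2 = 4 / 5 * (h / h1) powr s * \<eta>'"
      using Z h1 h by (simp add: c0_def m_def powr_divide)
    ultimately show ?thesis using \<eta>' by simp
  qed
  have plane: "kernel_integral s (\<lambda>y. - f (V *v perp w y)) + ennreal c0 * kernel_integral s (\<lambda>y. rho L SC (norm (perp w y)))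
      \<le> kernel_integral s (\<lambda>y. f (V *v perp w y))" if w: "norm w = 1" for w
  proof -
    define q where "q = (w \<bullet> (\<Delta> *v w)) / h"
    define S where "S = (norm (\<Delta> *v w))\<^sup>2 / h\<^sup>2"
    have wq: "w \<bullet> (\<Delta> *v w) = h * q" and wS: "(norm (\<Delta> *v w))\<^sup>2 = h\<^sup>2 * S" and dd: "\<Delta> \<bullet> \<Delta> = h\<^sup>2 * d"
      using h by (simp_all add: q_def S_def d_def)
    have "\<bar>w \<bullet> (\<Delta> *v w)\<bar> \<le> norm (\<Delta> *v w)"
      using Cauchy_Schwarz_ineq2[of w "\<Delta> *v w"] w by simp
    then have "(w \<bullet> (\<Delta> *v w))\<^sup>2 \<le> (norm (\<Delta> *v w))\<^sup>2" by (simp add: abs_le_square_iff[symmetric])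
    then have qS: "q\<^sup>2 \<le> S" unfolding q_def S_def power_divide by (intro divide_right_mono) auto
    have Sd: "S \<le> d" unfolding S_def d_def
      using norm_matrix_vector_le_frobenius[OF dev(4) w] by (intro divide_right_mono) auto
    note est = cone_estimate[OF Nd \<kappa>(1,2) qS Sd d \<kappa>(3) \<epsilon>m(2)]
    define X where "X = V ** (mat 1 + (k - 1) *\<^sub>R outer w w)"
    define B where "B = V ** V - (1 - \<kappa>) *\<^sub>R outer (V *v w) (V *v w)"
    note X = compressed_square[OF V(1) w, of k, folded X_def, unfolded k(2), folded B_def]
    note inv1 = rank_one_update_invariants(1)[OF V(1) D dev(3) w, unfolded wq]
    note inv = rank_one_update_invariants(2,3,4)[OF V(1) D dev(3) w, of "1 - \<kappa>", folded B_def, unfolded wq wS dd]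
    have Vw: "(norm (V *v w))\<^sup>2 = h * (1 + q)" using inv1 by (simp add: algebra_simps)
    have q1: "7 / 8 \<le> 1 + q" "1 + q \<le> 9 / 8" using est(1) by auto
    have trB: "trace B = h * (N - (1 - \<kappa>) * (1 + q))" using inv(1) by (simp add: N_def algebra_simps)
    have BB: "B \<bullet> B = h\<^sup>2 * (N + d - 2 * (1 - \<kappa>) * (1 + 2 * q + S) + (1 - \<kappa>)\<^sup>2 * (1 + q)\<^sup>2)"
      using inv(2) by (simp add: N_def algebra_simps power2_eq_square)
    \<comment> \<open>\<open>B\<close> divided by \<open>sqrt (2 Q)\<close> lies on the quadric\<close>
    define Q where "Q = (trace B)\<^sup>2 / (N - 1) - B \<bullet> B"
    have Q: "h\<^sup>2 / (4 * hs\<^sup>2) \<le> Q"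
    proof -
      have "Q = h\<^sup>2 * ((N - (1 - \<kappa>) * (1 + q))\<^sup>2 / (N - 1)
          - (N + d - 2 * (1 - \<kappa>) * (1 + 2 * q + S) + (1 - \<kappa>)\<^sup>2 * (1 + q)\<^sup>2))"
        unfolding Q_def trB BB power_mult_distrib by (simp only: right_diff_distrib times_divide_eq_right)
      moreover have "h\<^sup>2 * (1 / (2 * hs\<^sup>2) / 2) \<le> h\<^sup>2 * ((N - (1 - \<kappa>) * (1 + q))\<^sup>2 / (N - 1)
          - (N + d - 2 * (1 - \<kappa>) * (1 + 2 * q + S) + (1 - \<kappa>)\<^sup>2 * (1 + q)\<^sup>2))"
        by (rule mult_left_mono) (use est(2) in \<open>simp_all add: hs(2)\<close>)
      ultimately show ?thesis by simp
    qed
    have Qpos: "0 < Q" by (rule less_le_trans[OF _ Q]) (use h hs in simp)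
    define c where "c = sqrt (2 * Q)"
    have c: "0 < c" "c\<^sup>2 = 2 * Q" using Qpos by (simp_all add: c_def)
    have trpos: "0 < trace B"
    proof -
      have "N - (1 - \<kappa>) * (1 + q) = (N - 1) - q + \<kappa> * (1 + q)" by (simp add: algebra_simps)
      moreover have "0 < \<kappa> * (1 + q)" using \<kappa>(1) q1 by simp
      ultimately have "0 < N - (1 - \<kappa>) * (1 + q)" using N q1 by linarith
      then show ?thesis unfolding trB using h by simp
    qed
    have M': "(1 / c) *\<^sub>R B \<in> M2"
      by (rule scaled_matrix_in_M2[OF n inv(3) trpos c(1)]) (simp add: c(2) Q_def N_def)
    have XX: "X ** transpose X = c *\<^sub>R ((1 / c) *\<^sub>R B)" using X(2) c(1) by simp
    have thick: "kernel_integral s (\<lambda>z. - f (V *v (perp w z + (k * (w \<bullet> z)) *\<^sub>R w))) + ennreal (2 * c powr s * \<eta>')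
        \<le> kernel_integral s (\<lambda>z. f (V *v (perp w z + (k * (w \<bullet> z)) *\<^sub>R w)))"
      using viscosity_pointwise_linear[OF n s lip semi \<eta> visc M' XX c(1)] by (simp only: X(1) f_def \<eta>'_def)
    have Vpos: "0 < norm (V *v w)"
    proof -
      have "0 < (norm (V *v w))\<^sup>2" unfolding Vw using h q1 by simp
      then show ?thesis by (simp add: zero_less_power2)
    qed
    define b where "b = (k * norm (V *v w)) powr (2 * s) * Z1"
    have hyper: "kernel_integral s (\<lambda>z. - f (V *v perp w z)) + ennreal (2 * c powr s * \<eta>')
        \<le> kernel_integral s (\<lambda>z. f (V *v perp w z)) + ennreal b"
      using hyperplane_lower_bound[OF n s lip semi w less_imp_le[OF k(1)] Vpos, of x] thick
      unfolding f_def[symmetric] Z1_def b_def by blast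
    \<comment> \<open>the reflection error, estimated by \<open>|V w|^2 = h (1 + q) \<le> 9 h / 8\<close> and \<open>\<epsilon>1^s Z1 = \<eta>'/2\<close>\<close>
    have b: "b \<le> 9 / 16 * U * \<eta>'" "0 \<le> b"
    proof -
      have "(k * norm (V *v w)) powr (2 * s) = ((k * norm (V *v w))\<^sup>2) powr s"
        using power2_powr_half[of "k * norm (V *v w)" "2 * s"] k(1) by simp
      also have "(k * norm (V *v w))\<^sup>2 = es * (h / hs) * (1 + q)"
        by (simp add: power_mult_distrib k(2) Vw \<kappa>_def)
      also have "\<dots> powr s = es powr s * U * (1 + q) powr s"
        by (simp only: powr_mult U_def)
      finally have eq: "b = es powr s * Z1 * U * (1 + q) powr s" by (simp add: b_def mult_ac)
      have "(1 + q) powr s \<le> (9 / 8) powr s" using q1 s by (intro powr_mono2) auto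
      also have "\<dots> \<le> (9 / 8) powr 1" using s by (intro powr_mono) auto
      finally have q98: "(1 + q) powr s \<le> 9 / 8" by simp
      have "es powr s * Z1 \<le> e1 powr s * Z1"
        using es s Z by (intro mult_right_mono powr_mono2) auto
      then have "es powr s * Z1 \<le> \<eta>' / 2" using e1 by simp
      then have "b \<le> \<eta>' / 2 * U * (9 / 8)"
        unfolding eq using U q98 Z \<eta>' by (intro mult_mono) auto
      then show "b \<le> 9 / 16 * U * \<eta>'" by (simp add: mult_ac)
      show "0 \<le> b" unfolding eq using Z U by simp
    qed
    \<comment> \<open>\<open>7/10\<close> is below the square root of \<open>1/2\<close>, the fraction left by the cone estimate\<close>
    have cU: "7 / 10 * U \<le> c powr s"
    proof -
      have "(7 / 10 * (h / hs))\<^sup>2 \<le> c\<^sup>2"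
      proof -
        define W where "W = (h / hs)\<^sup>2"
        have "h\<^sup>2 / (4 * hs\<^sup>2) = W / 4" by (simp add: W_def power_divide)
        then have "W / 2 \<le> c\<^sup>2" using Q by (simp add: c(2))
        moreover have "(7 / 10 * (h / hs))\<^sup>2 = 49 / 100 * W"
          unfolding W_def power_mult_distrib by (simp add: power2_eq_square)
        moreover have "0 \<le> W" by (simp add: W_def)
        ultimately show ?thesis by linarith
      qed
      then have "7 / 10 * (h / hs) \<le> c" by (rule power2_le_imp_le) (use c in simp)
      then have "(7 / 10 * (h / hs)) powr s \<le> c powr s" using h hs s by (intro powr_mono2) auto
      moreover have "(7 / 10 * (h / hs)) powr s = (7 / 10) powr s * U" by (simp only: powr_mult U_def)
      moreover have "(7 / 10) powr 1 \<le> (7 / 10 :: real) powr s" using s by (intro powr_mono') auto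
      then have "7 / 10 * U \<le> (7 / 10) powr s * U" using U by (intro mult_right_mono) auto
      ultimately show ?thesis by linarith
    qed
    have "c0 * Z2 + b \<le> 2 * c powr s * \<eta>'"
    proof -
      have "7 / 10 * U * \<eta>' \<le> c powr s * \<eta>'" using cU \<eta>' by (intro mult_right_mono) auto
      moreover have "0 < U * \<eta>'" using U \<eta>' by simp
      ultimately show ?thesis using c0U b(1) by (simp add: mult.assoc)
    qed
    then have "ennreal (c0 * Z2 + b) \<le> ennreal (2 * c powr s * \<eta>')" by (rule ennreal_leI)
    moreover have "ennreal (c0 * Z2 + b) = ennreal (c0 * Z2) + ennreal b"
      using c0 Z b(2) by (intro ennreal_plus) auto
    ultimately have "ennreal (c0 * Z2) + ennreal b \<le> ennreal (2 * c powr s * \<eta>')" by (simp only:)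
    from add_left_mono[OF this, of "kernel_integral s (\<lambda>z. - f (V *v perp w z))"]
    have "ennreal b + (kernel_integral s (\<lambda>z. - f (V *v perp w z)) + ennreal (c0 * Z2))
        \<le> kernel_integral s (\<lambda>z. - f (V *v perp w z)) + ennreal (2 * c powr s * \<eta>')"
      by (simp only: add_ac)
    also have "\<dots> \<le> ennreal b + kernel_integral s (\<lambda>z. f (V *v perp w z))"
      using hyper by (simp add: add.commute)
    finally have "kernel_integral s (\<lambda>z. - f (V *v perp w z)) + ennreal (c0 * Z2) \<le> kernel_integral s (\<lambda>z. f (V *v perp w z))"
      by (simp add: ennreal_add_left_cancel_le)
    moreover have "ennreal (c0 * Z2) = ennreal c0 * kernel_integral s (\<lambda>y. rho L SC (norm (perp w y)))"
      using kernel_integral_rho_tangential[OF s L SC n w] c0 by (simp only: Z2_def ennreal_mult')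
    ultimately show ?thesis by simp
  qed
  \<comment> \<open>shrinking the direction \<open>e\<close> by \<open>t\<close> before applying \<open>V\<close> gives back the square root of \<open>M\<close>\<close>
  define t where "t = sqrt (\<epsilon> / h)"
  have "\<epsilon> < h"
  proof (rule ccontr)
    assume "\<not> \<epsilon> < h"
    then have "\<epsilon> * h \<le> \<epsilon> * \<epsilon>" using e(3) by (intro mult_left_mono) auto
    then show False using dev(1) \<epsilon>m(2) by (simp add: power2_eq_square)
  qed
  then have t: "0 < t" "t < 1" using e(3) h by (simp_all add: t_def)
  have s0: "0 < s" using s by simp
  have "kernel_integral s (\<lambda>z. - f (V *v (perp e z + (t * (e \<bullet> z)) *\<^sub>R e)))
      + ennreal c0 * kernel_integral s (\<lambda>z. rho L SC (norm (perp e z + (t * (e \<bullet> z)) *\<^sub>R e)))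
    \<le> kernel_integral s (\<lambda>z. f (V *v (perp e z + (t * (e \<bullet> z)) *\<^sub>R e)))"
    by (rule kernel_integral_lower_bound_from_hyperplanes[OF n s0 e(1) t, where F="\<lambda>y. f (V *v y)" and W="\<lambda>y. rho L SC (norm y)"])
       (use plane in auto)
  then have main: "kernel_integral s (\<lambda>z. - f (matrix_sqrt M *v z))
      + ennreal c0 * kernel_integral s (\<lambda>z. rho L SC (norm (perp e z + (t * (e \<bullet> z)) *\<^sub>R e)))
    \<le> kernel_integral s (\<lambda>z. f (matrix_sqrt M *v z))"
    by (simp only: t_def V(3))
  have "kernel_integral s (\<lambda>z. rho L SC (norm (perp e z)))
      \<le> kernel_integral s (\<lambda>z. rho L SC (norm (perp e z + (t * (e \<bullet> z)) *\<^sub>R e)))"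
  proof (rule kernel_integral_mono)
    fix z
    have "norm (perp e z) \<le> norm (perp e z + (t * (e \<bullet> z)) *\<^sub>R e)"
      using norm_perp_le[OF e(1), of "perp e z + (t * (e \<bullet> z)) *\<^sub>R e"]
      by (simp add: perp_add_multiple[OF e(1) inner_perp[OF e(1)]])
    then show "rho L SC (norm (perp e z)) \<le> rho L SC (norm (perp e z + (t * (e \<bullet> z)) *\<^sub>R e))"
      by (intro rho_mono L SC) auto
  qed
  then have "ennreal (c0 * Z2) \<le> ennreal c0 * kernel_integral s (\<lambda>z. rho L SC (norm (perp e z + (t * (e \<bullet> z)) *\<^sub>R e)))"
    unfolding kernel_integral_rho_tangential[OF s L SC n e(1)] Z2_def[symmetric]
    using c0 by (subst ennreal_mult') (auto intro: mult_left_mono)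
  then have "kernel_integral s (\<lambda>z. - f (matrix_sqrt M *v z)) + ennreal (c0 * Z2)
      \<le> kernel_integral s (\<lambda>z. f (matrix_sqrt M *v z))"
    using main by (meson add_left_mono order_trans)
  then show ?thesis using that[OF dev(1) h] by (simp only: c0_def)
qed

section \<open>Estimates for the constants\<close>

lemma kernel_integral_rho_scaled:
  fixes c :: real
  assumes c: "0 < c"
  shows "kernel_integral s (\<lambda>z::real^'n. rho L SC (norm (sqrt c *\<^sub>R z)))
    = ennreal (c powr s) * kernel_integral s (\<lambda>z::real^'n. rho L SC (norm z))"
proof -
  have "(sqrt c) powr (2 * s) = c powr s"
    using power2_powr_half[of "sqrt c" "2 * s"] c by simp
  then show ?thesis
    using kernel_integral_scale[of "sqrt c" "\<lambda>z::real^'n. rho L SC (norm z)" s] c by simp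
qed

text \<open>
  The identity matrix up to scaling shows that the kernel integral of the majorant, and hence all the constants, are positive.
  The matrix with eigenvalue \<open>\<epsilon>1\<close> once and its companion otherwise gives
  \<open>2\<eta>' \<le> \<epsilon>1^s Z1 + h1^s Z2\<close> with \<open>\<epsilon>1^s Z1 = \<eta>'/2\<close>, which means \<open>\<mu>0/\<mu>1 \<le> 1/3\<close>.
\<close>

theorem constants_estimates:
  fixes u :: "real^'n \<Rightarrow> real" and x :: "real^'n"
  assumes n: "2 \<le> CARD('n)" and s: "1 / 2 < s" "s < 1"
    and lip: "L-lipschitz_on UNIV u" and semi: "semiconcave SC u" and \<eta>: "0 < \<eta>0"
    and visc: "viscosity_ge s u \<eta>0 x"
  defines "\<eta>' \<equiv> \<eta>0 / (1 - s)"
    and "Z1 \<equiv> const_C1 s L SC * const_C2 CARD('n) s"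
    and "Z2 \<equiv> const_C3 CARD('n) s * (const_mu1 CARD('n) s L SC / (1 - s))"
    and "e1 \<equiv> const_eps1 CARD('n) s \<eta>0 L SC"
    and "m \<equiv> const_mu0 CARD('n) s \<eta>0 L SC / const_mu1 CARD('n) s L SC"
  shows "0 < Z1" "0 < Z2" "0 < e1" "e1 powr s * Z1 = \<eta>' / 2"
    "m = \<eta>' / (2 * companion CARD('n) e1 powr s * Z2)" "0 < m" "m \<le> 1 / 3"
    "m powr (1 / s) \<le> min 1 (e1 / companion CARD('n) e1)"
proof -
  have SC: "0 \<le> SC" and contu: "continuous_on UNIV u" using semi by (auto simp: semiconcave_def)
  have L: "0 \<le> L" using lipschitz_on_nonneg[OF lip] .
  define f where "f = second_diff u x"
  define N where "N = real CARD('n)"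
  have N: "2 \<le> N" using n by (simp add: N_def)
  have \<eta>': "0 < \<eta>'" using \<eta> s by (simp add: \<eta>'_def)
  have C3: "0 < const_C3 CARD('n) s" by (rule const_C3_nn) (use s in auto)
  have lower: "ennreal (2 * \<eta>') \<le> kernel_integral s (\<lambda>z. rho L SC (norm (X *v z)))"
    if M: "M \<in> M2" and X: "X ** transpose X = M" for M X :: "real^'n^'n"
  proof -
    have X1: "X ** transpose X = 1 *\<^sub>R M" using X by simp
    have "ennreal (2 * \<eta>') \<le> kernel_integral s (\<lambda>z. - f (X *v z)) + ennreal (2 * \<eta>')"
      by (rule add_increasing[OF zero_le order_refl])
    also have "\<dots> \<le> kernel_integral s (\<lambda>z. f (X *v z))"
      using viscosity_pointwise_linear[OF n s lip semi \<eta> visc M X1 zero_less_one]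
      by (simp add: f_def \<eta>'_def)
    also have "\<dots> \<le> kernel_integral s (\<lambda>z. rho L SC (norm (X *v z)))"
      unfolding f_def by (intro kernel_integral_mono second_diff_le_rho[OF lip semi])
    finally show ?thesis .
  qed
  define \<gamma> where "\<gamma> = sqrt ((real CARD('n) - 1) / (2 * real CARD('n)))"
  have \<gamma>: "0 < \<gamma>" using N by (simp add: \<gamma>_def N_def)
  define A where "A = kernel_integral s (\<lambda>z::real^'n. rho L SC (norm z))"
  have A1: "A \<le> ennreal (N * Z1)" unfolding A_def N_def Z1_def by (rule kernel_integral_rho_finite[OF s L SC n])
  have A2: "ennreal (N - 1) * A \<le> ennreal (N * Z2)"
    unfolding A_def N_def Z2_def by (rule kernel_integral_rho_le_tangential[OF s L SC n])
  have A0: "0 < A"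
  proof -
    have iso: "mat \<gamma> \<in> (M2 :: (real^'n^'n) set)" unfolding \<gamma>_def by (rule isotropic_in_M2[OF n])
    have "mat (sqrt \<gamma>) ** transpose (mat (sqrt \<gamma>)) = (mat \<gamma> :: real^'n^'n)"
      using \<gamma> by (intro matrix_eq[THEN iffD2] allI)
        (simp add: transpose_mat matrix_vector_mul_assoc[symmetric] mat_vector_mult)
    from lower[OF iso this] have "ennreal (2 * \<eta>') \<le> ennreal (\<gamma> powr s) * A"
      by (simp only: mat_vector_mult kernel_integral_rho_scaled[OF \<gamma>] A_def)
    moreover have "0 < ennreal (2 * \<eta>')" using \<eta>' by simp
    ultimately show ?thesis by (metis less_le_trans mult_zero_right not_gr_zero)
  qed
  have "0 < ennreal (N * Z1)" by (rule less_le_trans[OF A0 A1])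
  then show Z1: "0 < Z1" using N by (simp add: zero_less_mult_iff)
  have "0 < ennreal (N - 1) * A" using A0 N by (simp add: ennreal_zero_less_mult_iff)
  then have "0 < ennreal (N * Z2)" using A2 by (rule less_le_trans)
  then show Z2: "0 < Z2" using N by (simp add: zero_less_mult_iff)
  have e1_eq: "e1 = (\<eta>' / (2 * Z1)) powr (1 / s)"
  proof -
    have "\<eta>0 / (2 * (1 - s) * const_C1 s L SC * const_C2 CARD('n) s) = \<eta>' / (2 * Z1)"
      unfolding \<eta>'_def Z1_def by (simp only: divide_divide_eq_left mult_ac)
    then show ?thesis by (simp only: e1_def const_eps1_def)
  qed
  show e1: "0 < e1" unfolding e1_eq using \<eta>' Z1 by simp
  have e1s: "e1 powr s = \<eta>' / (2 * Z1)"
    unfolding e1_eq using s \<eta>' Z1 by (simp add: powr_powr)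
  then show e1Z: "e1 powr s * Z1 = \<eta>' / 2" using Z1 by simp
  define h1 where "h1 = companion CARD('n) e1"
  have h1: "0 < h1" unfolding h1_def using companion_facts(1)[OF N e1] by (simp add: N_def)
  have m: "m = \<eta>' / (2 * h1 powr s * Z2)"
  proof -
    have g: "fun_g CARD('n) e1 powr (2 * s) = 1 / h1 powr s"
    proof -
      have "fun_g CARD('n) e1 = h1 powr (- 1 / 2)" by (simp add: fun_g_def h1_def companion_def)
      then have "fun_g CARD('n) e1 powr (2 * s) = h1 powr (- s)" by (simp add: powr_powr)
      then show ?thesis by (simp only: powr_minus_divide)
    qed
    show ?thesis unfolding m_def const_mu0_def e1_def[symmetric] g Z2_def \<eta>'_def using s by simp
  qed
  then show "m = \<eta>' / (2 * companion CARD('n) e1 powr s * Z2)" by (simp only: h1_def)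
  show m0: "0 < m" unfolding m using \<eta>' h1 Z2 by simp
  have key: "3 / 2 * \<eta>' \<le> h1 powr s * Z2"
  proof -
    define e :: "real^'n" where "e = axis undefined 1"
    have e: "norm e = 1" unfolding e_def by (rule norm_axis_1)
    define V where "V = (mat (sqrt h1) :: real^'n^'n)"
    have V: "transpose V = V" "V *v z = sqrt h1 *\<^sub>R z" for z
      by (simp_all add: V_def transpose_mat mat_vector_mult)
    define k where "k = sqrt (e1 / h1)"
    have k2: "k\<^sup>2 = e1 / h1" and k: "0 \<le> k" using e1 h1 by (simp_all add: k_def)
    note X = compressed_square[OF V(1) e, of k]
    define X where "X = V ** (mat 1 + (k - 1) *\<^sub>R outer e e)"
    have XX: "X ** transpose X = mat h1 + (e1 - h1) *\<^sub>R outer e e"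
    proof -
      have "X ** transpose X = V ** V - (1 - e1 / h1) *\<^sub>R outer (V *v e) (V *v e)"
        unfolding X_def X(2) k2 ..
      also have "outer (V *v e) (V *v e) = h1 *\<^sub>R outer e e"
        using h1 by (simp add: V(2) outer_def vec_eq_iff)
      also have "V ** V = mat h1"
        using h1 by (intro matrix_eq[THEN iffD2] allI) (simp add: matrix_vector_mul_assoc[symmetric] V(2) mat_vector_mult)
      also have "mat h1 - (1 - e1 / h1) *\<^sub>R (h1 *\<^sub>R outer e e) = mat h1 + (e1 - h1) *\<^sub>R outer e e"
      proof -
        have "(1 - e1 / h1) * h1 = h1 - e1" using h1 by (simp add: algebra_simps)
        then show ?thesis by (simp add: algebra_simps)
      qed
      finally show ?thesis .
    qed
    have "mat h1 + (e1 - h1) *\<^sub>R outer e e \<in> M2"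
      unfolding h1_def by (rule two_eigenvalue_matrix_in_M2[OF n e e1])
    from lower[OF this XX] have "ennreal (2 * \<eta>') \<le> kernel_integral s (\<lambda>z. rho L SC (norm (X *v z)))" .
    also have "\<dots> \<le> kernel_integral s (\<lambda>z. rho L SC \<bar>e \<bullet> (sqrt e1 *\<^sub>R z)\<bar> + rho L SC (norm (perp e (sqrt h1 *\<^sub>R z))))"
    proof (rule kernel_integral_mono)
      fix z
      have "X *v z = sqrt h1 *\<^sub>R perp e z + (sqrt h1 * k * (e \<bullet> z)) *\<^sub>R e"
        unfolding X_def X(1) by (simp add: V(2) scaleR_right_distrib mult.assoc)
      also have "sqrt h1 * k = sqrt e1" using h1 e1 by (simp add: k_def real_sqrt_divide)
      finally have Xz: "X *v z = perp e (sqrt h1 *\<^sub>R z) + (sqrt e1 * (e \<bullet> z)) *\<^sub>R e" by (simp add: perp_scaleR)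
      have "(norm (X *v z))\<^sup>2 = \<bar>e \<bullet> (sqrt e1 *\<^sub>R z)\<bar>\<^sup>2 + (norm (perp e (sqrt h1 *\<^sub>R z)))\<^sup>2"
        unfolding Xz norm_add_multiple[OF e inner_perp[OF e]] by simp
      then show "rho L SC (norm (X *v z)) \<le> rho L SC \<bar>e \<bullet> (sqrt e1 *\<^sub>R z)\<bar> + rho L SC (norm (perp e (sqrt h1 *\<^sub>R z)))"
        by (intro rho_pythagoras L SC) auto
    qed
    also have "\<dots> = kernel_integral s (\<lambda>z. rho L SC \<bar>e \<bullet> (sqrt e1 *\<^sub>R z)\<bar>)
        + kernel_integral s (\<lambda>z. rho L SC (norm (perp e (sqrt h1 *\<^sub>R z))))"
      by (rule kernel_integral_add) (use L SC in \<open>auto simp: rho_nonneg\<close>)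
    also have "kernel_integral s (\<lambda>z. rho L SC \<bar>e \<bullet> (sqrt e1 *\<^sub>R z)\<bar>) = ennreal (e1 powr s) * ennreal Z1"
    proof -
      have "(sqrt e1) powr (2 * s) = e1 powr s" using power2_powr_half[of "sqrt e1" "2 * s"] e1 by simp
      then show ?thesis
        using kernel_integral_scale[of "sqrt e1" "\<lambda>z. rho L SC \<bar>e \<bullet> z\<bar>" s] e1
          kernel_integral_rho_normal[OF s L SC n e] by (simp add: Z1_def)
    qed
    also have "kernel_integral s (\<lambda>z. rho L SC (norm (perp e (sqrt h1 *\<^sub>R z)))) = ennreal (h1 powr s) * ennreal Z2"
    proof -
      have "(sqrt h1) powr (2 * s) = h1 powr s" using power2_powr_half[of "sqrt h1" "2 * s"] h1 by simp
      then show ?thesis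
        using kernel_integral_scale[of "sqrt h1" "\<lambda>z. rho L SC (norm (perp e z))" s] h1
          kernel_integral_rho_tangential[OF s L SC n e] by (simp add: Z2_def)
    qed
    also have "ennreal (e1 powr s) * ennreal Z1 + ennreal (h1 powr s) * ennreal Z2
        = ennreal (e1 powr s * Z1 + h1 powr s * Z2)"
      using Z1 Z2 by (simp add: ennreal_mult' ennreal_plus)
    finally have "2 * \<eta>' \<le> e1 powr s * Z1 + h1 powr s * Z2"
      using Z1 Z2 by (subst (asm) ennreal_le_iff) auto
    then show ?thesis using e1Z by simp
  qed
  show m13: "m \<le> 1 / 3"
  proof -
    have "0 < 2 * h1 powr s * Z2" using h1 Z2 by simp
    then show ?thesis unfolding m using key by (simp add: divide_le_eq)
  qed
  have "m powr (1 / s) \<le> 1" using m0 m13 s by (intro powr_le1) auto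
  moreover have "m powr (1 / s) \<le> e1 / h1"
  proof -
    have Z12: "Z1 \<le> Z2" unfolding Z1_def Z2_def by (rule const_product_le[OF s L SC n])
    have "2 * Z1 * e1 powr s = 2 * (e1 powr s * Z1)" by simp
    then have "\<eta>' = 2 * Z1 * e1 powr s" unfolding e1Z by simp
    then have "m = Z1 / Z2 * (e1 / h1) powr s" unfolding m by (simp add: powr_divide)
    also have "\<dots> \<le> 1 * (e1 / h1) powr s" using Z1 Z12 by (intro mult_right_mono) auto
    finally have "m powr (1 / s) \<le> ((e1 / h1) powr s) powr (1 / s)" using m0 s by (intro powr_mono2) auto
    also have "\<dots> = e1 / h1" using s e1 h1 by (simp add: powr_powr)
    finally show ?thesis .
  qed
  ultimately show "m powr (1 / s) \<le> min 1 (e1 / companion CARD('n) e1)" by (simp add: h1_def)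
qed

text \<open>
  The base of the power is at most \<open>6/5\<close> and the exponent at most \<open>2/3\<close>, and \<open>(6/5)^2 \<le> (17/15)^3\<close>.
\<close>

lemma const_C4_estimate:
  assumes n: "2 \<le> n" and s: "1 / 2 < s" and m: "0 < m" "m \<le> 1 / 3"
    and m_eq: "m = const_mu0 n s \<eta>0 L SC / const_mu1 n s L SC"
  shows "0 < const_C4 n s \<eta>0 L SC" "(const_C4 n s \<eta>0 L SC)\<^sup>2 \<le> 1 / 30"
proof -
  define a where "a = 2 / (real n + 2 * s)"
  have a: "0 < a" "a \<le> 2 / 3" using n s by (auto simp: a_def divide_le_eq)
  define y where "y = 1 / (1 - m / 2)"
  have y: "1 < y" "y \<le> 6 / 5" using m by (auto simp: y_def divide_le_eq)
  have C4: "const_C4 n s \<eta>0 L SC = 1 / 2 * sqrt (y powr a - 1)"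
  proof -
    have "const_mu0 n s \<eta>0 L SC / (2 * const_mu1 n s L SC) = m / 2" by (simp add: m_eq)
    moreover have "(1 - m / 2) powr (- 2 / (real n + 2 * s)) = y powr a"
    proof -
      have "(1 - m / 2) powr (- a) = y powr a"
        using powr_minus_divide[of "1 - m / 2" a] m by (simp add: y_def powr_divide)
      then show ?thesis by (simp add: a_def)
    qed
    ultimately show ?thesis by (simp only: const_C4_def)
  qed
  have y1: "1 < y powr a" using y a by simp
  then show "0 < const_C4 n s \<eta>0 L SC" by (simp add: C4)
  have "y powr a \<le> (6 / 5) powr a" using y a by (intro powr_mono2) auto
  also have "\<dots> \<le> (6 / 5) powr (2 / 3)" using a by (intro powr_mono) auto
  also have "\<dots> \<le> 17 / 15"
  proof -
    have "((6 / 5 :: real) powr (2 / 3)) ^ 3 \<le> (17 / 15) ^ 3"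
    proof -
      have "((6 / 5 :: real) powr (2 / 3)) ^ 3 = (6 / 5) powr 2" by (simp add: powr_power)
      also have "\<dots> = (6 / 5)\<^sup>2" by simp
      finally show ?thesis by (simp add: power2_eq_square power3_eq_cube)
    qed
    then show ?thesis by (subst (asm) power_mono_iff) auto
  qed
  finally have "y powr a \<le> 17 / 15" .
  then show "(const_C4 n s \<eta>0 L SC)\<^sup>2 \<le> 1 / 30"
    using y1 by (simp add: C4 power_mult_distrib power_divide)
qed

section \<open>Discarding degenerate matrices from the infimum\<close>

text \<open>
  Both parts of the integral are finite: the positive one by the majorant, the negative one by the pointwise bound.
\<close>

lemma ext_integral_real:
  fixes M :: "real^'n^'n" and u :: "real^'n \<Rightarrow> real"
  assumes n: "2 \<le> CARD('n)" and s: "1 / 2 < s" "s < 1"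
    and lip: "L-lipschitz_on UNIV u" and semi: "semiconcave SC u" and \<eta>: "0 < \<eta>0"
    and visc: "viscosity_ge s u \<eta>0 x" and M: "M \<in> M2"
  defines "f \<equiv> second_diff u x"
  obtains p q where "kernel_integral s (\<lambda>z. f (matrix_sqrt M *v z)) = ennreal p"
    "kernel_integral s (\<lambda>z. - f (matrix_sqrt M *v z)) = ennreal q" "0 \<le> p" "0 \<le> q"
    "2 * (\<eta>0 / (1 - s)) \<le> p - q" "integrable lborel (F2_integrand s M u x)"
    "ereal (1 / 2) * ext_integral (F2_integrand s M u x) = ereal ((p - q) / 2)"
proof -
  define c where "c = 2 * (\<eta>0 / (1 - s))"
  have c: "0 < c" using \<eta> s by (simp add: c_def)
  have SC: "0 \<le> SC" and contu: "continuous_on UNIV u" using semi by (auto simp: semiconcave_def)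
  have L: "0 \<le> L" using lipschitz_on_nonneg[OF lip] .
  have u: "u \<in> borel_measurable borel" by (rule borel_measurable_continuous_onI[OF contu])
  define P where "P = kernel_integral s (\<lambda>z. f (matrix_sqrt M *v z))"
  define Q where "Q = kernel_integral s (\<lambda>z. - f (matrix_sqrt M *v z))"
  have le: "Q + ennreal c \<le> P"
    using viscosity_pointwise[OF n s lip semi \<eta> visc M] by (simp only: P_def Q_def f_def c_def)
  have "P \<le> kernel_integral s (\<lambda>z. rho L SC (norm (matrix_sqrt M *v z)))"
    unfolding P_def f_def by (intro kernel_integral_mono second_diff_le_rho[OF lip semi])
  also have "\<dots> < \<infinity>" by (rule kernel_integral_rho_linear_finite[OF s L SC n])
  finally have Pfin: "P < \<infinity>" .
  have "Q \<le> Q + ennreal c" by (rule add_increasing2[OF zero_le order_refl])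
  also note le
  finally have "Q < \<infinity>" using Pfin by (rule le_less_trans)
  obtain p where p: "P = ennreal p" "0 \<le> p" using Pfin by (cases P) auto
  obtain q where q: "Q = ennreal q" "0 \<le> q" using \<open>Q < \<infinity>\<close> by (cases Q) auto
  have "ennreal (q + c) \<le> ennreal p" using le p q c by (simp add: ennreal_plus)
  then have pq: "c \<le> p - q" using p by (simp add: ennreal_le_iff)
  note F2 = ext_integral_F2_integrand[OF n M u, of x f s, unfolded f_def, OF refl, folded f_def, folded P_def Q_def]
  have "second_diff u x \<in> borel_measurable borel" by (rule borel_measurable_second_diff[OF contu])
  then have meas: "F2_integrand s M u x \<in> borel_measurable lborel"
    unfolding F2_integrand_def[abs_def] by measurable
  have int: "integrable lborel (F2_integrand s M u x)"
    unfolding real_integrable_def using meas by (simp add: F2 p(1) q(1))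
  have "ext_integral (F2_integrand s M u x) = ereal (p - q)"
    unfolding ext_integral_def F2 p(1) q(1) using p(2) q(2) by (simp add: enn2ereal_ennreal)
  then have "ereal (1 / 2) * ext_integral (F2_integrand s M u x) = ereal ((p - q) / 2)" by simp
  with p q pq int that[of p q] show ?thesis by (simp only: P_def Q_def c_def)
qed

lemma isotropic_value_le:
  fixes u :: "real^'n \<Rightarrow> real"
  assumes n: "2 \<le> CARD('n)" and lip: "L-lipschitz_on UNIV u" and semi: "semiconcave SC u"
    and \<gamma>: "0 < \<gamma>" "mat \<gamma> \<in> (M2 :: (real^'n^'n) set)"
  shows "kernel_integral s (\<lambda>z. second_diff u x (matrix_sqrt (mat \<gamma> :: real^'n^'n) *v z))
    \<le> ennreal (\<gamma> powr s) * kernel_integral s (\<lambda>z::real^'n. rho L SC (norm z))"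
proof -
  define S where "S = matrix_sqrt (mat \<gamma> :: real^'n^'n)"
  have S: "\<And>v. v \<noteq> 0 \<Longrightarrow> 0 < v \<bullet> (S *v v)" "S ** S = mat \<gamma>"
    unfolding S_def using M2_sqrt[OF n \<gamma>(2)] by blast+
  have psd: "0 \<le> v \<bullet> (S *v v)" for v using S(1)[of v] by (cases "v = 0") auto
  have Sz: "S *v z = sqrt \<gamma> *\<^sub>R z" for z
    by (rule psd_sqrt_eigenvector[OF psd S(2) mat_vector_mult \<gamma>(1)])
  have "kernel_integral s (\<lambda>z. second_diff u x (S *v z)) \<le> kernel_integral s (\<lambda>z::real^'n. rho L SC (norm (sqrt \<gamma> *\<^sub>R z)))"
    unfolding Sz by (intro kernel_integral_mono second_diff_le_rho[OF lip semi])
  then show ?thesis by (simp only: S_def kernel_integral_rho_scaled[OF \<gamma>(1)])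
qed

text \<open>
  The first two estimates provide the smallness of \<open>\<epsilon>\<close> assumed in the cone estimate. The last one compares the value at the multiple
  of the identity with the lower bound for degenerate matrices; it rests on \<open>\<gamma>^2 n/(n-1) = 1/2\<close> for the identity factor \<open>\<gamma>\<close>.
\<close>

theorem eps0_estimates:
  fixes N s m C4 :: real
  assumes N: "2 \<le> N" and s: "1 / 2 < s" "s < 1" and m: "0 < m" "m \<le> 1 / 3" and C4: "0 < C4" "C4\<^sup>2 \<le> 1 / 30"
  defines "e0 \<equiv> sqrt (N / (N - 1)) * C4 powr (1 / s) * m powr (1 / s)"
  assumes \<epsilon>: "0 < \<epsilon>" "\<epsilon> \<le> e0"
  shows "45 * \<epsilon>\<^sup>2 \<le> m powr (1 / s)" "135 * \<epsilon>\<^sup>2 \<le> 1"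
    and "\<And>h. 1 \<le> 4 * \<epsilon> * h \<Longrightarrow> 0 < h \<Longrightarrow>
      sqrt ((N - 1) / (2 * N)) powr s * (N / (N - 1)) \<le> 8 / 5 * m * h powr s"
proof -
  define r where "r = N / (N - 1)"
  have r: "0 < r" "r \<le> 2" using N by (auto simp: r_def divide_le_eq)
  define a where "a = C4 powr (1 / s)"
  define b where "b = m powr (1 / s)"
  have C41: "C4 \<le> 1"
  proof (rule power2_le_imp_le)
    show "C4\<^sup>2 \<le> 1\<^sup>2" using C4(2) by simp
  qed simp
  have s1: "1 \<le> 1 / s" using s by simp
  have "a \<le> C4 powr 1" unfolding a_def using C4 C41 s1 by (intro powr_mono') auto
  then have a: "0 < a" "a \<le> C4" using C4 by (simp_all add: a_def)
  then have "a\<^sup>2 \<le> C4\<^sup>2" by (intro power_mono) auto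
  then have a2: "a\<^sup>2 \<le> 1 / 30" using C4(2) by linarith
  have "b \<le> m powr 1" unfolding b_def using m s1 by (intro powr_mono') auto
  then have b: "0 < b" "b \<le> 1 / 3" using m by (simp_all add: b_def)
  have "\<epsilon>\<^sup>2 \<le> e0\<^sup>2" using \<epsilon> by (intro power_mono) auto
  also have "e0\<^sup>2 = (r * a\<^sup>2) * b\<^sup>2"
    using r by (simp add: e0_def power_mult_distrib a_def b_def r_def)
  also have "\<dots> \<le> (2 * (1 / 30)) * b\<^sup>2" using r a2 by (intro mult_right_mono mult_mono) auto
  finally have \<epsilon>2: "\<epsilon>\<^sup>2 \<le> b\<^sup>2 / 15" by simp
  have bb: "b\<^sup>2 \<le> b * (1 / 3)" unfolding power2_eq_square using b by (intro mult_left_mono) auto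
  show "45 * \<epsilon>\<^sup>2 \<le> m powr (1 / s)" using \<epsilon>2 bb by (simp add: b_def[symmetric])
  show "135 * \<epsilon>\<^sup>2 \<le> 1" using \<epsilon>2 bb b by simp
  fix h :: real assume h: "1 \<le> 4 * \<epsilon> * h" "0 < h"
  define \<gamma> where "\<gamma> = sqrt ((N - 1) / (2 * N))"
  have \<gamma>: "0 < \<gamma>" "\<gamma>\<^sup>2 = (N - 1) / (2 * N)" using N by (simp_all add: \<gamma>_def)
  \<comment> \<open>the base that remains when \<open>h\<close> is replaced by \<open>1/(4\<epsilon>)\<close> and \<open>\<epsilon>\<close> by its bound; it is the square root of 8 in every dimension\<close>
  define R where "R = 4 * \<gamma> * sqrt r"
  have R0: "0 < R" using \<gamma> r by (simp add: R_def)
  have R2: "R\<^sup>2 = 8"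
  proof -
    have half: "\<gamma>\<^sup>2 * r = 1 / 2" unfolding \<gamma>(2) r_def using N by simp
    have "R\<^sup>2 = 16 * (\<gamma>\<^sup>2 * r)" using r by (simp add: R_def power_mult_distrib)
    then show ?thesis unfolding half by simp
  qed
  have R1: "1 \<le> R" by (rule power2_le_imp_le) (use R2 R0 in auto)
  have "R powr s \<le> R powr 1" using R1 s by (intro powr_mono) auto
  then have Rs: "R powr s \<le> R" using R0 by simp
  have "(R * C4)\<^sup>2 \<le> (3 / 5)\<^sup>2" unfolding power_mult_distrib R2 using C4(2) by (simp add: power2_eq_square)
  then have RC: "R * C4 \<le> 3 / 5" by (rule power2_le_imp_le) simp
  have "\<epsilon> powr s \<le> e0 powr s" using \<epsilon> s by (intro powr_mono2) auto
  also have "e0 powr s = sqrt r powr s * (C4 * m)"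
    using s C4 m by (simp add: e0_def powr_mult powr_powr r_def)
  finally have es: "\<epsilon> powr s \<le> sqrt r powr s * (C4 * m)" .
  have "1 powr s \<le> (4 * \<epsilon> * h) powr s" using h s by (intro powr_mono2) auto
  then have "1 \<le> 4 powr s * \<epsilon> powr s * h powr s" by (simp add: powr_mult)
  then have "\<gamma> powr s * r * 1 \<le> \<gamma> powr s * r * (4 powr s * \<epsilon> powr s * h powr s)"
    using r by (intro mult_left_mono) auto
  also have "\<dots> \<le> \<gamma> powr s * r * (4 powr s * (sqrt r powr s * (C4 * m)) * h powr s)"
    using r es by (intro mult_left_mono mult_right_mono) auto
  also have "\<dots> = R powr s * C4 * (r * (m * h powr s))"
    by (simp add: R_def powr_mult mult_ac)
  also have "\<dots> \<le> R * C4 * (r * (m * h powr s))"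
    using Rs C4 r m by (intro mult_right_mono) auto
  also have "\<dots> \<le> 3 / 5 * (2 * (m * h powr s))"
    using RC r m C4 R0 by (intro mult_mono mult_right_mono) auto
  also have "\<dots> \<le> 8 / 5 * m * h powr s" using m by simp
  finally show "sqrt ((N - 1) / (2 * N)) powr s * (N / (N - 1)) \<le> 8 / 5 * m * h powr s"
    by (simp add: \<gamma>_def r_def)
qed

theorem theorem1p4:
  fixes u :: "real^'n \<Rightarrow> real" and \<Omega> :: "(real^'n) set" and s L SC \<eta>0 :: real
  assumes "2 \<le> CARD('n)"
    and "1/2 < s" and "s < 1"
    and "open \<Omega>"
    and "L-lipschitz_on UNIV u"
    and "semiconcave SC u"
    and "0 < \<eta>0"
    and "\<forall>x\<in>\<Omega>. viscosity_ge s u \<eta>0 x"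
  shows "(\<Omega> \<noteq> {} \<longrightarrow> 0 < const_eps0 CARD('n) s \<eta>0 L SC) \<and>
    (\<forall>x\<in>\<Omega>. (\<forall>M\<in>M2. integrable lborel (F2_integrand s M u x)) \<and>
       \<bar>F2 s u x\<bar> \<noteq> \<infinity> \<and>
       F2 s u x = F2_restr (const_eps0 CARD('n) s \<eta>0 L SC) s u x)"
proof -
  note n = assms(1) and s = assms(2,3) and lip = assms(5) and semi = assms(6) and \<eta> = assms(7)
  define N where "N = real CARD('n)"
  have N: "2 \<le> N" using n by (simp add: N_def)
  have SC: "0 \<le> SC" using semi by (auto simp: semiconcave_def)
  have L: "0 \<le> L" using lipschitz_on_nonneg[OF lip] .
  define m where "m = const_mu0 CARD('n) s \<eta>0 L SC / const_mu1 CARD('n) s L SC"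
  define C4 where "C4 = const_C4 CARD('n) s \<eta>0 L SC"
  define e0 where "e0 = const_eps0 CARD('n) s \<eta>0 L SC"
  have e0_eq: "e0 = sqrt (N / (N - 1)) * C4 powr (1 / s) * m powr (1 / s)"
    by (simp add: e0_def const_eps0_def N_def C4_def m_def)
  define \<gamma> where "\<gamma> = sqrt ((N - 1) / (2 * N))"
  have \<gamma>: "0 < \<gamma>" using N by (simp add: \<gamma>_def)
  have iso: "mat \<gamma> \<in> (M2 :: (real^'n^'n) set)" unfolding \<gamma>_def N_def by (rule isotropic_in_M2[OF n])
  define val where "val x M = ereal (1 / 2) * ext_integral (F2_integrand s M u x)" for x and M :: "real^'n^'n"
  have main: "0 < e0 \<and> (\<forall>M\<in>M2. integrable lborel (F2_integrand s M u x)) \<and> \<bar>F2 s u x\<bar> \<noteq> \<infinity> \<and> F2 s u x = F2_restr e0 s u x"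
    if x: "x \<in> \<Omega>" for x
  proof -
    have visc: "viscosity_ge s u \<eta>0 x" using assms(8) x by blast
    note const = constants_estimates[OF n s lip semi \<eta> visc, folded m_def]
    have C4: "0 < C4" "C4\<^sup>2 \<le> 1 / 30"
      using const_C4_estimate[OF n s(1) const(6,7), of \<eta>0 L SC] by (simp_all add: C4_def m_def)
    have e0: "0 < e0" unfolding e0_eq using N C4 const(6) by simp
    note est = eps0_estimates[OF N s const(6,7) C4, folded e0_eq]
    have real: "\<exists>p q. kernel_integral s (\<lambda>z. second_diff u x (matrix_sqrt M *v z)) = ennreal p
      \<and> kernel_integral s (\<lambda>z. - second_diff u x (matrix_sqrt M *v z)) = ennreal q \<and> 0 \<le> p \<and> 0 \<le> q
      \<and> 2 * (\<eta>0 / (1 - s)) \<le> p - q \<and> integrable lborel (F2_integrand s M u x) \<and> val x M = ereal ((p - q) / 2)"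
      if "M \<in> M2" for M
      using ext_integral_real[OF n s lip semi \<eta> visc that] unfolding val_def by metis
    have F2: "F2 s u x = (INF M\<in>M2. val x M)" by (simp add: F2_def val_def)
    have F2r: "F2_restr e0 s u x = (INF M\<in>{M \<in> M2. e0 \<le> lambda_min M}. val x M)"
      by (simp add: F2_restr_def val_def)
    have "e0 \<le> \<gamma>"
    proof (rule power2_le_imp_le)
      have "e0\<^sup>2 \<le> 1 / 4" using est(2)[OF e0 order_refl] by simp
      also have "\<dots> \<le> \<gamma>\<^sup>2" using N by (simp add: \<gamma>_def le_divide_eq)
      finally show "e0\<^sup>2 \<le> \<gamma>\<^sup>2" .
    qed (use \<gamma> in simp)
    then have iso': "mat \<gamma> \<in> {M \<in> M2. e0 \<le> lambda_min (M :: real^'n^'n)}"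
      using iso by (simp add: lambda_min_mat)
    \<comment> \<open>degenerate matrices do not beat the multiple of the identity\<close>
    have small: "val x (mat \<gamma>) \<le> val x M" if M: "M \<in> M2" "lambda_min M < e0" for M
    proof -
      define Z2 where "Z2 = const_C3 CARD('n) s * (const_mu1 CARD('n) s L SC / (1 - s))"
      have Z2: "0 < Z2" using const(2) by (simp add: Z2_def)
      have lpos: "0 < lambda_min M" using lambda_min_eigenvector[OF n M(1)] by metis
      note est' = est[OF lpos less_imp_le[OF M(2)]]
      obtain h where h: "1 \<le> 4 * lambda_min M * h" "0 < h"
        "kernel_integral s (\<lambda>z. - second_diff u x (matrix_sqrt M *v z)) + ennreal (8 / 5 * m * h powr s * Z2)
          \<le> kernel_integral s (\<lambda>z. second_diff u x (matrix_sqrt M *v z))"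
        using degenerate_value_bound[OF n s lip semi \<eta> visc M(1) const(3,4,1,2), folded const(5), OF const(8) est'(1,2)]
        unfolding Z2_def by metis
      obtain p q where p: "kernel_integral s (\<lambda>z. second_diff u x (matrix_sqrt M *v z)) = ennreal p"
        "kernel_integral s (\<lambda>z. - second_diff u x (matrix_sqrt M *v z)) = ennreal q" "0 \<le> p" "0 \<le> q"
        "val x M = ereal ((p - q) / 2)"
        using real[OF M(1)] by metis
      obtain p0 q0 where p0: "kernel_integral s (\<lambda>z. second_diff u x (matrix_sqrt (mat \<gamma>) *v z)) = ennreal p0"
        "0 \<le> p0" "0 \<le> q0" "val x (mat \<gamma>) = ereal ((p0 - q0) / 2)"
        using real[OF iso] by metis
      define c where "c = 8 / 5 * m * h powr s * Z2"
      have c: "0 \<le> c" using const(6) Z2 by (simp add: c_def)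
      have "ennreal (q + c) \<le> ennreal p" 
      proof -
        have "ennreal q + ennreal c \<le> ennreal p" using h(3) unfolding p(1,2) c_def .
        then show ?thesis using p(4) c by (simp add: ennreal_plus)
      qed
      then have cpq: "c \<le> p - q" using p(3) by (simp add: ennreal_le_iff)
      define A where "A = kernel_integral s (\<lambda>z::real^'n. rho L SC (norm z))"
      have "ennreal p0 \<le> ennreal (\<gamma> powr s) * A"
        using isotropic_value_le[OF n lip semi \<gamma> iso, of s x] by (simp add: p0(1) A_def)
      then have "ennreal (N - 1) * ennreal p0 \<le> ennreal (N - 1) * (ennreal (\<gamma> powr s) * A)"
        by (rule mult_left_mono) simp
      also have "\<dots> = ennreal (\<gamma> powr s) * (ennreal (N - 1) * A)" by (simp only: mult_ac)
      also have "\<dots> \<le> ennreal (\<gamma> powr s) * ennreal (N * Z2)"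
        unfolding A_def N_def Z2_def by (intro mult_left_mono kernel_integral_rho_le_tangential[OF s L SC n]) simp
      finally have "ennreal ((N - 1) * p0) \<le> ennreal (\<gamma> powr s * (N * Z2))"
        using N p0(2) by (simp add: ennreal_mult')
      then have "(N - 1) * p0 \<le> \<gamma> powr s * (N * Z2)"
        using N Z2 by (subst (asm) ennreal_le_iff) auto
      then have "p0 \<le> \<gamma> powr s * (N / (N - 1)) * Z2"
        using N by (simp add: le_divide_eq mult_ac)
      also have "\<dots> \<le> 8 / 5 * m * h powr s * Z2"
        using est'(3)[OF h(1,2)] Z2 by (intro mult_right_mono) (simp_all add: \<gamma>_def)
      finally have "p0 \<le> c" by (simp add: c_def)
      then show ?thesis unfolding p(5) p0(4) using cpq p0(3) by simp
    qed
    have "F2 s u x = F2_restr e0 s u x"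
    proof (rule antisym)
      show "F2 s u x \<le> F2_restr e0 s u x"
        unfolding F2 F2r by (rule INF_superset_mono) auto
      show "F2_restr e0 s u x \<le> F2 s u x"
        unfolding F2
      proof (rule INF_greatest)
        fix M assume M: "M \<in> (M2 :: (real^'n^'n) set)"
        show "F2_restr e0 s u x \<le> val x M"
        proof (cases "e0 \<le> lambda_min M")
          case True
          then show ?thesis unfolding F2r using M by (intro INF_lower) simp
        next
          case False
          have "F2_restr e0 s u x \<le> val x (mat \<gamma>)" unfolding F2r by (rule INF_lower[OF iso'])
          also have "\<dots> \<le> val x M" using small[OF M] False by simp
          finally show ?thesis .
        qed
      qed
    qed
    moreover have "\<bar>F2 s u x\<bar> \<noteq> \<infinity>"
    proof -
      have "ereal 0 \<le> F2 s u x" unfolding F2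
      proof (rule INF_greatest)
        fix M assume M: "M \<in> (M2 :: (real^'n^'n) set)"
        have pos: "0 < \<eta>0 / (1 - s)" using \<eta> s by simp
        obtain p q where pq: "2 * (\<eta>0 / (1 - s)) \<le> p - q" "val x M = ereal ((p - q) / 2)"
          using real[OF M] by blast
        have "0 \<le> 2 * (\<eta>0 / (1 - s))" using pos by simp
        also note pq(1)
        finally have "0 \<le> (p - q) / 2" by simp
        then show "ereal 0 \<le> val x M" unfolding pq(2) by simp
      qed
      moreover have "F2 s u x \<le> val x (mat \<gamma>)" unfolding F2 by (rule INF_lower[OF iso])
      moreover obtain r where "val x (mat \<gamma>) = ereal r" using real[OF iso] by blast
      ultimately show ?thesis by (cases "F2 s u x") auto
    qed
    moreover have "\<forall>M\<in>M2. integrable lborel (F2_integrand s M u x)" using real by blast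
    ultimately show ?thesis using e0 by blast
  qed
  show ?thesis unfolding e0_def[symmetric]
  proof (intro conjI impI ballI)
    assume "\<Omega> \<noteq> {}"
    then obtain x where "x \<in> \<Omega>" by blast
    from main[OF this] show "0 < e0" by (rule conjunct1)
  next
    fix x M assume x: "x \<in> \<Omega>" and M: "M \<in> (M2 :: (real^'n^'n) set)"
    from main[OF x] have "\<forall>M\<in>M2. integrable lborel (F2_integrand s M u x)" by (elim conjE)
    with M show "integrable lborel (F2_integrand s M u x)" by (rule bspec[rotated])
  next
    fix x assume x: "x \<in> \<Omega>"
    from main[OF x] show "\<bar>F2 s u x\<bar> \<noteq> \<infinity>" by (elim conjE)
    from main[OF x] show "F2 s u x = F2_restr e0 s u x" by (elim conjE)
  qed
qed

end
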